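(* There is an absolute constant $C>0$ such that, writing $D(x)=\exp[C(\log x)^{1/2}]$, the following holds for each $\eta\in\{-1,1\}$. Fix $\epsilon>0$. For all sufficiently large $x$ there exist at least $D(x)^{1-\epsilon}$ positive integers $d\le D(x)$, each admitting a quadratic Dirichlet character $\chi_d$ of conductor $d$, for which $$\frac{\#\{pq\le x:\ \chi_d(p)=\chi_d(q)=\eta\}}{\frac14\,\#\{pq\le x:\ (pq,d)=1\}}\ \ \le\ \ 1-\frac{\log\log\log x+O(1)}{\log\log x},$$ where the implied constant in $O(1)$ is independent of $x$ and $d$.
   Context: In the counts, $p$ and $q$ denote primes (possibly equal), and $\#\{pq\le x:\dots\}$ counts the integers at most $x$ that are a product $pq$ of two primes satisfying the stated condition. A quadratic character $\chi_d$ of conductor $d$ is a primitive, real, non-principal Dirichlet character modulo $d$. $(m,n)$ denotes the greatest common divisor. *)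

theory Defs
  imports Complex_Main "HOL-Computational_Algebra.Primes"
begin

definition dirichlet_character :: "nat \<Rightarrow> (int \<Rightarrow> complex) \<Rightarrow> bool" where
  "dirichlet_character m \<chi> \<longleftrightarrow>
     m > 0 \<and>
     (\<forall>a b. \<chi> (a * b) = \<chi> a * \<chi> b) \<and>
     (\<forall>a. \<chi> (a + int m) = \<chi> a) \<and>
     (\<forall>a. \<chi> a \<noteq> 0 \<longleftrightarrow> coprime a (int m))"

definition principal_character :: "nat \<Rightarrow> int \<Rightarrow> complex" where
  "principal_character m = (\<lambda>a. if coprime a (int m) then 1 else 0)"

definition induced_from_modulus :: "nat \<Rightarrow> (int \<Rightarrow> complex) \<Rightarrow> nat \<Rightarrow> bool" where
  "induced_from_modulus m \<chi> e \<longleftrightarrow>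
     e dvd m \<and>
     (\<exists>\<psi>. dirichlet_character e \<psi> \<and> (\<forall>a. coprime a (int m) \<longrightarrow> \<chi> a = \<psi> a))"

definition conductor :: "nat \<Rightarrow> (int \<Rightarrow> complex) \<Rightarrow> nat" where
  "conductor m \<chi> = (LEAST e. induced_from_modulus m \<chi> e)"

definition primitive_character :: "nat \<Rightarrow> (int \<Rightarrow> complex) \<Rightarrow> bool" where
  "primitive_character m \<chi> \<longleftrightarrow> dirichlet_character m \<chi> \<and> conductor m \<chi> = m"

definition quadratic_character :: "nat \<Rightarrow> (int \<Rightarrow> complex) \<Rightarrow> bool" where
  "quadratic_character d \<chi> \<longleftrightarrow>
     primitive_character d \<chi> \<and> range \<chi> \<subseteq> \<real> \<and> \<chi> \<noteq> principal_character d"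

text \<open>Integers, not pairs of primes, are counted: \<open>p * q\<close> and \<open>q * p\<close> contribute once,
  and \<open>p = q\<close> is allowed.\<close>

definition prime_product_count :: "real \<Rightarrow> (nat \<Rightarrow> nat \<Rightarrow> bool) \<Rightarrow> nat" where
  "prime_product_count x P =
     card {n :: nat. real n \<le> x \<and> (\<exists>p q. prime p \<and> prime q \<and> n = p * q \<and> P p q)}"

end

theory Submission
  imports Defs "HOL-Number_Theory.Number_Theory" "HOL-Complex_Analysis.Complex_Analysis"
    "HOL-Real_Asymp.Real_Asymp" "HOL-Computational_Algebra.Squarefree"
begin

text \<open>
  The characters are Jacobi symbols modulo odd squarefree d with d = 1 (mod 4), taken from one residue class
  that by quadratic reciprocity forces \<chi>(p) = -\<eta> at every odd prime p up to (log x)^(1/4).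
  Since 4 [\<chi>(p) = \<eta>] [\<chi>(q) = \<eta>] = (1 + \<eta> \<chi>(p)) (1 + \<eta> \<chi>(q)) for pq coprime to d, the deficit comes from the
  cross terms in which one prime is small: they contribute a multiple of \<eta> \<Sum> \<chi>(p) \<pi>(x/p), which the prescribed
  values make as negative as - x log log log x / log x. The other terms are negligible once \<chi> has no
  bias at the larger primes. A second moment over the residue class controls \<Sum> \<chi>(p)/p in the middle range, and
  a duality (large sieve) inequality shows that only few d have a bias beyond exp(4 (log x)^(1/2)).

  The evaluation of \<pi>(x/p) needs the prime number theorem with error O(x / (log x log log x)). It follows
  from the inequality of Mertens 3 + 4 cos \<theta> + cos 2\<theta> \<ge> 0, which bounds |\<zeta>(1 + it)| from below by a power of
  1/|t|; smoothing the Laplace transform of the remainder by a Poisson kernel gives the Tauberian step.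
\<close>

text \<open>Three bounds on primes are tied to L = ln x. The prescribed range ends at L^(1/4): its
  modulus is then smaller than any fixed power of D(x) = exp(L^(1/2)), which leaves room for D(x)^(1
  - \<epsilon>) conductors, while the logarithm of ln(L^(1/4)) is still ln ln ln x - ln 4. The
  second moment has an error term of the square of the number of primes, which must stay below the
  number of conductors, so it stops at exp(L^(1/2) / 8). The duality bound needs sums longer than 2
  D(x)^3, so it starts at exp(4 L^(1/2)). Primes between these two bounds escape both methods, but
  the bounds are fixed powers of each other, and the reciprocals of those primes add up to ln 32 +
  O(1). It is reached cheaply: smoothing of width l costs l^(-17) against a gain of 1 / ln x, so l
  may be a power of 1 / ln ln x.\<close>

unbundle no vec_syntax

section \<open>Chebyshev and Mertens estimates\<close>

text \<open>Passing from N to N + 1 raises \<open>N div d\<close> by one exactly at the divisors d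
  of N + 1, and \<open>mangoldt\<close> summed over these is ln (N + 1).\<close>

lemma ln_fact_eq_sum_mangoldt:
  "ln (fact N) = (\<Sum>d=1..N. mangoldt d * real (N div d))"
proof (induction N)
  case (Suc N)
  have "(\<Sum>d=1..Suc N. mangoldt d * real (Suc N div d)) =
        (\<Sum>d=1..Suc N. mangoldt d * real (N div d) + (if d dvd Suc N then mangoldt d else 0))"
    by (intro sum.cong refl) (auto simp: div_Suc mod_eq_0_iff_dvd algebra_simps)
  also have "\<dots> = (\<Sum>d=1..N. mangoldt d * real (N div d)) + (\<Sum>d=1..Suc N. if d dvd Suc N then mangoldt d else 0)"
    by (simp add: sum.distrib)
  also have "(\<Sum>d=1..Suc N. if d dvd Suc N then mangoldt d else 0 :: real) = (\<Sum>d\<in>{1..Suc N} \<inter> {d. d dvd Suc N}. mangoldt d)"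
    by (subst sum.inter_restrict) auto
  also have "{1..Suc N} \<inter> {d. d dvd Suc N} = {d. d dvd Suc N}"
    by (auto dest: dvd_imp_le intro!: Nat.gr0I simp: Suc_le_eq)
  also have "(\<Sum>d | d dvd Suc N. mangoldt d) = ln (real (Suc N))"
    using mangoldt_sum[of "Suc N", where ?'a = real] by simp
  finally have "(\<Sum>d=1..Suc N. mangoldt d * real (Suc N div d)) = (\<Sum>d=1..N. mangoldt d * real (N div d)) + ln (real (Suc N))" .
  moreover have "ln (fact (Suc N) :: real) = ln (real (Suc N)) + ln (fact N)"
    by (simp only: fact_Suc) (subst ln_mult, auto)
  ultimately show ?case using Suc by simp
qed simp

definition psi :: "real \<Rightarrow> real" where
  "psi x = (\<Sum>n | n > 0 \<and> real n \<le> x. mangoldt n)"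

lemma finite_nat_le_real [simp, intro]: "finite {n::nat. real n \<le> x}"
proof (rule finite_subset)
  show "{n::nat. real n \<le> x} \<subseteq> {..nat \<lfloor>x\<rfloor>}" by (auto simp: le_nat_floor)
qed simp

lemma finite_nat_le_real_conj [simp, intro]:
  "finite {n::nat. P n \<and> real n \<le> x}" "finite {n::nat. P n \<and> real n \<le> x \<and> Q n}" "finite {n::nat. real n \<le> x \<and> Q n}"
  by (rule finite_subset[OF _ finite_nat_le_real[of x]]; auto)+

lemma psi_of_nat: "psi (real N) = (\<Sum>n=1..N. mangoldt n)"
  unfolding psi_def by (intro sum.cong) auto

lemma psi_mono: "x \<le> y \<Longrightarrow> psi x \<le> psi y"
  unfolding psi_def by (rule sum_mono2) (auto simp: mangoldt_nonneg)

lemma psi_nonneg: "psi x \<ge> 0"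
  unfolding psi_def by (rule sum_nonneg) (auto simp: mangoldt_nonneg)

text \<open>Chebyshev's argument: in the expansion of the logarithm of
  \<open>(2 * n) choose n\<close> the coefficient of \<open>mangoldt d\<close> is
  \<open>2 * n div d - 2 * (n div d)\<close>, which is never negative and equals 1 for n < d \<le>
  2n. The bound is then that of the binomial coefficient by 2^(2n).\<close>

lemma psi_double_le: "psi (real (2 * n)) - psi (real n) \<le> real (2 * n) * ln 2"
proof -
  have "psi (real (2 * n)) - psi (real n) = (\<Sum>d\<in>{n<..2*n}. mangoldt d)"
  proof -
    have "{1..2*n} = {1..n} \<union> {n<..2*n}" by auto
    hence "(\<Sum>d=1..2*n. mangoldt d) = (\<Sum>d=1..n. mangoldt d) + (\<Sum>d\<in>{n<..2*n}. mangoldt d :: real)"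
      by (simp add: sum.union_disjoint ivl_disj_int)
    thus ?thesis by (simp only: psi_of_nat)
  qed
  also have "\<dots> \<le> (\<Sum>d\<in>{n<..2*n}. mangoldt d * real (2 * n div d))"
  proof (rule sum_mono)
    fix d assume d: "d \<in> {n<..2*n}"
    hence "2 * n div d \<ge> 1" by (simp add: Suc_leI div_greater_zero_iff)
    hence "real (2 * n div d) \<ge> 1" by linarith
    thus "mangoldt d \<le> mangoldt d * real (2 * n div d)"
      using mangoldt_nonneg[of d] by (simp add: mult_le_cancel_left1)
  qed
  also have "\<dots> = (\<Sum>d\<in>{n<..2*n}. mangoldt d * (real (2 * n div d) - 2 * real (n div d)))"
    by (intro sum.cong) auto
  also have "\<dots> \<le> (\<Sum>d\<in>{1..2*n}. mangoldt d * (real (2 * n div d) - 2 * real (n div d)))"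
  proof (rule sum_mono2)
    fix d assume "d \<in> {1..2*n} - {n<..2*n}"
    have "2 * (n div d) \<le> 2 * n div d"
    proof (cases "d = 0")
      case False
      hence "2 * (n div d) * d \<le> 2 * n" by simp
      with False show ?thesis by (simp add: less_eq_div_iff_mult_less_eq)
    qed simp
    hence "2 * real (n div d) \<le> real (2 * n div d)" by linarith
    thus "0 \<le> mangoldt d * (real (2 * n div d) - 2 * real (n div d))"
      by (simp add: mangoldt_nonneg)
  qed auto
  also have "\<dots> = (\<Sum>d\<in>{1..2*n}. mangoldt d * real (2 * n div d)) - 2 * (\<Sum>d\<in>{1..2*n}. mangoldt d * real (n div d))"
    by (simp add: algebra_simps sum_subtractf sum_distrib_left)
  also have "(\<Sum>d\<in>{1..2*n}. mangoldt d * real (n div d)) = (\<Sum>d\<in>{1..n}. mangoldt d * real (n div d))"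
    by (rule sum.mono_neutral_right) auto
  also have "(\<Sum>d\<in>{1..2*n}. mangoldt d * real (2 * n div d)) - 2 * \<dots> = ln (fact (2 * n)) - 2 * ln (fact n)"
    by (simp only: ln_fact_eq_sum_mangoldt)
  also have "\<dots> = ln (real ((2 * n) choose n))"
  proof -
    have "fact n * fact (2 * n - n) * (2 * n choose n) = (fact (2 * n) :: nat)"
      by (rule binomial_fact_lemma) simp
    hence "real (fact (2 * n)) = real (fact n * fact n * (2 * n choose n))" by simp
    hence "(fact (2 * n) :: real) = fact n * fact n * real (2 * n choose n)" by simp
    thus ?thesis by (simp add: ln_mult zero_less_binomial)
  qed
  also have "\<dots> \<le> ln (2 ^ (2 * n))"
  proof -
    have "(2 * n) choose n \<le> 2 ^ (2 * n)" by (rule binomial_le_pow2)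
    hence "real ((2 * n) choose n) \<le> 2 ^ (2 * n)" by (metis of_nat_le_iff of_nat_numeral of_nat_power)
    thus ?thesis by (subst ln_le_cancel_iff) (auto simp: zero_less_binomial)
  qed
  finally show ?thesis by (simp add: ln_realpow)
qed

lemma psi_le_nat: "psi (real N) \<le> 4 * real N"
proof (induction N rule: less_induct)
  case (less N)
  show ?case
  proof (cases "N \<le> 1")
    case True
    hence "N = 0 \<or> N = 1" by auto
    thus ?thesis using psi_of_nat[of 0] psi_of_nat[of 1] by auto
  next
    case False
    \<comment> \<open>Rounding the half up keeps N \<le> 2m; the possible excess 2m = N + 1 is what
      forces N = 2 to be treated on its own below.\<close>
    define m where "m = (N + 1) div 2"
    have m: "m < N" "N \<le> 2 * m" "2 * m \<le> N + 1" "m \<ge> 1" using False unfolding m_def by auto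
    have "psi (real N) \<le> psi (real (2 * m))" using m by (intro psi_mono) simp
    also have "\<dots> \<le> psi (real m) + real (2 * m) * ln 2" using psi_double_le[of m] by linarith
    also have "\<dots> \<le> 4 * real m + real (2 * m) * ln 2" using less.IH[OF m(1)] by simp
    \<comment> \<open>The number 2/3 + 1/30 is 0.7, just above 25/36, so the total is 5.4 m, at most
      2.7 (N + 1).\<close>
    also have "\<dots> \<le> 4 * real m + real (2 * m) * (2 / 3 + 1/30)"
      using ln_2_less_1 ln2_le_25_over_36 by (intro add_left_mono mult_left_mono) auto
    also have "\<dots> \<le> 4 * real N"
    proof -
      consider "N = 2" "m = 1" | "N \<ge> 3" using m False by linarith
      thus ?thesis
      proof cases
        case 2
        have "2 * real m \<le> real N + 1" "real N \<ge> 3" using m 2 by linarith+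
        thus ?thesis by (simp add: field_simps)
      qed (use m in auto)
    qed
    finally show ?thesis .
  qed
qed

lemma psi_le: "x \<ge> 0 \<Longrightarrow> psi x \<le> 4 * x"
proof -
  assume x: "x \<ge> 0"
  have "psi x = psi (real (nat \<lfloor>x\<rfloor>))"
    unfolding psi_def
  proof (intro sum.cong refl Collect_cong conj_cong)
    fix n show "real n \<le> x \<longleftrightarrow> real n \<le> real (nat \<lfloor>x\<rfloor>)"
      using x by (metis le_nat_floor of_nat_floor of_nat_le_iff order_trans)
  qed
  also have "\<dots> \<le> 4 * real (nat \<lfloor>x\<rfloor>)" by (rule psi_le_nat)
  also have "\<dots> \<le> 4 * x" using x by (simp add: of_nat_floor)
  finally show ?thesis .
qed

text \<open>The increment of N ln N - N is at most ln (N + 1), because N (ln (N + 1) - ln N) \<le>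
  1.\<close>

lemma ln_fact_ge: "ln (fact N) \<ge> real N * ln (real N) - real N"
proof (induction N)
  case (Suc N)
  have "real N * (ln (real (Suc N)) - ln (real N)) \<le> 1"
  proof (cases "N = 0")
    case False
    have "ln (real (Suc N)) - ln (real N) = ln (1 + 1 / real N)"
    proof -
      have "real (Suc N) = real N * (1 + 1 / real N)" using False by (simp add: field_simps)
      hence "ln (real (Suc N)) = ln (real N) + ln (1 + 1 / real N)"
        using False by (simp only:) (subst ln_mult, auto simp: add_pos_nonneg)
      thus ?thesis by simp
    qed
    also have "\<dots> \<le> 1 / real N" using False by (intro ln_add_one_self_le_self) auto
    finally show ?thesis using False by (simp add: field_simps)
  qed simp
  moreover have "ln (fact (Suc N) :: real) = ln (real (Suc N)) + ln (fact N)"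
    by (simp only: fact_Suc) (subst ln_mult, auto)
  ultimately show ?case using Suc by (simp only: of_nat_Suc) (simp add: algebra_simps)
qed simp

text \<open>Replacing \<open>N div n\<close> by N/n in \<open>ln_fact_eq_sum_mangoldt\<close> costs
  at most \<open>psi N\<close>, that is 4N, and ln N! lies between N ln N - N and N ln N; division
  by N leaves a bounded error.\<close>

lemma mertens_mangoldt:
  assumes "N \<ge> 1"
  shows "\<bar>(\<Sum>n=1..N. mangoldt n / real n) - ln (real N)\<bar> \<le> 4"
proof -
  define S where "S = (\<Sum>n=1..N. mangoldt n / real n)"
  have S: "real N * S = (\<Sum>n=1..N. mangoldt n * (real N / real n))"
    unfolding S_def sum_distrib_left by (intro sum.cong) auto
  have "ln (fact N) \<le> real N * S"
    unfolding S ln_fact_eq_sum_mangoldt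
    by (intro sum_mono mult_left_mono mangoldt_nonneg) (auto simp: of_nat_div_le_of_nat)
  moreover have "real N * S - psi (real N) \<le> ln (fact N)"
  proof -
    have "real N * S - psi (real N) = (\<Sum>n=1..N. mangoldt n * (real N / real n - 1))"
      unfolding S psi_of_nat by (simp add: algebra_simps sum_subtractf)
    also have "\<dots> \<le> ln (fact N)"
      unfolding ln_fact_eq_sum_mangoldt
    proof (intro sum_mono mult_left_mono mangoldt_nonneg)
      fix i assume "i \<in> {1..N}"
      show "real N / real i - 1 \<le> real (N div i)"
      proof (cases "i = 0")
        case False
        have "real N = real i * real (N div i) + real (N mod i)"
          by (metis mult_div_mod_eq of_nat_add of_nat_mult)
        moreover have "real (N mod i) \<le> real i" using False by (simp add: less_imp_le)
        ultimately show ?thesis using False by (simp add: field_simps)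
      qed simp
    qed
    finally show ?thesis .
  qed
  moreover have "ln (fact N) \<le> real N * ln (real N)"
  proof -
    have "ln (fact N) \<le> ln (real N ^ N)"
      using fact_le_power[of N, where ?'a = real] assms by (subst ln_le_cancel_iff) auto
    thus ?thesis using assms by (simp add: ln_realpow)
  qed
  moreover note ln_fact_ge[of N] psi_le_nat[of N]
  ultimately have "real N * S \<le> real N * (ln (real N) + 4)" "real N * (ln (real N) - 1) \<le> real N * S"
    by (auto simp: algebra_simps)
  thus ?thesis using assms unfolding S_def[symmetric] by (simp add: abs_le_iff)
qed

text \<open>Von Mangoldt's function cut down to the prime powers p^k with k at least 2.\<close>

definition pp_part :: "nat \<Rightarrow> real" where
  "pp_part n = mangoldt n - (if prime n then ln (real n) else 0)"

lemma pp_part_nonneg: "pp_part n \<ge> 0"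
  by (simp add: pp_part_def mangoldt_nonneg)

lemma pp_part_nonzeroE:
  assumes "pp_part n \<noteq> 0"
  obtains p k where "prime p" "k \<ge> 2" "n = p ^ k" "pp_part n = ln (real p)"
proof -
  have n: "primepow n" "\<not> prime n"
    using assms by (auto simp: pp_part_def mangoldt_def split: if_splits)
  then obtain p k where pk: "prime p" "k > 0" "n = p ^ k"
    by (auto simp: primepow_def)
  have "k \<noteq> 1" using n pk by auto
  hence "k \<ge> 2" using pk by linarith
  with pk n show ?thesis by (intro that[of p k]) (auto simp: pp_part_def)
qed

text \<open>For fixed p the exponents k \<ge> 2 give a geometric series of the size of its first
  term, p^(-3/2) ln p, and this is summable over p. The exponent 3/4 lies strictly between 1/2,
  where convergence begins, and 1, the exponent to be beaten in
  \<open>sum_pp_part_le\<close>.\<close>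

lemma sum_pp_part_powr_bounded:
  "\<exists>C\<ge>0. \<forall>N. (\<Sum>n=1..N. pp_part n * real n powr (-3/4)) \<le> C"
proof (intro exI allI conjI)
  have summ: "summable (\<lambda>n. 16 * real n powr (-5/4))"
    by (intro summable_mult) (simp add: summable_real_powr_iff)
  define C where "C = (\<Sum>n. 16 * real n powr (-5/4))"
  show "C \<ge> 0" unfolding C_def by (intro suminf_nonneg summ) auto
  fix N :: nat
  define g where "g = (\<lambda>n. pp_part n * real n powr (-3/4))"
  have g_nonneg: "g n \<ge> 0" for n by (simp add: g_def pp_part_nonneg)
  define P where "P = (SIGMA p:{p\<in>{2..N}. prime p}. {2..N})"
  have fin: "finite P" by (simp add: P_def)
  have "(\<Sum>n=1..N. g n) = (\<Sum>n | n \<in> {1..N} \<and> pp_part n \<noteq> 0. g n)"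
    by (intro sum.mono_neutral_right) (auto simp: g_def)
  also have "\<dots> \<le> (\<Sum>n\<in>(\<lambda>(p,k). p ^ k) ` P. g n)"
  proof (intro sum_mono2 finite_imageI fin subsetI g_nonneg)
    fix n assume n: "n \<in> {n. n \<in> {1..N} \<and> pp_part n \<noteq> 0}"
    then obtain p k where pk: "prime p" "k \<ge> 2" "n = p ^ k" by (auto elim: pp_part_nonzeroE)
    have "p \<le> p ^ k" using pk prime_gt_0_nat[of p] by (intro self_le_power) auto
    moreover have "k < p ^ k"
      using power_gt_expt[of p k] pk prime_ge_2_nat[of p] by auto
    ultimately show "n \<in> (\<lambda>(p,k). p ^ k) ` P"
      using pk n prime_ge_2_nat[of p] by (intro image_eqI[of _ _ "(p, k)"]) (simp_all add: P_def)
  qed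
  also have "\<dots> \<le> (\<Sum>pk\<in>P. g ((\<lambda>(p,k). p ^ k) pk))"
    using sum_image_le[OF fin, of g "\<lambda>(p,k). p ^ k"] g_nonneg by (auto simp: o_def)
  also have "\<dots> = (\<Sum>p | p \<in> {2..N} \<and> prime p. \<Sum>k=2..N. g (p ^ k))"
    unfolding P_def by (subst sum.Sigma) (auto intro!: sum.cong)
  also have "\<dots> \<le> (\<Sum>p | p \<in> {2..N} \<and> prime p. 16 * real p powr (-5/4))"
  proof (rule sum_mono)
    fix p assume "p \<in> {p. p \<in> {2..N} \<and> prime p}"
    hence p: "prime p" "p \<ge> 2" by auto
    define q where "q = real p powr (-3/4)"
    have q0: "q > 0" using p by (simp add: q_def)
    have "q \<le> 2 powr (-3/4)" unfolding q_def using p by (intro powr_mono2') auto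
    also have "\<dots> \<le> 2 powr (-1/2)" by (intro powr_mono) auto
    also have "\<dots> = 1 / sqrt 2" by (simp add: powr_minus powr_half_sqrt divide_simps)
    also have "\<dots> \<le> 3 / 4"
    proof -
      have "4 / 3 \<le> sqrt 2" by (rule real_le_rsqrt) (simp add: power2_eq_square)
      thus ?thesis by (simp add: field_simps)
    qed
    finally have q1: "q \<le> 3 / 4" .
    have "(\<Sum>k=2..N. g (p ^ k)) = (\<Sum>k=2..N. ln (real p) * q ^ k)"
    proof (intro sum.cong refl)
      fix k assume k: "k \<in> {2..N}"
      have "\<not> prime (p ^ k)" using k by (auto simp: prime_power_iff)
      moreover have "real (p ^ k) powr (-3/4) = q ^ k"
      proof -
        have "real (p ^ k) = real p powr real k" using p by (simp add: powr_realpow)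
        thus ?thesis using p by (simp add: q_def powr_power powr_powr mult.commute)
      qed
      ultimately show "g (p ^ k) = ln (real p) * q ^ k"
        using p k by (simp add: g_def pp_part_def)
    qed
    also have "\<dots> = ln (real p) * (\<Sum>k=2..N. q ^ k)" by (simp add: sum_distrib_left)
    \<comment> \<open>As q \<le> 3/4, the series is at most q^2 / (1 - q), hence 4 q^2; together
      with ln p \<le> 4 p^(1/4) this is the origin of the factor 16.\<close>
    also have "(\<Sum>k=2..N. q ^ k) \<le> 4 * q\<^sup>2"
    proof (cases "N \<ge> 2")
      case True
      have "(\<Sum>k=2..N. q ^ k) = (q\<^sup>2 - q ^ Suc N) / (1 - q)"
        using q1 True by (subst sum_gp) auto
      also have "\<dots> \<le> q\<^sup>2 / (1/4)" using q0 q1 by (intro frac_le) auto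
      finally show ?thesis by simp
    qed auto
    also have "q\<^sup>2 = real p powr (-3/2)"
      using p by (simp add: q_def powr_power)
    also have "ln (real p) * (4 * real p powr (-3/2)) \<le> (real p powr (1/4) / (1/4)) * (4 * real p powr (-3/2))"
      using p by (intro mult_right_mono ln_powr_bound) auto
    also have "\<dots> = 16 * (real p powr (1/4) * real p powr (-3/2))" by simp
    also have "\<dots> = 16 * real p powr (-5/4)" by (simp flip: powr_add)
    finally show "(\<Sum>k=2..N. g (p ^ k)) \<le> 16 * real p powr (-5/4)" using p by (simp add: mult_left_mono)
  qed
  also have "\<dots> \<le> C" unfolding C_def by (intro sum_le_suminf summ) auto
  finally show "(\<Sum>n=1..N. pp_part n * real n powr (-3/4)) \<le> C" by (simp add: g_def)
qed

text \<open>Rankin's trick in both parts: 1 \<le> (N / n)^(3/4) for n \<le> N, and 1/n \<le>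
  n^(-3/4).\<close>

lemma sum_pp_part_le:
  "\<exists>C\<ge>0. \<forall>N\<ge>1. (\<Sum>n=1..N. pp_part n) \<le> C * real N powr (3/4) \<and> (\<Sum>n=1..N. pp_part n / real n) \<le> C"
proof -
  obtain C where C: "C \<ge> 0" "\<And>N. (\<Sum>n=1..N. pp_part n * real n powr (-3/4)) \<le> C"
    using sum_pp_part_powr_bounded by blast
  show ?thesis
  proof (intro exI[of _ C] conjI C(1) allI impI)
    fix N :: nat assume N: "N \<ge> 1"
    have "(\<Sum>n=1..N. pp_part n) \<le> (\<Sum>n=1..N. real N powr (3/4) * (pp_part n * real n powr (-3/4)))"
    proof (rule sum_mono)
      fix n assume n: "n \<in> {1..N}"
      have "1 = real n powr (3/4) * real n powr (-3/4)" using n by (simp flip: powr_add)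
      also have "\<dots> \<le> real N powr (3/4) * real n powr (-3/4)"
        using n by (intro mult_right_mono powr_mono2) auto
      finally have "pp_part n * 1 \<le> pp_part n * (real N powr (3/4) * real n powr (-3/4))"
        by (intro mult_left_mono pp_part_nonneg)
      thus "pp_part n \<le> real N powr (3/4) * (pp_part n * real n powr (-3/4))" by (simp add: mult_ac)
    qed
    also have "\<dots> \<le> C * real N powr (3/4)"
      using C(2)[of N] by (simp add: mult.commute[of C] mult_left_mono flip: sum_distrib_left)
    finally show "(\<Sum>n=1..N. pp_part n) \<le> C * real N powr (3/4)" .
    have "(\<Sum>n=1..N. pp_part n / real n) \<le> (\<Sum>n=1..N. pp_part n * real n powr (-3/4))"
    proof (rule sum_mono)
      fix n assume n: "n \<in> {1..N}"
      have "inverse (real n) = real n powr (-1)" using n by (simp add: powr_minus)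
      also have "\<dots> \<le> real n powr (-3/4)" using n by (intro powr_mono) auto
      finally show "pp_part n / real n \<le> pp_part n * real n powr (-3/4)"
        unfolding divide_inverse by (intro mult_left_mono pp_part_nonneg)
    qed
    thus "(\<Sum>n=1..N. pp_part n / real n) \<le> C" using C(2)[of N] by linarith
  qed
qed

section \<open>Mertens' sums over primes\<close>

lemma mertens_prime:
  "\<exists>C\<ge>0. \<forall>N\<ge>1. \<bar>(\<Sum>n=1..N. (if prime n then ln (real n) / real n else 0)) - ln (real N)\<bar> \<le> C"
proof -
  obtain C where C: "C \<ge> 0" "\<And>N. N \<ge> 1 \<Longrightarrow> (\<Sum>n=1..N. pp_part n / real n) \<le> C"
    using sum_pp_part_le by blast
  show ?thesis
  proof (intro exI[of _ "C + 4"] conjI allI impI)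
    fix N :: nat assume N: "N \<ge> 1"
    have "(\<Sum>n=1..N. (if prime n then ln (real n) / real n else 0)) =
          (\<Sum>n=1..N. mangoldt n / real n - pp_part n / real n)"
      by (intro sum.cong) (auto simp: pp_part_def diff_divide_distrib)
    also have "\<dots> = (\<Sum>n=1..N. mangoldt n / real n) - (\<Sum>n=1..N. pp_part n / real n)"
      by (simp add: sum_subtractf)
    finally show "\<bar>(\<Sum>n=1..N. (if prime n then ln (real n) / real n else 0)) - ln (real N)\<bar> \<le> C + 4"
      using mertens_mangoldt[OF N] C(2)[OF N] sum_nonneg[of "{1..N}" "\<lambda>n. pp_part n / real n"]
      by (auto simp: pp_part_nonneg)
  qed (use C in auto)
qed

text \<open>Partial summation. The induction follows the sum minus its boundary term; each step adds
  a partial sum of c times \<open>f k - f (Suc k)\<close>, and these differences telescope because f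
  decreases.\<close>

lemma abel_bound:
  fixes c f :: "nat \<Rightarrow> real"
  assumes "m \<le> N" and B: "\<And>k. m \<le> k \<Longrightarrow> k \<le> N \<Longrightarrow> \<bar>\<Sum>i=m..k. c i\<bar> \<le> B"
    and f: "\<And>k. m \<le> k \<Longrightarrow> k < N \<Longrightarrow> f (Suc k) \<le> f k" "f N \<ge> 0"
  shows "\<bar>\<Sum>i=m..N. c i * f i\<bar> \<le> B * f m"
proof -
  have "\<bar>(\<Sum>i=m..k. c i * f i) - (\<Sum>i=m..k. c i) * f k\<bar> \<le> B * (f m - f k)" if "m \<le> k" "k \<le> N" for k
    using that
  proof (induction k rule: dec_induct)
    case (step k)
    have "(\<Sum>i=m..Suc k. c i * f i) - (\<Sum>i=m..Suc k. c i) * f (Suc k) =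
          ((\<Sum>i=m..k. c i * f i) - (\<Sum>i=m..k. c i) * f k) + (\<Sum>i=m..k. c i) * (f k - f (Suc k))"
      using step by (simp add: algebra_simps)
    also have "\<bar>\<dots>\<bar> \<le> B * (f m - f k) + B * (f k - f (Suc k))"
      using step B[of k] f(1)[of k]
      by (intro order_trans[OF abs_triangle_ineq] add_mono) (auto simp: abs_mult intro!: mult_right_mono)
    finally show ?case by (simp add: algebra_simps)
  qed simp
  from this[of N] have "\<bar>(\<Sum>i=m..N. c i * f i) - (\<Sum>i=m..N. c i) * f N\<bar> \<le> B * (f m - f N)" using assms by simp
  moreover have "\<bar>(\<Sum>i=m..N. c i) * f N\<bar> \<le> B * f N"
    using B[of N] f(2) assms(1) by (auto simp: abs_mult intro!: mult_right_mono)
  ultimately show ?thesis by (simp add: algebra_simps)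
qed

text \<open>A Riemann sum for the integral of dv / v along the points v = ln n. Its steps b - a are
  at most 1, so each deviates from ln b - ln a by at most 1/a - 1/b, which telescopes. The summand 1
  is the term n = 2.\<close>

lemma ln_ln_sum_bounds:
  assumes "N \<ge> 2"
  shows "(\<Sum>n=2..N. (ln (real n) - ln (real (n - 1))) / ln (real n)) \<le> ln (ln (real N)) - ln (ln 2) + 1" (is ?A)
    and "(\<Sum>n=2..N. (ln (real n) - ln (real (n - 1))) / ln (real n)) \<ge>
           ln (ln (real N)) - ln (ln 2) + 1 - (1 / ln 2 - 1 / ln (real N))" (is ?B)
proof -
  have "?A \<and> ?B" using assms
  proof (induction N rule: dec_induct)
    case (step N)
    define a b where "a = ln (real N)" and "b = ln (real (Suc N))"
    have ab: "0 < a" "a \<le> b" "0 < b" using step by (auto simp: a_def b_def)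
    have "b - a \<le> 1"
    proof -
      have "b - a \<le> (real (Suc N) - real N) / real N"
        unfolding a_def b_def using step by (intro ln_diff_le) auto
      also have "\<dots> \<le> 1" using step by simp
      finally show ?thesis .
    qed
    have up: "(b - a) / b \<le> ln b - ln a"
      using ln_diff_le[of a b] ab by (simp add: field_simps)
    have "ln b - ln a \<le> (b - a) / a"
      using ln_diff_le[of b a] ab by simp
    also have "\<dots> = (b - a) / b + (b - a) * (1 / a - 1 / b)" using ab by (simp add: field_simps)
    also have "\<dots> \<le> (b - a) / b + 1 * (1 / a - 1 / b)"
      using ab \<open>b - a \<le> 1\<close> by (intro add_left_mono mult_right_mono) (auto simp: field_simps)
    finally have low: "ln b - ln a - (1 / a - 1 / b) \<le> (b - a) / b" by simp
    have "(\<Sum>n=2..Suc N. (ln (real n) - ln (real (n - 1))) / ln (real n)) =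
          (\<Sum>n=2..N. (ln (real n) - ln (real (n - 1))) / ln (real n)) + (b - a) / b"
      using step by (simp add: a_def b_def)
    with step.IH up low show ?case unfolding a_def[symmetric] b_def[symmetric] by linarith
  qed auto
  thus ?A ?B by auto
qed

text \<open>Partial summation against 1 / ln n carries the bounded error of
  \<open>mertens_prime\<close> over to this sum; the smooth part ln n - ln (n - 1) is evaluated by
  \<open>ln_ln_sum_bounds\<close>.\<close>

lemma mertens_reciprocal_nat:
  "\<exists>C\<ge>0. \<forall>N\<ge>2. \<bar>(\<Sum>n=2..N. if prime n then 1 / real n else 0) - ln (ln (real N))\<bar> \<le> C"
proof -
  obtain C where C: "C \<ge> 0"
    "\<And>N. N \<ge> 1 \<Longrightarrow> \<bar>(\<Sum>n=1..N. (if prime n then ln (real n) / real n else 0)) - ln (real N)\<bar> \<le> C"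
    using mertens_prime by blast
  define c where "c = (\<lambda>n. (if prime n then ln (real n) / real n else 0) - (ln (real n) - ln (real (n - 1))))"
  have c: "\<bar>\<Sum>n=2..k. c n\<bar> \<le> C" if "k \<ge> 2" for k
  proof -
    have "(\<Sum>n=2..k. ln (real n) - ln (real (n - 1))) = ln (real k)"
      using that by (induction k rule: dec_induct) auto
    moreover have "(\<Sum>n=2..k. (if prime n then ln (real n) / real n else 0)) =
                   (\<Sum>n=1..k. (if prime n then ln (real n) / real n else 0))"
      by (intro sum.mono_neutral_left) (auto simp: numeral_2_eq_2 not_less_eq_eq)
    ultimately show ?thesis using C(2)[of k] that by (simp add: c_def sum_subtractf)
  qed
  define K where "K = C / ln 2 + \<bar>ln (ln 2)\<bar> + 1 + 1 / ln 2"
  show ?thesis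
  proof (intro exI[of _ K] conjI allI impI)
    show "K \<ge> 0" using C by (simp add: K_def)
    fix N :: nat assume N: "N \<ge> 2"
    have 1: "\<bar>\<Sum>n=2..N. c n * (1 / ln (real n))\<bar> \<le> C * (1 / ln (real 2))"
    proof (rule abel_bound)
      fix k :: nat assume "2 \<le> k"
      thus "1 / ln (real (Suc k)) \<le> 1 / ln (real k)" by (intro divide_left_mono) auto
    qed (use N c in auto)
    have "(\<Sum>n=2..N. c n * (1 / ln (real n))) =
          (\<Sum>n=2..N. (if prime n then 1 / real n else 0) - (ln (real n) - ln (real (n - 1))) / ln (real n))"
    proof (intro sum.cong refl)
      fix n :: nat assume "n \<in> {2..N}"
      hence "ln (real n) > 0" by simp
      thus "c n * (1 / ln (real n)) = (if prime n then 1 / real n else 0) - (ln (real n) - ln (real (n - 1))) / ln (real n)"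
        by (simp add: c_def diff_divide_distrib)
    qed
    also have "\<dots> = (\<Sum>n=2..N. if prime n then 1 / real n else 0) -
        (\<Sum>n=2..N. (ln (real n) - ln (real (n - 1))) / ln (real n))" by (simp add: sum_subtractf)
    finally have 2: "(\<Sum>n=2..N. c n * (1 / ln (real n))) = \<dots>" .
    have 3: "1 / ln (real N) \<ge> 0" using N by simp
    show "\<bar>(\<Sum>n=2..N. if prime n then 1 / real n else 0) - ln (ln (real N))\<bar> \<le> K"
    proof -
      have "C * (1 / ln (real 2)) = C / ln 2" by simp
      thus ?thesis using 1 2 3 ln_ln_sum_bounds[OF N] unfolding K_def by linarith
    qed
  qed
qed

lemma mertens_reciprocal:
  "\<exists>C\<ge>0. \<forall>x\<ge>2. \<bar>(\<Sum>p | prime p \<and> real p \<le> x. 1 / real p) - ln (ln x)\<bar> \<le> C"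
proof -
  obtain C where C: "C \<ge> 0"
    "\<And>N. N \<ge> 2 \<Longrightarrow> \<bar>(\<Sum>n=2..N. if prime n then 1 / real n else 0) - ln (ln (real N))\<bar> \<le> C"
    using mertens_reciprocal_nat by blast
  show ?thesis
  proof (intro exI[of _ "C + ln 2"] conjI allI impI)
    fix x :: real assume x: "x \<ge> 2"
    define N where "N = nat \<lfloor>x\<rfloor>"
    have N: "N \<ge> 2" "real N \<le> x" "x < real N + 1" using x unfolding N_def by linarith+
    have "(\<Sum>p | prime p \<and> real p \<le> x. 1 / real p) = (\<Sum>n\<in>{2..N} \<inter> {n. prime n}. 1 / real n)"
      using x by (intro sum.cong) (auto simp: N_def le_nat_floor prime_ge_2_nat le_nat_iff le_floor_iff)
    also have "\<dots> = (\<Sum>n=2..N. if prime n then 1 / real n else 0)"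
      by (subst sum.inter_restrict) auto
    finally have eq: "(\<Sum>p | prime p \<and> real p \<le> x. 1 / real p) = \<dots>" .
    have "ln (ln (real N)) \<le> ln (ln x)" using N by simp
    moreover have "ln (ln x) \<le> ln (2 * ln (real N))"
    proof -
      \<comment> \<open>From x < N + 1 \<le> 2N \<le> N^2: passing from N back to x changes ln ln by
        at most ln 2.\<close>
      have "x \<le> real N * real N" using N mult_right_mono[of 2 "real N" "real N"] by linarith
      hence "ln x \<le> ln (real N * real N)" using N by (subst ln_le_cancel_iff) auto
      hence "ln x \<le> 2 * ln (real N)" using N by (simp add: ln_mult)
      thus ?thesis using N by (subst ln_le_cancel_iff) auto
    qed
    moreover have "ln (2 * ln (real N)) = ln 2 + ln (ln (real N))" using N by (subst ln_mult) auto
    ultimately show "\<bar>(\<Sum>p | prime p \<and> real p \<le> x. 1 / real p) - ln (ln x)\<bar> \<le> C + ln 2"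
      using C(2)[OF N(1)] eq by linarith
  qed (use C in auto)
qed

lemma mertens_prime_le:
  "\<exists>C\<ge>0. \<forall>x\<ge>1. (\<Sum>p | prime p \<and> real p \<le> x. ln (real p) / real p) \<le> ln x + C"
proof -
  obtain C where C: "C \<ge> 0"
    "\<And>N. N \<ge> 1 \<Longrightarrow> \<bar>(\<Sum>n=1..N. (if prime n then ln (real n) / real n else 0)) - ln (real N)\<bar> \<le> C"
    using mertens_prime by blast
  show ?thesis
  proof (intro exI[of _ C] conjI allI impI)
    fix x :: real assume x: "x \<ge> 1"
    define N where "N = nat \<lfloor>x\<rfloor>"
    have N: "N \<ge> 1" "real N \<le> x" using x unfolding N_def by linarith+
    have "(\<Sum>p | prime p \<and> real p \<le> x. ln (real p) / real p) = (\<Sum>n\<in>{1..N} \<inter> {n. prime n}. ln (real n) / real n)"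
      using x by (intro sum.cong) (auto simp: N_def le_nat_floor le_nat_iff le_floor_iff dest: prime_gt_0_nat)
    also have "\<dots> = (\<Sum>n=1..N. if prime n then ln (real n) / real n else 0)"
      by (subst sum.inter_restrict) auto
    also have "\<dots> \<le> ln (real N) + C" using C(2)[OF N(1)] by linarith
    also have "ln (real N) \<le> ln x" using N by simp
    finally show "(\<Sum>p | prime p \<and> real p \<le> x. ln (real p) / real p) \<le> ln x + C" by simp
  qed (use C in auto)
qed

section \<open>Passing from psi to the prime counting function\<close>

definition pi_fun :: "real \<Rightarrow> real" where
  "pi_fun x = real (card {p. prime p \<and> real p \<le> x})"

definition theta :: "real \<Rightarrow> real" where
  "theta x = (\<Sum>p | prime p \<and> real p \<le> x. ln (real p))"

lemma psi_minus_theta: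
  "\<exists>C\<ge>0. \<forall>x\<ge>1. theta x \<le> psi x \<and> psi x \<le> theta x + C * x powr (3/4)"
proof -
  obtain C where C: "C \<ge> 0" "\<And>N. N \<ge> 1 \<Longrightarrow> (\<Sum>n=1..N. pp_part n) \<le> C * real N powr (3/4)"
    using sum_pp_part_le by blast
  show ?thesis
  proof (intro exI[of _ C] conjI allI impI C(1))
    fix x :: real assume x: "x \<ge> 1"
    define N where "N = nat \<lfloor>x\<rfloor>"
    have N: "N \<ge> 1" "real N \<le> x" using x unfolding N_def by linarith+
    have set_eq: "{n. n > 0 \<and> real n \<le> x} = {1..N}"
      using x by (auto simp: N_def le_nat_floor le_nat_iff le_floor_iff)
    have "theta x = (\<Sum>n\<in>{1..N} \<inter> {n. prime n}. ln (real n))"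
      unfolding theta_def set_eq[symmetric] by (intro sum.cong) (auto simp: prime_gt_0_nat)
    also have "\<dots> = (\<Sum>n=1..N. if prime n then ln (real n) else 0)"
      by (subst sum.inter_restrict) auto
    finally have "psi x - theta x = (\<Sum>n=1..N. pp_part n)"
      unfolding psi_def set_eq by (simp add: pp_part_def sum_subtractf)
    moreover have "(\<Sum>n=1..N. pp_part n) \<ge> 0" by (intro sum_nonneg pp_part_nonneg)
    moreover have "C * real N powr (3/4) \<le> C * x powr (3/4)"
      using N C by (intro mult_left_mono powr_mono2) auto
    ultimately show "theta x \<le> psi x" "psi x \<le> theta x + C * x powr (3/4)"
      using C(2)[OF N(1)] by linarith+
  qed
qed

lemma pi_fun_ge_theta: "x > 1 \<Longrightarrow> theta x \<le> pi_fun x * ln x"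
  unfolding theta_def pi_fun_def by (rule sum_bounded_above) (auto simp: prime_gt_0_nat)

text \<open>The primes up to w are counted trivially, while each prime in (w, x] contributes at
  least ln w to \<open>theta x\<close>.\<close>

lemma pi_fun_le_theta:
  assumes "1 < w" "w \<le> x"
  shows "pi_fun x \<le> w + theta x / ln w"
proof -
  have "{p. prime p \<and> real p \<le> x} = {p. prime p \<and> real p \<le> w} \<union> {p. prime p \<and> w < real p \<and> real p \<le> x}"
    using assms by auto
  hence "card {p. prime p \<and> real p \<le> x} \<le> card {p. prime p \<and> real p \<le> w} + card {p. prime p \<and> w < real p \<and> real p \<le> x}"
    by (simp only: card_Un_le)
  hence "pi_fun x \<le> real (card {p. prime p \<and> real p \<le> w}) + real (card {p. prime p \<and> w < real p \<and> real p \<le> x})"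
    unfolding pi_fun_def by linarith
  also have "real (card {p. prime p \<and> real p \<le> w}) \<le> w"
  proof -
    have "card {p. prime p \<and> real p \<le> w} \<le> card {1..nat \<lfloor>w\<rfloor>}"
      by (intro card_mono) (auto simp: le_nat_floor dest: prime_gt_0_nat)
    thus ?thesis using assms by simp linarith
  qed
  also have "real (card {p. prime p \<and> w < real p \<and> real p \<le> x}) \<le> theta x / ln w"
  proof -
    have "real (card {p. prime p \<and> w < real p \<and> real p \<le> x}) * ln w \<le>
          (\<Sum>p | prime p \<and> w < real p \<and> real p \<le> x. ln (real p))"
      by (rule sum_bounded_below) (use assms in auto)
    also have "\<dots> \<le> theta x" unfolding theta_def

    proof (rule sum_mono2)
      fix p assume "p \<in> {p. prime p \<and> real p \<le> x} - {p. prime p \<and> w < real p \<and> real p \<le> x}"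
      hence "p \<ge> 1" using prime_gt_0_nat[of p] by auto
      thus "0 \<le> ln (real p)" by simp
    qed (use assms in auto)
    finally show ?thesis using assms by (simp add: field_simps)
  qed
  finally show ?thesis by simp
qed

text \<open>Cutting at w = x / (ln x)^2 makes the trivially counted part a fraction 1 / ln x of the
  main term and replaces ln x by ln x - 2 ln ln x, a relative change of order ln ln x / ln x. Both
  are smaller than the relative error 1 / ln ln x inherited from psi.\<close>

lemma pi_fun_from_psi:
  assumes "\<forall>\<^sub>F x in at_top. \<bar>psi x - x\<bar> \<le> C * x / ln (ln x)" "C \<ge> 0"
  shows "\<exists>K\<ge>0. \<forall>\<^sub>F x in at_top. \<bar>pi_fun x - x / ln x\<bar> \<le> K * x / (ln x * ln (ln x))"
proof -
  obtain B where B: "B \<ge> 0" "\<And>x. x \<ge> 1 \<Longrightarrow> theta x \<le> psi x \<and> psi x \<le> theta x + B * x powr (3/4)"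
    using psi_minus_theta by blast
  have 1: "\<forall>\<^sub>F x::real in at_top. x powr (3/4) \<le> x / ln (ln x)" by real_asymp
  have 2: "\<forall>\<^sub>F x::real in at_top. x / (ln x)^2 \<le> x / (ln x * ln (ln x))" by real_asymp
  have 3: "\<forall>\<^sub>F x::real in at_top. 1 < x / (ln x)^2 \<and> x / (ln x)^2 \<le> x \<and> x > 1 \<and> ln x > 0 \<and> ln (ln x) > 1"
    by (intro eventually_conj; real_asymp)
  have 4: "\<forall>\<^sub>F x::real in at_top. x / (ln x - 2 * ln (ln x)) \<le> x / ln x + x / (ln x * ln (ln x))" by real_asymp
  have 5: "\<forall>\<^sub>F x::real in at_top. x / ln (ln x) / (ln x - 2 * ln (ln x)) \<le> 2 * (x / (ln x * ln (ln x)))" by real_asymp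
  show ?thesis
  proof (intro exI[of _ "2 + 2 * C + B"] conjI)
    show "\<forall>\<^sub>F x in at_top. \<bar>pi_fun x - x / ln x\<bar> \<le> (2 + 2 * C + B) * x / (ln x * ln (ln x))"
      using 1 2 3 4 5 assms(1)
    proof eventually_elim
      case (elim x)
      define D where "D = x / (ln x * ln (ln x))"
      have D: "D \<ge> 0" using elim unfolding D_def by simp
      have th1: "theta x \<le> x + C * (x / ln (ln x))" using B(2)[of x] elim by (simp add: abs_le_iff)
      have th2: "theta x \<ge> x - C * (x / ln (ln x)) - B * (x / ln (ln x))"
      proof -
        have "B * x powr (3/4) \<le> B * (x / ln (ln x))" using elim B by (intro mult_left_mono) auto
        thus ?thesis using B(2)[of x] elim by (simp add: abs_le_iff)
      qed
      have "pi_fun x \<le> x / (ln x)^2 + theta x / ln (x / (ln x)^2)"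
        using elim by (intro pi_fun_le_theta) auto
      also have "ln (x / (ln x)^2) = ln x - 2 * ln (ln x)" using elim by (simp add: ln_div ln_realpow)
      also have "theta x / (ln x - 2 * ln (ln x)) \<le> (x + C * (x / ln (ln x))) / (ln x - 2 * ln (ln x))"
      proof (rule divide_right_mono[OF th1])
        have "0 \<le> ln (x / (ln x)^2)" using elim by (intro ln_ge_zero) auto
        thus "0 \<le> ln x - 2 * ln (ln x)" using elim by (simp add: ln_div ln_realpow)
      qed
      also have "\<dots> = x / (ln x - 2 * ln (ln x)) + C * (x / ln (ln x) / (ln x - 2 * ln (ln x)))"
        by (simp add: add_divide_distrib)
      also have "\<dots> \<le> (x / ln x + D) + C * (2 * D)"
        unfolding D_def using elim assms(2) by (intro add_mono mult_left_mono) auto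
      also have "x / (ln x)^2 \<le> D" unfolding D_def using elim by simp
      finally have up: "pi_fun x \<le> x / ln x + 2 * D + 2 * C * D" by simp
      have "x / ln x - C * D - B * D = (x - C * (x / ln (ln x)) - B * (x / ln (ln x))) / ln x"
        by (simp add: D_def diff_divide_distrib mult_ac)
      also have "\<dots> \<le> theta x / ln x" using th2 elim by (intro divide_right_mono) auto
      also have "\<dots> \<le> pi_fun x" using pi_fun_ge_theta[of x] elim by (simp add: field_simps)
      finally have low: "pi_fun x \<ge> x / ln x - C * D - B * D" .
      have "0 \<le> C * D" "0 \<le> B * D" using D B assms by auto
      hence "\<bar>pi_fun x - x / ln x\<bar> \<le> (2 + 2 * C + B) * D"
        using up low D by (simp add: abs_le_iff algebra_simps)
      thus ?case by (simp add: D_def)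
    qed
  qed (use assms B in auto)
qed

section \<open>The zeta function on and to the right of the line Re s = 1\<close>

text \<open>With m = n + 1 this is (s - 1) times the difference of m^(-s) and the integral of u^(-s)
  over m \<le> u \<le> m + 1: the comparison of sum and integral, multiplied by s - 1 to remove the
  pole.\<close>

definition zf :: "nat \<Rightarrow> complex \<Rightarrow> complex" where
  "zf n s = (s - 1) * of_nat (Suc n) powr (-s) + of_nat (Suc (Suc n)) powr (1 - s) - of_nat (Suc n) powr (1 - s)"

text \<open>The continuation of (s - 1) zeta(s) to Re s > 0. The summand 1 is s - 1 times the
  integral of u^(-s) over u \<ge> 1.\<close>

definition Zf :: "complex \<Rightarrow> complex" where
  "Zf s = 1 + (\<Sum>n. zf n s)"

lemma mem_real_segment:
  assumes "z \<in> closed_segment (complex_of_real a) (complex_of_real b)" "0 < a" "a \<le> b"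
  obtains u where "z = of_real u" "a \<le> u" "u \<le> b" "z \<notin> \<real>\<^sub>\<le>\<^sub>0"
  using assms by (auto simp: closed_segment_of_real closed_segment_eq_real_ivl nonpos_Reals_of_real_iff split: if_splits)

lemma norm_of_real_powr: "0 \<le> u \<Longrightarrow> norm (complex_of_real u powr s) = u powr Re s"
  using norm_powr_real_powr[of "complex_of_real u" s] by simp

lemma norm_powr_diff_le:
  assumes "0 < a" "a \<le> b" "Re s > 0"
  shows "norm (complex_of_real b powr (-s) - of_real a powr (-s)) \<le> norm s * a powr (-Re s - 1) * (b - a)"
proof -
  have "norm (complex_of_real b powr (-s) - of_real a powr (-s)) \<le>
          (norm s * a powr (-Re s - 1)) * norm (complex_of_real b - of_real a)"
  proof (rule field_differentiable_bound[of "closed_segment (complex_of_real a) (complex_of_real b)"])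
    fix z assume z: "z \<in> closed_segment (complex_of_real a) (complex_of_real b)"
    then obtain u where u: "z = of_real u" "a \<le> u" "u \<le> b" "z \<notin> \<real>\<^sub>\<le>\<^sub>0"
      using assms by (elim mem_real_segment) auto
    show "((\<lambda>z. z powr (-s)) has_field_derivative (-s * z powr (-s - 1)))
            (at z within closed_segment (complex_of_real a) (complex_of_real b))"
      by (rule has_field_derivative_at_within, rule has_field_derivative_powr, rule u(4))
    have "norm (-s * z powr (-s - 1)) = norm s * u powr (-Re s - 1)"
      using u assms by (simp add: norm_mult norm_of_real_powr)
    also have "\<dots> \<le> norm s * a powr (-Re s - 1)"
      using u assms by (intro mult_left_mono powr_mono2') auto
    finally show "norm (-s * z powr (-s - 1)) \<le> norm s * a powr (-Re s - 1)" .
  qed auto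
  also have "norm (complex_of_real b - of_real a) = b - a"
    using assms by (simp flip: of_real_diff)
  finally show ?thesis .
qed

text \<open>The auxiliary function g has derivative (s - 1) (a^(-s) - z^(-s)), a difference that is
  itself small by \<open>norm_powr_diff_le\<close>. This gains one power of n, so that the series
  converges for Re s > 0.\<close>

lemma norm_zf:
  assumes "Re s > 0"
  shows "norm (zf n s) \<le> norm (s - 1) * norm s * real (Suc n) powr (-Re s - 1)"
proof -
  define a where "a = real (Suc n)"
  have a: "a > 0" by (simp add: a_def)
  define g where "g = (\<lambda>z. (s - 1) * (z - of_real a) * of_real a powr (-s) + z powr (1 - s))"
  define B where "B = norm (s - 1) * norm s * a powr (-Re s - 1)"
  have zf: "zf n s = g (of_real (a + 1)) - g (of_real a)"
    by (simp add: zf_def g_def a_def algebra_simps)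
  have "norm (g (of_real (a + 1)) - g (of_real a)) \<le> B * norm (complex_of_real (a + 1) - of_real a)"
  proof (rule field_differentiable_bound[of "closed_segment (complex_of_real a) (complex_of_real (a + 1))"])
    fix z assume z: "z \<in> closed_segment (complex_of_real a) (complex_of_real (a + 1))"
    then obtain u where u: "z = of_real u" "a \<le> u" "u \<le> a + 1" "z \<notin> \<real>\<^sub>\<le>\<^sub>0"
      using a by (elim mem_real_segment) auto
    show "(g has_field_derivative ((s - 1) * (of_real a powr (-s) - z powr (-s))))
            (at z within closed_segment (complex_of_real a) (complex_of_real (a + 1)))"
      unfolding g_def using u
      by (auto intro!: derivative_eq_intros has_field_derivative_at_within[OF has_field_derivative_powr] simp: algebra_simps)
    have "norm ((s - 1) * (of_real a powr (-s) - z powr (-s))) = norm (s - 1) * norm (z powr (-s) - of_real a powr (-s))"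
      by (simp add: norm_mult norm_minus_commute)
    also have "\<dots> \<le> norm (s - 1) * (norm s * a powr (-Re s - 1) * (u - a))"
      unfolding u(1) using u a assms by (intro mult_left_mono norm_powr_diff_le) auto
    also have "\<dots> \<le> norm (s - 1) * (norm s * a powr (-Re s - 1) * 1)"
      using u a by (intro mult_left_mono) auto
    finally show "norm ((s - 1) * (of_real a powr (-s) - z powr (-s))) \<le> B" by (simp add: B_def mult_ac)
  qed auto
  also have "norm (complex_of_real (a + 1) - of_real a) = 1" by simp
  finally show ?thesis using zf by (simp add: B_def a_def)
qed

lemma summable_Suc_powr: "a < -1 \<Longrightarrow> summable (\<lambda>n. real (Suc n) powr a)"
  by (subst summable_Suc_iff[of "\<lambda>n. real n powr a"]) (simp add: summable_real_powr_iff)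

lemma zf_field_differentiable: "zf n field_differentiable (at s)"
proof -
  have "(\<lambda>s. (s - 1) * of_nat (Suc n) powr (-s) + of_nat (Suc (Suc n)) powr (1 - s) - of_nat (Suc n) powr (1 - s)) holomorphic_on (UNIV :: complex set)"
    by (intro holomorphic_intros) (auto simp del: of_nat_Suc)
  hence "zf n holomorphic_on UNIV" by (simp only: zf_def[abs_def])
  thus ?thesis by (rule holomorphic_on_imp_differentiable_at) auto
qed

lemma deriv_const_powr_minus:
  "w \<noteq> 0 \<Longrightarrow> ((\<lambda>s. w powr (-s)) has_field_derivative -(Ln w * w powr (-s))) (at (s::complex))"
  using DERIV_chain2[OF has_field_derivative_powr_right[of w "-s"] DERIV_minus[OF DERIV_ident]] by simp

lemma summable_zf: "Re s > 0 \<Longrightarrow> summable (\<lambda>n. norm (zf n s))"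
  by (rule summable_comparison_test'[OF summable_mult[OF summable_Suc_powr[of "-Re s - 1"]], of 0 _ "norm (s - 1) * norm s"])
     (use norm_zf[of s] in auto)

lemma Zf_holomorphic: "Zf holomorphic_on {s. Re s > 0}"
proof -
  define S where "S = {s. Re s > 0}"
  have "\<exists>g g'. \<forall>x\<in>S. (\<lambda>n. zf n x) sums g x \<and> (\<lambda>n. deriv (zf n) x) sums g' x \<and> (g has_field_derivative g' x) (at x)"
  proof (rule series_and_derivative_comparison_complex[of S zf])
    show "open S" unfolding S_def by (rule open_halfspace_Re_gt)
    show "(zf n has_field_derivative deriv (zf n) x) (at x)" for n x
      using zf_field_differentiable by (simp add: DERIV_deriv_iff_field_differentiable)
    fix x assume x: "x \<in> S"
    \<comment> \<open>On the ball of this radius the real part stays above d and both |s| and |s -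
      1| stay below |x| + d + 1, so one majorant serves the whole ball.\<close>
    define d where "d = Re x / 2"
    define h where "h = (\<lambda>n. complex_of_real ((norm x + d + 1) ^ 2 * real (Suc n) powr (-d - 1)))"
    have d: "d > 0" using x by (simp add: d_def S_def)
    show "\<exists>d h. 0 < d \<and> summable h \<and> range h \<subseteq> \<real>\<^sub>\<ge>\<^sub>0 \<and>
            (\<forall>\<^sub>F n in sequentially. \<forall>y\<in>ball x d \<inter> S. cmod (zf n y) \<le> cmod (h n))"
    proof (intro exI[of _ d] exI[of _ h] conjI always_eventually allI ballI)
      show "summable h" unfolding h_def summable_complex_of_real
        using d by (intro summable_mult summable_Suc_powr) auto
      fix n y assume y: "y \<in> ball x d \<inter> S"
      have 1: "norm (x - y) < d" using y by (simp add: dist_norm)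
      have "Re x - Re y \<le> norm (x - y)" using complex_Re_le_cmod[of "x - y"] by simp
      hence 2: "Re y \<ge> d" using 1 by (simp add: d_def)
      have 3: "norm y \<le> norm x + d" using norm_triangle_ineq2[of y x] 1 by (simp add: norm_minus_commute)
      have 4: "norm (y - 1) \<le> norm x + d + 1" using norm_triangle_ineq4[of y 1] 3 by simp
      have "norm (zf n y) \<le> norm (y - 1) * norm y * real (Suc n) powr (-Re y - 1)"
        using y by (intro norm_zf) (auto simp: S_def)
      also have "\<dots> \<le> (norm x + d + 1) * (norm x + d + 1) * real (Suc n) powr (-d - 1)"
        using 2 3 4 d by (intro mult_mono powr_mono) auto
      finally show "norm (zf n y) \<le> norm (h n)" using d unfolding h_def norm_of_real
        by (simp add: power2_eq_square abs_mult)
    qed (use d in \<open>auto simp: h_def\<close>)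
  qed
  then obtain g where g: "\<And>x. x \<in> S \<Longrightarrow> (\<lambda>n. zf n x) sums g x" "\<And>x. x \<in> S \<Longrightarrow> g field_differentiable (at x)"
    by (auto simp: field_differentiable_def)
  have "(\<lambda>s. 1 + g s) field_differentiable (at x)" if "x \<in> S" for x
    using g that by (intro field_differentiable_add) auto
  hence "(\<lambda>s. 1 + g s) holomorphic_on S"
    by (auto simp: holomorphic_on_def intro: field_differentiable_at_within)
  moreover have "1 + g s = Zf s" if "s \<in> S" for s
    using g that by (auto simp: Zf_def sums_iff)
  ultimately show ?thesis unfolding S_def by (rule holomorphic_transform) (auto simp: S_def)
qed

lemma Zf_bound: "\<exists>C\<ge>1. \<forall>s. Re s \<ge> 1/2 \<longrightarrow> norm (Zf s) \<le> C * (1 + norm s) ^ 2"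
proof -
  define C where "C = (\<Sum>n. real (Suc n) powr (-3/2))"
  have C: "C \<ge> 0" unfolding C_def by (intro suminf_nonneg summable_Suc_powr) auto
  show ?thesis
  proof (intro exI[of _ "1 + C"] conjI allI impI)
    fix s :: complex assume s: "Re s \<ge> 1/2"
    have "norm (Zf s) \<le> 1 + (\<Sum>n. norm (zf n s))"
      unfolding Zf_def using summable_norm[OF summable_zf[of s]] s
      by (intro order_trans[OF norm_triangle_ineq]) auto
    also have "(\<Sum>n. norm (zf n s)) \<le> (\<Sum>n. (1 + norm s) ^ 2 * real (Suc n) powr (-3/2))"
    proof (intro suminf_le summable_zf summable_mult summable_Suc_powr)
      fix n
      have "norm (zf n s) \<le> norm (s - 1) * norm s * real (Suc n) powr (-Re s - 1)"
        using s by (intro norm_zf) auto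
      also have "\<dots> \<le> (1 + norm s) * (1 + norm s) * real (Suc n) powr (-3/2)"
        using s norm_triangle_ineq4[of s 1] by (intro mult_mono powr_mono) auto
      finally show "norm (zf n s) \<le> (1 + norm s) ^ 2 * real (Suc n) powr (-3/2)" by (simp add: power2_eq_square)
    qed (use s in auto)
    also have "\<dots> = (1 + norm s) ^ 2 * C"
      unfolding C_def by (intro suminf_mult summable_Suc_powr) auto
    also have "1 + \<dots> \<le> (1 + C) * (1 + norm s) ^ 2"
      by (simp add: algebra_simps)
    finally show "norm (Zf s) \<le> (1 + C) * (1 + norm s) ^ 2" by simp
  qed (use C in auto)
qed

section \<open>Dirichlet series in the half-plane Re s > 1\<close>

definition zeta :: "complex \<Rightarrow> complex" where
  "zeta s = (\<Sum>n. of_nat (Suc n) powr (-s))"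

lemma norm_Suc_powr: "norm (complex_of_nat (Suc n) powr s) = real (Suc n) powr Re s"
  using norm_of_real_powr[of "real (Suc n)" s] by simp

text \<open>The weight 1 + ln n dominates all coefficients met below: 1, ln n,
  \<open>mangoldt\<close> and \<open>mangoldt\<close> divided by ln. Half of the excess a - 1 pays
  for the logarithm.\<close>

lemma summable_dirichlet_majorant:
  assumes "a > 1"
  shows "summable (\<lambda>n. (1 + ln (real (Suc n))) * real (Suc n) powr (-a))"
proof (rule summable_comparison_test')
  define d where "d = (a - 1) / 2"
  have d: "d > 0" using assms by (simp add: d_def)
  show "summable (\<lambda>n. (1 + 1 / d) * real (Suc n) powr (-a + d))"
    using assms by (intro summable_mult summable_Suc_powr) (auto simp: d_def field_simps)
  fix n :: nat
  have "1 + ln (real (Suc n)) \<le> real (Suc n) powr d + real (Suc n) powr d / d"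
    using d ge_one_powr_ge_zero[of "real (Suc n)" d] by (intro add_mono ln_powr_bound) auto
  also have "\<dots> = (1 + 1 / d) * real (Suc n) powr d" using d by (simp add: field_simps)
  finally have "(1 + ln (real (Suc n))) * real (Suc n) powr (-a) \<le> (1 + 1 / d) * real (Suc n) powr d * real (Suc n) powr (-a)"
    by (intro mult_right_mono) auto
  also have "\<dots> = (1 + 1 / d) * real (Suc n) powr (-a + d)"
    by (simp only: powr_add mult_ac)
  finally show "norm ((1 + ln (real (Suc n))) * real (Suc n) powr (-a)) \<le> (1 + 1 / d) * real (Suc n) powr (-a + d)"
    by simp
qed

lemma summable_dirichlet:
  assumes "\<And>n. norm (a n) \<le> 1 + ln (real (Suc n))" "Re s > 1"
  shows "summable (\<lambda>n. norm (a n * of_nat (Suc n) powr (-s) :: complex))"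
  by (rule summable_comparison_test'[OF summable_dirichlet_majorant[OF assms(2)], of 0])
     (auto simp: norm_mult norm_Suc_powr intro!: mult_right_mono assms simp del: of_nat_Suc)

lemma dirichlet_series_deriv:
  fixes a :: "nat \<Rightarrow> complex"
  assumes a: "\<And>n. norm (a n) \<le> 1 + ln (real (Suc n))" and s: "Re s > 1"
  shows "((\<lambda>s. \<Sum>n. a n * of_nat (Suc n) powr (-s)) has_field_derivative
          -(\<Sum>n. a n * ln (real (Suc n)) * of_nat (Suc n) powr (-s))) (at s)"
    and "summable (\<lambda>n. a n * ln (real (Suc n)) * of_nat (Suc n) powr (-s))"
proof -
  define S where "S = {s. Re s > 1}"
  define f where "f = (\<lambda>n s. a n * of_nat (Suc n) powr (-s))"
  define f' where "f' = (\<lambda>n s. -(a n * ln (real (Suc n)) * of_nat (Suc n) powr (-s)))"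
  have openS: "open S" unfolding S_def by (rule open_halfspace_Re_gt)
  have "\<exists>g g'. \<forall>x\<in>S. (\<lambda>n. f n x) sums g x \<and> (\<lambda>n. f' n x) sums g' x \<and> (g has_field_derivative g' x) (at x)"
  proof (rule series_and_derivative_comparison_complex[OF openS])
    fix n x
    show "(f n has_field_derivative f' n x) (at x)"
      using DERIV_cmult[OF deriv_const_powr_minus[of "of_nat (Suc n)" x], of "a n"]
      unfolding f_def f'_def by (simp add: Ln_of_nat mult_ac del: of_nat_Suc)
  next
    fix x assume x: "x \<in> S"
    define d where "d = (Re x - 1) / 2"
    define h where "h = (\<lambda>n. complex_of_real ((1 + ln (real (Suc n))) * real (Suc n) powr (-(1 + d))))"
    have d: "d > 0" using x by (simp add: d_def S_def)
    show "\<exists>d h. 0 < d \<and> summable h \<and> range h \<subseteq> \<real>\<^sub>\<ge>\<^sub>0 \<and>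
            (\<forall>\<^sub>F n in sequentially. \<forall>y\<in>ball x d \<inter> S. cmod (f n y) \<le> cmod (h n))"
    proof (intro exI[of _ d] exI[of _ h] conjI always_eventually allI ballI)
      show "summable h" unfolding h_def summable_complex_of_real
        using d by (intro summable_dirichlet_majorant) auto
      fix n y assume y: "y \<in> ball x d \<inter> S"
      have 1: "norm (x - y) < d" using y by (simp add: dist_norm)
      have "Re x - Re y \<le> norm (x - y)" using complex_Re_le_cmod[of "x - y"] by simp
      hence 2: "Re y \<ge> 1 + d" using 1 by (simp add: d_def field_simps)
      have "norm (f n y) = norm (a n) * real (Suc n) powr (-Re y)"
        unfolding f_def norm_mult norm_Suc_powr by simp
      also have "\<dots> \<le> (1 + ln (real (Suc n))) * real (Suc n) powr (-(1 + d))"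
        using 2 by (intro mult_mono a powr_mono) auto
      also have "\<dots> = norm (h n)" unfolding h_def norm_of_real by (subst abs_of_nonneg) auto
      finally show "norm (f n y) \<le> norm (h n)" .
    qed (use d in \<open>auto simp: h_def\<close>)
  qed
  then obtain g g' where g: "\<And>x. x \<in> S \<Longrightarrow> (\<lambda>n. f n x) sums g x"
    "\<And>x. x \<in> S \<Longrightarrow> (\<lambda>n. f' n x) sums g' x" "\<And>x. x \<in> S \<Longrightarrow> (g has_field_derivative g' x) (at x)"
    by blast
  have sS: "s \<in> S" using s by (simp add: S_def)
  show sm: "summable (\<lambda>n. a n * ln (real (Suc n)) * of_nat (Suc n) powr (-s))"
    using sums_summable[OF g(2)[OF sS]] unfolding f'_def by (simp only: summable_minus_iff)
  have "g' s = -(\<Sum>n. a n * ln (real (Suc n)) * of_nat (Suc n) powr (-s))"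
    using g(2)[OF sS] sm unfolding f'_def by (simp add: sums_iff suminf_minus)
  moreover have "((\<lambda>s. \<Sum>n. f n s) has_field_derivative g' s) (at s)"
    by (rule has_field_derivative_transform_within_open[OF g(3)[OF sS] openS sS]) (use g(1) in \<open>auto simp: sums_iff\<close>)
  ultimately show "((\<lambda>s. \<Sum>n. a n * of_nat (Suc n) powr (-s)) has_field_derivative
          -(\<Sum>n. a n * ln (real (Suc n)) * of_nat (Suc n) powr (-s))) (at s)"
    by (simp add: f_def)
qed

lemma summable_zeta: "Re s > 1 \<Longrightarrow> summable (\<lambda>n. norm (complex_of_nat (Suc n) powr (-s)))"
  using summable_dirichlet[of "\<lambda>_. 1" s] by simp

text \<open>The differences of n^(1 - s) telescope to -1 and cancel the leading 1 of
  \<open>Zf\<close>.\<close>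

lemma Zf_eq_zeta:
  assumes "Re s > 1"
  shows "Zf s = (s - 1) * zeta s"
proof -
  define f where "f = (\<lambda>n. complex_of_nat (Suc n) powr (1 - s))"
  have "(\<lambda>n. norm (f n)) \<longlonglongrightarrow> 0"
  proof -
    have "(\<lambda>n. real (Suc n) powr (1 - Re s)) \<longlonglongrightarrow> 0"
      using assms by real_asymp
    thus ?thesis by (simp only: f_def norm_Suc_powr) simp
  qed
  hence "f \<longlonglongrightarrow> 0" by (rule tendsto_norm_zero_cancel)
  hence "(\<lambda>n. f (Suc n) - f n) sums (0 - f 0)" by (rule telescope_sums)
  moreover have "(\<lambda>n. (s - 1) * of_nat (Suc n) powr (-s)) sums ((s - 1) * zeta s)"
    unfolding zeta_def by (rule sums_mult[OF summable_sums[OF summable_norm_cancel[OF summable_zeta[OF assms]]]])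
  ultimately have "(\<lambda>n. (s - 1) * of_nat (Suc n) powr (-s) + (f (Suc n) - f n)) sums ((s - 1) * zeta s + (0 - f 0))"
    by (intro sums_add)
  moreover have "(\<lambda>n. (s - 1) * of_nat (Suc n) powr (-s) + (f (Suc n) - f n)) = (\<lambda>n. zf n s)"
    by (simp add: zf_def f_def algebra_simps fun_eq_iff)
  ultimately show ?thesis by (simp add: sums_iff Zf_def f_def)
qed

definition mangoldt_series :: "complex \<Rightarrow> complex" where
  "mangoldt_series s = (\<Sum>n. of_real (mangoldt (Suc n)) * of_nat (Suc n) powr (-s))"

text \<open>A logarithm of zeta as a Dirichlet series. At n = 0 the coefficient reads 0 / 0, which
  evaluates to 0, the correct value.\<close>

definition log_zeta :: "complex \<Rightarrow> complex" where
  "log_zeta s = (\<Sum>n. of_real (mangoldt (Suc n) / ln (real (Suc n))) * of_nat (Suc n) powr (-s))"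

lemma mangoldt_le_one_plus_ln: "\<bar>mangoldt (Suc n)\<bar> \<le> 1 + ln (real (Suc n))"
  using mangoldt_le[of "Suc n"] by simp

lemma summable_mangoldt_series:
  "Re s > 1 \<Longrightarrow> summable (\<lambda>n. norm (complex_of_real (mangoldt (Suc n)) * of_nat (Suc n) powr (-s)))"
  by (rule summable_dirichlet) (use mangoldt_le_one_plus_ln in \<open>auto simp del: of_real_mangoldt of_nat_Suc\<close>)

lemma mangoldt_div_ln_le: "\<bar>mangoldt (Suc n) / ln (real (Suc n))\<bar> \<le> 1"
proof (cases "n = 0")
  case False
  hence "ln (real (Suc n)) > 0" by simp
  thus ?thesis using mangoldt_le[of "Suc n"] by (simp add: abs_div divide_le_eq)
qed simp

lemma mangoldt_div_ln_le': "\<bar>mangoldt (Suc n) / ln (real (Suc n))\<bar> \<le> 1 + ln (real (Suc n))"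
  by (rule order_trans[OF mangoldt_div_ln_le]) simp

lemma log_zeta_deriv:
  assumes "Re s > 1"
  shows "(log_zeta has_field_derivative -mangoldt_series s) (at s)"
proof -
  have "(\<Sum>n. complex_of_real (mangoldt (Suc n) / ln (real (Suc n))) * ln (real (Suc n)) * of_nat (Suc n) powr (-s))
     = mangoldt_series s"
    unfolding mangoldt_series_def
  proof (intro suminf_cong arg_cong2[where f = "(*)"] refl)
    fix n
    have "complex_of_real (mangoldt (Suc n) / ln (real (Suc n))) * ln (real (Suc n)) =
          complex_of_real (mangoldt (Suc n) / ln (real (Suc n)) * ln (real (Suc n)))"
      by (simp only: of_real_mult)
    also have "mangoldt (Suc n) / ln (real (Suc n)) * ln (real (Suc n)) = mangoldt (Suc n)"
      by (cases "n = 0") auto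
    finally show "complex_of_real (mangoldt (Suc n) / ln (real (Suc n))) * ln (real (Suc n)) = complex_of_real (mangoldt (Suc n))" .
  qed
  thus ?thesis
    using dirichlet_series_deriv(1)[of "\<lambda>n. complex_of_real (mangoldt (Suc n) / ln (real (Suc n)))" s] assms
      mangoldt_div_ln_le'
    unfolding log_zeta_def[abs_def] norm_of_real by metis
qed

text \<open>The convolution of the constant 1 with \<open>mangoldt\<close> is ln. Absolute
  summability over all pairs of indices allows the double series to be grouped by their
  product.\<close>

lemma zeta_times_mangoldt_series:
  fixes s :: complex
  assumes s: "Re s > 1"
  shows "zeta s * mangoldt_series s = (\<Sum>n. complex_of_real (ln (real (Suc n))) * of_nat (Suc n) powr (-s))"
proof -
  \<comment> \<open>The index is no longer shifted: the series now start at n = 0, where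
    \<open>0 powr (-s)\<close> is 0 and adds nothing.\<close>
  define a where "a = (\<lambda>n. complex_of_nat n powr (-s))"
  define b where "b = (\<lambda>n. complex_of_real (mangoldt n) * a n)"
  have a_mult: "a (m * n) = a m * a n" for m n
    unfolding a_def by (simp add: powr_times_real of_nat_mult)
  have sa: "summable (\<lambda>n. norm (a n))" "summable (\<lambda>n. norm (b n))"
  proof -
    show "summable (\<lambda>n. norm (a n))"
      by (subst summable_Suc_iff[symmetric]) (use summable_zeta[OF s] in \<open>simp only: a_def\<close>)
    show "summable (\<lambda>n. norm (b n))"
      by (subst summable_Suc_iff[symmetric]) (use summable_mangoldt_series[OF s] in \<open>simp only: a_def b_def\<close>)
  qed
  have hz: "(\<Sum>n. a n) = zeta s"
    using suminf_split_head[OF summable_norm_cancel[OF sa(1)]] by (simp add: zeta_def a_def)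
  have hm: "(\<Sum>n. b n) = mangoldt_series s"
    using suminf_split_head[OF summable_norm_cancel[OF sa(2)]] by (simp add: mangoldt_series_def a_def b_def)
  have abs_a: "(\<lambda>n. norm (a n)) summable_on UNIV" and abs_b: "(\<lambda>n. norm (b n)) summable_on UNIV"
    using sa by (simp_all add: summable_nonneg_imp_summable_on)
  have "(\<lambda>p. norm (a (fst p) * b (snd p))) summable_on (UNIV \<times> UNIV)"
  proof (subst Infinite_Sum.abs_summable_on_Sigma_iff, intro conjI ballI)
    fix m
    show "(\<lambda>n. norm (a (fst (m, n)) * b (snd (m, n)))) summable_on UNIV"
      unfolding norm_mult fst_conv snd_conv by (rule summable_on_cmult_right[OF abs_b])
    have "(\<lambda>m. norm (a m) * (\<Sum>\<^sub>\<infinity>n. norm (b n))) summable_on UNIV"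
      by (rule summable_on_cmult_left[OF abs_a])
    moreover have "norm (\<Sum>\<^sub>\<infinity>n. norm (a (fst (m, n)) * b (snd (m, n)))) = norm (a m) * (\<Sum>\<^sub>\<infinity>n. norm (b n))" for m
      by (simp add: norm_mult infsum_cmult_right' infsum_nonneg)
    ultimately show "(\<lambda>m. norm (\<Sum>\<^sub>\<infinity>n. norm (a (fst (m, n)) * b (snd (m, n))))) summable_on UNIV"
      by simp
  qed
  hence "(\<lambda>p. a (fst p) * b (snd p)) summable_on (UNIV \<times> UNIV)"
    by (rule abs_summable_summable)
  hence prod_sum: "(\<lambda>(m, n). a m * b n) summable_on (UNIV \<times> UNIV)"
    by (simp add: case_prod_unfold)
  have "(\<Sum>\<^sub>\<infinity>m. \<Sum>\<^sub>\<infinity>n. a m * b n) = infsum (\<lambda>(m, n). a m * b n) (UNIV \<times> UNIV)"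
    by (rule infsum_Sigma'_banach[OF prod_sum])
  moreover have "(\<Sum>\<^sub>\<infinity>m. \<Sum>\<^sub>\<infinity>n. a m * b n) = infsum a UNIV * infsum b UNIV"
    by (simp add: infsum_cmult_right' infsum_cmult_left')
  moreover have "infsum a UNIV = zeta s"
    using norm_summable_imp_has_sum[OF sa(1) summable_sums[OF summable_norm_cancel[OF sa(1)]]] hz by (simp add: infsumI)
  moreover have "infsum b UNIV = mangoldt_series s"
    using norm_summable_imp_has_sum[OF sa(2) summable_sums[OF summable_norm_cancel[OF sa(2)]]] hm by (simp add: infsumI)
  ultimately have lhs: "infsum (\<lambda>(m, n). a m * b n) (UNIV \<times> UNIV) = zeta s * mangoldt_series s" by simp
  define g where "g = (\<lambda>p. a (fst p) * b (snd p))"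
  have g: "g summable_on (UNIV \<times> UNIV)" "infsum g (UNIV \<times> UNIV) = zeta s * mangoldt_series s"
    using prod_sum lhs by (simp_all add: g_def case_prod_unfold)
  define P where "P = {p::nat\<times>nat. fst p > 0 \<and> snd p > 0}"
  have gP: "infsum g P = zeta s * mangoldt_series s"
    unfolding g(2)[symmetric]
    by (rule infsum_cong_neutral) (auto simp: P_def g_def b_def a_def)
  have sP: "g summable_on P" using g(1) by (rule summable_on_subset_banach) auto
  define Q where "Q = (SIGMA k:{0<..}. {d. d dvd (k::nat)})"
  \<comment> \<open>A pair (m, d) of positive indices corresponds to the product k = m d together
    with its divisor d.\<close>
  have bij: "bij_betw (\<lambda>(k, d). (k div d, d)) Q P"
    by (rule bij_betwI[where g = "\<lambda>(m, d). (m * d, d)"])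
       (auto simp: Q_def P_def dvd_div_eq_0_iff intro!: Nat.gr0I dest: dvd_pos_nat)
  have sQ: "(\<lambda>x. g (case x of (k, d) \<Rightarrow> (k div d, d))) summable_on Q"
    using summable_on_reindex_bij_betw[OF bij, of g] sP by simp
  have "zeta s * mangoldt_series s = infsum (\<lambda>x. g (case x of (k, d) \<Rightarrow> (k div d, d))) Q"
    using infsum_reindex_bij_betw[OF bij, of g] gP by simp
  also have "\<dots> = (\<Sum>\<^sub>\<infinity>k\<in>{0<..}. \<Sum>\<^sub>\<infinity>d\<in>{d. d dvd k}. g (k div d, d))"
    using infsum_Sigma_banach[OF sQ[unfolded Q_def]] unfolding Q_def by simp
  also have "\<dots> = (\<Sum>\<^sub>\<infinity>k\<in>{0<..}. complex_of_real (ln (real k)) * a k)"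
  proof (rule infsum_cong)
    fix k :: nat assume k: "k \<in> {0<..}"
    have fin: "finite {d. d dvd k}" using k by auto
    have "(\<Sum>\<^sub>\<infinity>d\<in>{d. d dvd k}. g (k div d, d)) = (\<Sum>d | d dvd k. g (k div d, d))"
      using fin by simp
    also have "\<dots> = (\<Sum>d | d dvd k. complex_of_real (mangoldt d) * a k)"
    proof (rule sum.cong[OF refl])
      fix d assume "d \<in> {d. d dvd k}"
      hence "a k = a (k div d) * a d" by (simp flip: a_mult)
      thus "g (k div d, d) = complex_of_real (mangoldt d) * a k"
        by (simp only: g_def b_def fst_conv snd_conv mult_ac)
    qed
    also have "\<dots> = complex_of_real (\<Sum>d | d dvd k. mangoldt d) * a k"
      by (simp add: sum_distrib_right del: of_real_mangoldt)
    also have "(\<Sum>d | d dvd k. mangoldt d :: real) = ln (real k)"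
      using mangoldt_sum[of k, where ?'a = real] k by simp
    finally show "(\<Sum>\<^sub>\<infinity>d\<in>{d. d dvd k}. g (k div d, d)) = complex_of_real (ln (real k)) * a k" .
  qed
  also have "\<dots> = (\<Sum>\<^sub>\<infinity>n. complex_of_real (ln (real (Suc n))) * a (Suc n))"
    by (rule infsum_reindex_bij_betw[symmetric, where g = Suc])
       (auto simp: bij_betw_def image_def gr0_conv_Suc)
  also have "\<dots> = (\<Sum>n. complex_of_real (ln (real (Suc n))) * a (Suc n))"
  proof -
    have "summable (\<lambda>n. norm (complex_of_real (ln (real (Suc n))) * a (Suc n)))"
      using summable_dirichlet[of "\<lambda>n. complex_of_real (ln (real (Suc n)))" s] s by (simp add: a_def del: of_nat_Suc)
    from norm_summable_imp_has_sum[OF this summable_sums[OF summable_norm_cancel[OF this]]]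
    show ?thesis by (rule infsumI)
  qed
  finally show ?thesis by (simp add: a_def)
qed

lemma zeta_deriv:
  assumes "Re s > 1"
  shows "(zeta has_field_derivative -(zeta s * mangoldt_series s)) (at s)"
proof -
  have "((\<lambda>s. \<Sum>n. 1 * of_nat (Suc n) powr (-s)) has_field_derivative -(zeta s * mangoldt_series s)) (at s)"
    using dirichlet_series_deriv(1)[of "\<lambda>_. 1" s] assms
    unfolding zeta_times_mangoldt_series[OF assms] by simp
  thus ?thesis by (simp only: zeta_def[abs_def] mult_1)
qed

text \<open>The product of zeta and exp (-log_zeta) has derivative zero on a convex set, hence is
  constant, and the constant cannot vanish because zeta(2) > 0. This takes the place of the Euler
  product: it supplies the logarithm and the absence of zeros at once.\<close>

lemma zeta_eq_exp_log_zeta: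
  obtains c where "c \<noteq> 0" "\<And>s. Re s > 1 \<Longrightarrow> zeta s = c * exp (log_zeta s)"
proof -
  define S where "S = {s. Re s > 1}"
  have "\<exists>c. \<forall>s\<in>S. zeta s * exp (-log_zeta s) = c"
  proof (rule has_field_derivative_zero_constant)
    show "convex S" unfolding S_def by (rule convex_halfspace_Re_gt)
    fix s assume "s \<in> S"
    hence s: "Re s > 1" by (simp add: S_def)
    have "((\<lambda>s. zeta s * exp (-log_zeta s)) has_field_derivative 0) (at s)"
      by (rule derivative_eq_intros zeta_deriv[OF s] log_zeta_deriv[OF s] refl)+ (simp add: algebra_simps)
    thus "((\<lambda>s. zeta s * exp (-log_zeta s)) has_field_derivative 0) (at s within S)"
      by (rule has_field_derivative_at_within)
  qed
  then obtain c where c: "\<And>s. Re s > 1 \<Longrightarrow> zeta s * exp (-log_zeta s) = c" by (auto simp: S_def)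
  have eq: "zeta s = c * exp (log_zeta s)" if "Re s > 1" for s
    using c[OF that] by (simp add: exp_minus field_simps)
  have "c \<noteq> 0"
  proof
    assume "c = 0"
    hence "zeta 2 = 0" using eq[of 2] by simp
    have sm: "summable (\<lambda>n. complex_of_nat (Suc n) powr (-2))"
      using summable_norm_cancel[OF summable_zeta[of 2]] by simp
    have re: "Re (complex_of_nat (Suc n) powr (-2)) = real (Suc n) powr (-2)" for n
      using powr_of_real[of "real (Suc n)" "-2"] by (simp del: of_nat_Suc)
    have "Re (zeta 2) = (\<Sum>n. real (Suc n) powr (-2))"
      unfolding zeta_def using sm by (subst Re_suminf) (auto simp: re simp del: of_nat_Suc)
    also have "\<dots> > 0"
      by (intro suminf_pos summable_Suc_powr) auto
    finally show False using \<open>zeta 2 = 0\<close> by simp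
  qed
  with eq that show ?thesis by blast
qed

section \<open>Lower bounds for zeta near the line Re s = 1\<close>

lemma Re_log_zeta:
  assumes "\<sigma> > 1"
  shows "(\<lambda>n. mangoldt (Suc n) / ln (real (Suc n)) * real (Suc n) powr (-\<sigma>) * cos (t * ln (real (Suc n)))) sums
           Re (log_zeta (Complex \<sigma> t))"
proof -
  have "summable (\<lambda>n. norm (complex_of_real (mangoldt (Suc n) / ln (real (Suc n))) * of_nat (Suc n) powr (-Complex \<sigma> t)))"
    using assms mangoldt_div_ln_le' by (intro summable_dirichlet) (simp_all only: norm_of_real complex.sel)
  from summable_sums[OF summable_norm_cancel[OF this]] have "(\<lambda>n. complex_of_real (mangoldt (Suc n) / ln (real (Suc n))) * of_nat (Suc n) powr (-Complex \<sigma> t)) sums log_zeta (Complex \<sigma> t)"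
    by (simp only: log_zeta_def)
  hence "(\<lambda>n. Re (complex_of_real (mangoldt (Suc n) / ln (real (Suc n))) * of_nat (Suc n) powr (-Complex \<sigma> t))) sums Re (log_zeta (Complex \<sigma> t))"
    by (rule sums_Re)
  moreover have "Re (complex_of_real r * of_nat (Suc n) powr (-Complex \<sigma> t)) =
        r * real (Suc n) powr (-\<sigma>) * cos (t * ln (real (Suc n)))" for n r
  proof -
    have "complex_of_nat (Suc n) powr (-Complex \<sigma> t) = exp (-Complex \<sigma> t * of_real (ln (real (Suc n))))"
      by (simp add: powr_def Ln_of_nat del: of_nat_Suc)
    hence "Re (complex_of_nat (Suc n) powr (-Complex \<sigma> t)) = exp (-\<sigma> * ln (real (Suc n))) * cos (t * ln (real (Suc n)))"
      by (simp add: Re_exp del: of_nat_Suc)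
    also have "exp (-\<sigma> * ln (real (Suc n))) = real (Suc n) powr (-\<sigma>)" by (simp add: powr_def)
    finally show ?thesis by (simp add: mult.assoc del: of_nat_Suc)
  qed
  ultimately show ?thesis by (simp only:)
qed

text \<open>The logarithm of the product is a series of nonnegative coefficients times 3 + 4 cos y +
  cos 2y = 2 (1 + cos y)^2. The constant of \<open>zeta_eq_exp_log_zeta\<close> enters 3 + 4 + 1
  times, so the lower bound is its eighth power.\<close>

lemma three_four_one:
  "\<exists>c>0. \<forall>\<sigma> t. \<sigma> > 1 \<longrightarrow>
     norm (zeta (Complex \<sigma> 0)) ^ 3 * norm (zeta (Complex \<sigma> t)) ^ 4 * norm (zeta (Complex \<sigma> (2 * t))) \<ge> c"
proof -
  obtain c where c: "c \<noteq> 0" "\<And>s. Re s > 1 \<Longrightarrow> zeta s = c * exp (log_zeta s)"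
    using zeta_eq_exp_log_zeta by blast
  show ?thesis
  proof (intro exI[of _ "norm c ^ 8"] conjI allI impI)
    fix \<sigma> t :: real assume \<sigma>: "\<sigma> > 1"
    have nz: "norm (zeta (Complex \<sigma> u)) = norm c * exp (Re (log_zeta (Complex \<sigma> u)))" for u
      using c(2)[of "Complex \<sigma> u"] \<sigma> by (simp add: norm_mult)
    define E where "E = 3 * Re (log_zeta (Complex \<sigma> 0)) + 4 * Re (log_zeta (Complex \<sigma> t)) + Re (log_zeta (Complex \<sigma> (2 * t)))"
    define e where "e = (\<lambda>n. mangoldt (Suc n) / ln (real (Suc n)) * real (Suc n) powr (-\<sigma>))"
    have h1: "(\<lambda>n. 3 * (e n * cos (0 * ln (real (Suc n)))) + 4 * (e n * cos (t * ln (real (Suc n)))) + e n * cos (2 * t * ln (real (Suc n)))) sums E"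
      unfolding E_def e_def by (intro sums_add sums_mult Re_log_zeta \<sigma>)
    have h2: "0 \<le> 3 * (e n * cos (0 * ln (real (Suc n)))) + 4 * (e n * cos (t * ln (real (Suc n)))) + e n * cos (2 * t * ln (real (Suc n)))" for n
    proof -
      define y where "y = t * ln (real (Suc n))"
      have "3 * (e n * cos (0 * ln (real (Suc n)))) + 4 * (e n * cos (t * ln (real (Suc n)))) + e n * cos (2 * t * ln (real (Suc n)))
          = e n * (3 + 4 * cos y + cos (2 * y))" by (simp add: y_def algebra_simps)
      also have "3 + 4 * cos y + cos (2 * y) = 2 * (1 + cos y) ^ 2"
        using cos_double_cos[of y] by (simp only:) (simp add: power2_eq_square algebra_simps)
      also have "e n * \<dots> \<ge> 0" by (simp add: e_def mangoldt_nonneg)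
      finally show ?thesis by simp
    qed
    have "E \<ge> 0" by (rule sums_le[OF h2 sums_zero h1])
    have "norm (zeta (Complex \<sigma> 0)) ^ 3 * norm (zeta (Complex \<sigma> t)) ^ 4 * norm (zeta (Complex \<sigma> (2 * t))) =
          norm c ^ 8 * (exp (Re (log_zeta (Complex \<sigma> 0))) ^ 3 * exp (Re (log_zeta (Complex \<sigma> t))) ^ 4 * exp (Re (log_zeta (Complex \<sigma> (2 * t)))))"
    proof -
      have "(n * x) ^ 3 * (n * y) ^ 4 * (n * z) = n ^ 8 * (x ^ 3 * y ^ 4 * z)" for n x y z :: real
        by (simp add: eval_nat_numeral algebra_simps)
      thus ?thesis unfolding nz by blast
    qed
    also have "exp (Re (log_zeta (Complex \<sigma> 0))) ^ 3 * exp (Re (log_zeta (Complex \<sigma> t))) ^ 4 * exp (Re (log_zeta (Complex \<sigma> (2 * t)))) = exp E"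
      by (simp add: E_def exp_add flip: exp_of_nat_mult)
    finally show "norm c ^ 8 \<le> norm (zeta (Complex \<sigma> 0)) ^ 3 * norm (zeta (Complex \<sigma> t)) ^ 4 * norm (zeta (Complex \<sigma> (2 * t)))"
      using \<open>E \<ge> 0\<close> by (simp add: mult_le_cancel_left1)
  qed (use c in auto)
qed

text \<open>Cauchy's inequality on discs of radius 1/2, which stay inside Re s \<ge> 1/2, transfers
  the quadratic growth of \<open>Zf_bound\<close> to two derivatives.\<close>

lemma Zf_bound_strip:
  "\<exists>C\<ge>1. \<forall>\<sigma> t. 1 \<le> \<sigma> \<and> \<sigma> \<le> 2 \<longrightarrow>
     norm (Zf (Complex \<sigma> t)) \<le> C * (1 + \<bar>t\<bar>) ^ 2 \<and>
     norm (deriv Zf (Complex \<sigma> t)) \<le> C * (1 + \<bar>t\<bar>) ^ 2 \<and>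
     norm (deriv (deriv Zf) (Complex \<sigma> t)) \<le> C * (1 + \<bar>t\<bar>) ^ 2"
proof -
  obtain C where C: "C \<ge> 1" "\<And>s. Re s \<ge> 1/2 \<Longrightarrow> norm (Zf s) \<le> C * (1 + norm s) ^ 2"
    using Zf_bound by blast
  show ?thesis
  \<comment> \<open>The factor 128 is 2! times 16 times 2^2, for the second derivative on radius
    1/2; here 16 = 4^2 stems from 1 + |w| \<le> 4 (1 + |t|) on the disc.\<close>
  proof (intro exI[of _ "128 * C"] conjI allI impI)
    fix \<sigma> t :: real assume \<sigma>: "1 \<le> \<sigma> \<and> \<sigma> \<le> 2"
    define s where "s = Complex \<sigma> t"
    have ns: "norm s \<le> 2 + \<bar>t\<bar>"
      using cmod_le[of s] \<sigma> by (simp add: s_def)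
    have B: "norm (Zf w) \<le> 16 * C * (1 + \<bar>t\<bar>) ^ 2" if "norm (s - w) \<le> 1/2" for w
    proof -
      have "Re s - Re w \<le> norm (s - w)" using complex_Re_le_cmod[of "s - w"] by simp
      hence "Re w \<ge> 1/2" using that \<sigma> by (simp add: s_def)
      hence "norm (Zf w) \<le> C * (1 + norm w) ^ 2" by (rule C)
      also have "\<dots> \<le> C * (4 * (1 + \<bar>t\<bar>)) ^ 2"
      proof (intro mult_left_mono power_mono)
        have "norm w \<le> norm s + norm (s - w)" using norm_triangle_ineq4[of s "s - w"] by simp
        thus "1 + norm w \<le> 4 * (1 + \<bar>t\<bar>)" using that ns abs_ge_zero[of t] by argo
      qed (use C in auto)
      also have "\<dots> = 16 * C * (1 + \<bar>t\<bar>) ^ 2" by (simp add: power2_eq_square algebra_simps)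
      finally show ?thesis .
    qed
    have sub: "cball s (1/2) \<subseteq> {s. Re s > 0}"
    proof
      fix w assume "w \<in> cball s (1/2)"
      hence "norm (s - w) \<le> 1/2" by (simp add: dist_norm)
      thus "w \<in> {s. Re s > 0}" using complex_Re_le_cmod[of "s - w"] \<sigma> by (simp add: s_def)
    qed
    have hol: "Zf holomorphic_on cball s (1/2)" by (rule holomorphic_on_subset[OF Zf_holomorphic sub])
    have cauchy: "norm ((deriv ^^ n) Zf s) \<le> fact n * (16 * C * (1 + \<bar>t\<bar>) ^ 2) / (1/2) ^ n" for n
    proof (rule Cauchy_inequality)
      show "Zf holomorphic_on ball s (1/2)" by (rule holomorphic_on_subset[OF hol ball_subset_cball])
      show "continuous_on (cball s (1/2)) Zf" by (rule holomorphic_on_imp_continuous_on[OF hol])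
    qed (use B in auto)
    have pos: "0 \<le> C * (1 + \<bar>t\<bar>) ^ 2" using C by simp
    show "norm (Zf (Complex \<sigma> t)) \<le> 128 * C * (1 + \<bar>t\<bar>) ^ 2"
      using B[of s] pos by (simp add: s_def)
    show "norm (deriv Zf (Complex \<sigma> t)) \<le> 128 * C * (1 + \<bar>t\<bar>) ^ 2"
      using cauchy[of 1] pos by (simp add: s_def)
    show "norm (deriv (deriv Zf) (Complex \<sigma> t)) \<le> 128 * C * (1 + \<bar>t\<bar>) ^ 2"
      using cauchy[of 2] pos by (simp add: s_def numeral_2_eq_2)
  qed (use C in auto)
qed

lemma Zf_1: "Zf 1 = 1"
  by (simp add: Zf_def zf_def del: of_nat_Suc)

lemma Zf_deriv: "Re s > 0 \<Longrightarrow> (Zf has_field_derivative deriv Zf s) (at s)"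
  using Zf_holomorphic by (rule holomorphic_derivI) (auto simp: open_halfspace_Re_gt)

text \<open>\<open>three_four_one\<close> solved for the middle factor: zeta(\<sigma>) is at most C
  / (\<sigma> - 1), and zeta(\<sigma> + 2it) grows at most linearly in |t|. Keeping |t| \<ge> r
  allows zeta to be bounded by \<open>Zf\<close> over |t| at heights t and 2t.\<close>

lemma Zf_fourth_power_lower:
  assumes "0 < r"
  shows "\<exists>c>0. \<forall>\<sigma> t. 1 < \<sigma> \<and> \<sigma> \<le> 2 \<and> \<bar>t\<bar> \<ge> r \<longrightarrow> norm (Zf (Complex \<sigma> t)) ^ 4 \<ge> c * (\<sigma> - 1) ^ 3"
proof -
  obtain C where C: "C \<ge> 1" "\<And>\<sigma> t. 1 \<le> \<sigma> \<Longrightarrow> \<sigma> \<le> 2 \<Longrightarrow> norm (Zf (Complex \<sigma> t)) \<le> C * (1 + \<bar>t\<bar>) ^ 2"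
    using Zf_bound_strip by blast
  obtain c where c: "c > 0" "\<And>\<sigma> t. \<sigma> > 1 \<Longrightarrow>
     norm (zeta (Complex \<sigma> 0)) ^ 3 * norm (zeta (Complex \<sigma> t)) ^ 4 * norm (zeta (Complex \<sigma> (2 * t))) \<ge> c"
    using three_four_one by blast
  define k where "k = 1 + 1 / r"
  have k: "k > 0" using assms by (simp add: k_def add_pos_pos)
  define M where "M = 2 * C ^ 4 * k ^ 2 / r ^ 3"
  have M: "M > 0" using C k assms by (simp add: M_def)
  show ?thesis
  proof (intro exI[of _ "c / M"] conjI allI impI)
    fix \<sigma> t :: real assume *: "1 < \<sigma> \<and> \<sigma> \<le> 2 \<and> \<bar>t\<bar> \<ge> r"
    hence t: "\<bar>t\<bar> > 0" "\<bar>t\<bar> \<ge> r" and \<sigma>: "\<sigma> > 1" "\<sigma> \<le> 2" using assms by auto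
    have zeta: "norm (zeta (Complex \<sigma> u)) = norm (Zf (Complex \<sigma> u)) / norm (Complex (\<sigma> - 1) u)" for u
    proof -
      have "Complex \<sigma> u - 1 = Complex (\<sigma> - 1) u" by (simp add: complex_eq_iff)
      moreover have "Complex (\<sigma> - 1) u \<noteq> 0" using \<sigma> by (simp add: complex_eq_iff)
      ultimately show ?thesis using Zf_eq_zeta[of "Complex \<sigma> u"] \<sigma> by (simp add: norm_mult)
    qed
    have z0: "norm (zeta (Complex \<sigma> 0)) \<le> C / (\<sigma> - 1)"
    proof -
      have "norm (Complex (\<sigma> - 1) 0) = \<sigma> - 1" using \<sigma> by (simp add: cmod_def)
      thus ?thesis using zeta[of 0] C(2)[of \<sigma> 0] \<sigma> by (simp add: divide_right_mono)
    qed
    have np: "norm (Complex (\<sigma> - 1) u) > 0" for u using \<sigma> by (simp add: complex_eq_iff)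
    have z1: "norm (zeta (Complex \<sigma> t)) \<le> norm (Zf (Complex \<sigma> t)) / \<bar>t\<bar>"
      unfolding zeta using abs_Im_le_cmod[of "Complex (\<sigma> - 1) t"] t np by (intro divide_left_mono mult_pos_pos) auto
    have z2: "norm (zeta (Complex \<sigma> (2 * t))) \<le> 2 * C * k ^ 2 * \<bar>t\<bar>"
    proof -
      have "norm (zeta (Complex \<sigma> (2 * t))) \<le> norm (Zf (Complex \<sigma> (2 * t))) / (2 * \<bar>t\<bar>)"
        unfolding zeta using abs_Im_le_cmod[of "Complex (\<sigma> - 1) (2 * t)"] t np by (intro divide_left_mono mult_pos_pos) auto
      also have "\<dots> \<le> C * (1 + \<bar>2 * t\<bar>) ^ 2 / (2 * \<bar>t\<bar>)"
        using \<sigma> t by (intro divide_right_mono C(2)) auto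
      also have "\<dots> \<le> C * (2 * (k * \<bar>t\<bar>)) ^ 2 / (2 * \<bar>t\<bar>)"
      proof (intro divide_right_mono mult_left_mono power_mono)
        have "1 \<le> \<bar>t\<bar> / r" using t assms by simp
        hence "1 + \<bar>t\<bar> \<le> k * \<bar>t\<bar>" by (simp add: k_def algebra_simps)
        thus "1 + \<bar>2 * t\<bar> \<le> 2 * (k * \<bar>t\<bar>)" by simp
      qed (use C in auto)
      also have "\<dots> = 2 * C * k ^ 2 * \<bar>t\<bar>" using t by (simp add: power2_eq_square field_simps)
      finally show ?thesis .
    qed
    define Z where "Z = norm (Zf (Complex \<sigma> t))"
    have "c \<le> norm (zeta (Complex \<sigma> 0)) ^ 3 * norm (zeta (Complex \<sigma> t)) ^ 4 * norm (zeta (Complex \<sigma> (2 * t)))"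
      by (rule c) (use \<sigma> in auto)
    also have "\<dots> \<le> (C / (\<sigma> - 1)) ^ 3 * (Z / \<bar>t\<bar>) ^ 4 * (2 * C * k ^ 2 * \<bar>t\<bar>)"
      using z0 z1 z2 C k \<sigma> t unfolding Z_def
      by (intro mult_mono power_mono mult_nonneg_nonneg zero_le_power divide_nonneg_nonneg) auto
    also have "\<dots> = 2 * C ^ 4 * k ^ 2 / \<bar>t\<bar> ^ 3 * (Z ^ 4 / (\<sigma> - 1) ^ 3)"
    proof -
      have "(C / D) ^ 3 * (Z / T) ^ 4 * (2 * C * k ^ 2 * T) = 2 * C ^ 4 * k ^ 2 / T ^ 3 * (Z ^ 4 / D ^ 3)"
        if "D > 0" "T > 0" for D T :: real
        using that by (simp add: eval_nat_numeral field_simps)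
      thus ?thesis using t \<sigma> by simp
    qed
    also have "\<dots> \<le> M * (Z ^ 4 / (\<sigma> - 1) ^ 3)"
      unfolding M_def using t C assms \<sigma> by (intro mult_right_mono divide_left_mono power_mono) auto
    finally show "c / M * (\<sigma> - 1) ^ 3 \<le> norm (Zf (Complex \<sigma> t)) ^ 4"
      using M \<sigma> by (simp add: Z_def field_simps)
  qed (use c M in auto)
qed

text \<open>Near the real axis \<open>Zf\<close> is close to \<open>Zf 1\<close>, which is 1.
  Elsewhere \<open>Zf_fourth_power_lower\<close> degenerates towards the line Re s = 1, so it is
  used at distance b^4 from the line and carried inward by the derivative bound.\<close>

lemma Zf_lower:
  "\<exists>c>0. \<exists>r>0. r \<le> 1 \<and> (\<forall>\<sigma> t. 1 < \<sigma> \<and> \<sigma> \<le> 1 + r \<longrightarrow> norm (Zf (Complex \<sigma> t)) \<ge> c / (1 + \<bar>t\<bar>) ^ 6)"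
proof -
  have "continuous_on {s. Re s > 0} Zf"
    by (rule holomorphic_on_imp_continuous_on[OF Zf_holomorphic])
  hence "isCont Zf 1"
    by (rule continuous_on_interior) (auto simp: interior_open open_halfspace_Re_gt)
  then obtain \<delta> where \<delta>: "\<delta> > 0" "\<And>s. dist s 1 < \<delta> \<Longrightarrow> dist (Zf s) (Zf 1) < 1/2"
    unfolding continuous_at_eps_delta by (metis half_gt_zero_iff zero_less_one)
  define r where "r = min 1 (\<delta> / 3)"
  have r: "r > 0" "r \<le> 1" "2 * r < \<delta>" using \<delta> by (auto simp: r_def min_def)
  obtain C where C: "C \<ge> 1" "\<And>\<sigma> t. 1 \<le> \<sigma> \<Longrightarrow> \<sigma> \<le> 2 \<Longrightarrow> norm (deriv Zf (Complex \<sigma> t)) \<le> C * (1 + \<bar>t\<bar>) ^ 2"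
    using Zf_bound_strip by blast
  obtain c2 where c2: "c2 > 0" "\<And>\<sigma> t. 1 < \<sigma> \<Longrightarrow> \<sigma> \<le> 2 \<Longrightarrow> \<bar>t\<bar> \<ge> r \<Longrightarrow> norm (Zf (Complex \<sigma> t)) ^ 4 \<ge> c2 * (\<sigma> - 1) ^ 3"
    using Zf_fourth_power_lower[OF r(1)] by blast
  define c3 where "c3 = root 4 c2"
  have c3: "c3 > 0" "c3 ^ 4 = c2" using c2 by (auto simp: c3_def)
  define \<beta> where "\<beta> = min r (c3 / (2 * C))"
  have \<beta>: "\<beta> > 0" "\<beta> \<le> r" "\<beta> * C \<le> c3 / 2"
    using r c3 C by (auto simp: \<beta>_def min_def field_simps)
  define c where "c = min (1/2) (c3 * \<beta> ^ 3 / 2)"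
  have c: "c > 0" using c3 \<beta> by (simp add: c_def)
  have main: "norm (Zf (Complex \<sigma> t)) \<ge> c / (1 + \<bar>t\<bar>) ^ 6" if \<sigma>: "1 < \<sigma>" "\<sigma> \<le> 1 + r" for \<sigma> t
  proof (cases "\<bar>t\<bar> \<ge> r")
    case False
    have "norm (Complex \<sigma> t - 1) \<le> \<bar>\<sigma> - 1\<bar> + \<bar>t\<bar>" using cmod_le[of "Complex \<sigma> t - 1"] by simp
    also have "\<dots> < \<delta>" using False \<sigma> r by simp
    finally have "norm (Zf (Complex \<sigma> t) - 1) < 1/2" using \<delta>(2) by (simp add: dist_norm Zf_1)
    hence "norm (Zf (Complex \<sigma> t)) \<ge> 1/2"
      using norm_triangle_ineq2[of 1 "1 - Zf (Complex \<sigma> t)"] by (simp add: norm_minus_commute)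
    moreover have "c / (1 + \<bar>t\<bar>) ^ 6 \<le> c / 1" using c by (intro divide_left_mono one_le_power) auto
    moreover have "c \<le> 1/2" by (simp add: c_def)
    ultimately show ?thesis by linarith
  next
    case t: True
    define \<tau> where "\<tau> = 1 + \<bar>t\<bar>"
    have \<tau>: "\<tau> \<ge> 1" by (simp add: \<tau>_def)
    \<comment> \<open>At distance b^4 the lower bound is c3 b^3, while moving inward costs at most C
      \<tau>^2 b^4 = C \<beta> b^3, which the choice of \<beta> makes at most half of it. The
      remaining c3 b^3 / 2 is the source of the exponent 6.\<close>
    define b where "b = \<beta> / \<tau> ^ 2"
    have b: "0 < b" "b \<le> \<beta>" using \<beta> \<tau> by (auto simp: b_def field_simps mult_le_cancel_left1)
    have b4: "b ^ 4 \<le> r"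
    proof -
      have "b ^ 4 \<le> b ^ 1" using b \<beta> r by (intro power_decreasing) auto
      thus ?thesis using b \<beta> by simp
    qed
    have big: "norm (Zf (Complex s t)) \<ge> c3 * b ^ 3" if "1 + b ^ 4 \<le> s" "s \<le> 1 + r" for s
    proof -
      have "(c3 * b ^ 3) ^ 4 = c2 * (b ^ 4) ^ 3" by (simp add: power_mult_distrib c3 flip: power_mult)
      also have "\<dots> \<le> c2 * (s - 1) ^ 3" using that b c2 by (intro mult_left_mono power_mono) auto
      also have "\<dots> \<le> norm (Zf (Complex s t)) ^ 4"
      proof (rule c2(2))
        have "0 < b ^ 4" using b by simp
        thus "1 < s" using that by linarith
      qed (use that r t in auto)
      finally show ?thesis by (rule power_le_imp_le_base[where n = 3, simplified]) auto
    qed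
    have "norm (Zf (Complex \<sigma> t)) \<ge> c3 * b ^ 3 / 2"
    proof (cases "1 + b ^ 4 \<le> \<sigma>")
      case True
      have "0 \<le> c3 * b ^ 3" using c3 b by simp
      thus ?thesis using big[OF True \<sigma>(2)] by simp
    next
      case False
      define \<sigma>1 where "\<sigma>1 = 1 + b ^ 4"
      have \<sigma>1: "\<sigma> < \<sigma>1" "\<sigma>1 \<le> 1 + r" using False b4 by (auto simp: \<sigma>1_def)
      have "norm (Zf (Complex \<sigma>1 t) - Zf (Complex \<sigma> t)) \<le> (C * \<tau> ^ 2) * norm (Complex \<sigma>1 t - Complex \<sigma> t)"
      proof (rule field_differentiable_bound)
        show "convex {s. Re s \<in> {\<sigma>..\<sigma>1} \<and> Im s = t}"
        proof -
          have "{s. Re s \<in> {\<sigma>..\<sigma>1} \<and> Im s = t} =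
                ({s. Re s \<ge> \<sigma>} \<inter> {s. Re s \<le> \<sigma>1}) \<inter> ({s. Im s \<ge> t} \<inter> {s. Im s \<le> t})" by auto
          thus ?thesis
            by (simp only:) (intro convex_Int convex_halfspace_Re_ge convex_halfspace_Re_le convex_halfspace_Im_ge convex_halfspace_Im_le)
        qed
        fix z assume z: "z \<in> {s. Re s \<in> {\<sigma>..\<sigma>1} \<and> Im s = t}"
        show "(Zf has_field_derivative deriv Zf z) (at z within {s. Re s \<in> {\<sigma>..\<sigma>1} \<and> Im s = t})"
          by (rule has_field_derivative_at_within[OF Zf_deriv]) (use z \<sigma> in auto)
        have "z = Complex (Re z) t" using z by (simp add: complex_eq_iff)
        moreover have "norm (deriv Zf (Complex (Re z) t)) \<le> C * \<tau> ^ 2"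
          unfolding \<tau>_def using z \<sigma> \<sigma>1 r by (intro C(2)) auto
        ultimately show "norm (deriv Zf z) \<le> C * \<tau> ^ 2" by simp
      qed (use \<sigma>1 in auto)
      also have "norm (Complex \<sigma>1 t - Complex \<sigma> t) = \<sigma>1 - \<sigma>" using \<sigma>1 by (simp add: cmod_def)
      also have "C * \<tau> ^ 2 * (\<sigma>1 - \<sigma>) \<le> C * \<tau> ^ 2 * b ^ 4"
        using C \<sigma> by (intro mult_left_mono) (auto simp: \<sigma>1_def)
      also have "\<dots> = (\<beta> * C) * b ^ 3"
      proof -
        have "\<tau> ^ 2 * b = \<beta>" using \<tau> by (simp add: b_def)
        moreover have "C * \<tau> ^ 2 * b ^ 4 = (\<tau> ^ 2 * b) * C * b ^ 3" by (simp add: eval_nat_numeral)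
        ultimately show ?thesis by (simp only:)
      qed
      also have "\<dots> \<le> c3 / 2 * b ^ 3" using \<beta> b by (intro mult_right_mono) auto
      finally have "norm (Zf (Complex \<sigma>1 t) - Zf (Complex \<sigma> t)) \<le> c3 / 2 * b ^ 3" .
      moreover have "norm (Zf (Complex \<sigma>1 t)) \<ge> c3 * b ^ 3" using \<sigma>1 by (intro big) (auto simp: \<sigma>1_def)
      moreover have "norm (Zf (Complex \<sigma>1 t)) \<le> norm (Zf (Complex \<sigma> t)) + norm (Zf (Complex \<sigma>1 t) - Zf (Complex \<sigma> t))"
        using norm_triangle_ineq[of "Zf (Complex \<sigma> t)" "Zf (Complex \<sigma>1 t) - Zf (Complex \<sigma> t)"] by simp
      ultimately show ?thesis by simp
    qed
    moreover have "c3 * b ^ 3 / 2 = (c3 * \<beta> ^ 3 / 2) / \<tau> ^ 6"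
      by (simp add: b_def power_divide flip: power_mult)
    moreover have "c / \<tau> ^ 6 \<le> (c3 * \<beta> ^ 3 / 2) / \<tau> ^ 6"
      using \<tau> by (intro divide_right_mono) (auto simp: c_def)
    ultimately show ?thesis by (simp add: \<tau>_def)
  qed
  with c r show ?thesis by blast
qed

text \<open>The Laplace transform, taken at s - 1, of psi(e^u) e^(-u) - 1; see
  \<open>laplace_A_fun\<close>.\<close>

definition G_fun :: "complex \<Rightarrow> complex" where
  "G_fun s = mangoldt_series s / s - 1 / (s - 1)"

lemma Zf_nonzero: "Re s > 1 \<Longrightarrow> Zf s \<noteq> 0"
proof -
  assume s: "Re s > 1"
  obtain c where "c \<noteq> 0" "\<And>s. Re s > 1 \<Longrightarrow> zeta s = c * exp (log_zeta s)"
    using zeta_eq_exp_log_zeta by blast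
  moreover have "s \<noteq> 1" using s by auto
  ultimately show ?thesis using s Zf_eq_zeta[of s] by simp
qed

text \<open>The logarithmic derivative of (s - 1) zeta(s) is 1 / (s - 1) -
  \<open>mangoldt_series s\<close>; after substitution the two poles at 1 cancel.\<close>

lemma G_fun_eq:
  assumes "Re s > 1"
  shows "G_fun s = -(deriv Zf s / Zf s + 1) / s"
proof -
  have s: "s \<noteq> 1" "s \<noteq> 0" using assms by auto
  have "((\<lambda>s. (s - 1) * zeta s) has_field_derivative zeta s - (s - 1) * (zeta s * mangoldt_series s)) (at s)"
    by (rule derivative_eq_intros zeta_deriv[OF assms] refl)+ (simp add: algebra_simps)
  hence "(Zf has_field_derivative zeta s - (s - 1) * (zeta s * mangoldt_series s)) (at s)"
    by (rule has_field_derivative_transform_within_open[of _ _ _ "{s. Re s > 1}"])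
       (use assms Zf_eq_zeta in \<open>auto simp: open_halfspace_Re_gt\<close>)
  hence "deriv Zf s = zeta s - (s - 1) * (zeta s * mangoldt_series s)" by (rule DERIV_imp_deriv)
  moreover have "zeta s \<noteq> 0" using Zf_nonzero[OF assms] Zf_eq_zeta[OF assms] by auto
  ultimately have "deriv Zf s / Zf s = 1 / (s - 1) - mangoldt_series s"
    using s unfolding Zf_eq_zeta[OF assms] by (simp add: diff_divide_distrib)
  thus ?thesis using s by (simp add: G_fun_def) (simp add: field_simps)
qed

text \<open>With \<tau> = 1 + |t|, an upper bound \<tau>^2 over the lower bound \<tau>^(-6) gives
  \<tau>^8, and the square of Zf' / Zf in the derivative gives \<tau>^16. The point is the
  uniformity as \<sigma> decreases to 1.\<close>

lemma G_fun_bounds: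
  "\<exists>r>0. \<exists>C\<ge>0. \<forall>\<sigma> t. 1 < \<sigma> \<and> \<sigma> \<le> 1 + r \<longrightarrow>
     norm (G_fun (Complex \<sigma> t)) \<le> C * (1 + \<bar>t\<bar>) ^ 16 \<and> norm (deriv G_fun (Complex \<sigma> t)) \<le> C * (1 + \<bar>t\<bar>) ^ 16"
  and G_fun_holomorphic: "G_fun holomorphic_on {s. Re s > 1}"
proof -
  define S where "S = {s. Re s > 1}"
  have openS: "open S" unfolding S_def by (rule open_halfspace_Re_gt)
  have holZ: "Zf holomorphic_on S" by (rule holomorphic_on_subset[OF Zf_holomorphic]) (auto simp: S_def)
  have holZ': "deriv Zf holomorphic_on S" by (rule holomorphic_deriv[OF holZ openS])
  have nzS: "s \<noteq> 0" "Zf s \<noteq> 0" if "s \<in> S" for s using that Zf_nonzero by (auto simp: S_def)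
  have "(\<lambda>s. -(deriv Zf s / Zf s + 1) / s) holomorphic_on S"
    using nzS by (intro holomorphic_intros holZ holZ') auto
  thus "G_fun holomorphic_on {s. Re s > 1}"
    unfolding S_def by (rule holomorphic_transform) (simp add: G_fun_eq)
  have derG: "deriv G_fun s = -((deriv (deriv Zf) s / Zf s - (deriv Zf s / Zf s) ^ 2)) / s + (deriv Zf s / Zf s + 1) / s ^ 2"
    if s: "s \<in> S" for s
  proof -
    have 1: "(Zf has_field_derivative deriv Zf s) (at s)" by (rule holomorphic_derivI[OF holZ openS s])
    have 2: "(deriv Zf has_field_derivative deriv (deriv Zf) s) (at s)" by (rule holomorphic_derivI[OF holZ' openS s])
    have "((\<lambda>s. -(deriv Zf s / Zf s + 1) / s) has_field_derivative
            (-((deriv (deriv Zf) s / Zf s - (deriv Zf s / Zf s) ^ 2)) / s + (deriv Zf s / Zf s + 1) / s ^ 2)) (at s)"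
      by (rule derivative_eq_intros 1 2 refl nzS[OF s])+ (use nzS[OF s] in \<open>simp add: field_simps power2_eq_square\<close>)
    hence "(G_fun has_field_derivative
            (-((deriv (deriv Zf) s / Zf s - (deriv Zf s / Zf s) ^ 2)) / s + (deriv Zf s / Zf s + 1) / s ^ 2)) (at s)"
      by (rule has_field_derivative_transform_within_open[OF _ openS s]) (simp add: G_fun_eq S_def)
    thus ?thesis by (rule DERIV_imp_deriv)
  qed
  obtain c r where cr: "c > 0" "r > 0" "r \<le> 1"
    "\<And>\<sigma> t. 1 < \<sigma> \<Longrightarrow> \<sigma> \<le> 1 + r \<Longrightarrow> norm (Zf (Complex \<sigma> t)) \<ge> c / (1 + \<bar>t\<bar>) ^ 6"
    using Zf_lower by blast
  obtain C where C: "C \<ge> 1" "\<And>\<sigma> t. 1 \<le> \<sigma> \<Longrightarrow> \<sigma> \<le> 2 \<Longrightarrow> norm (deriv Zf (Complex \<sigma> t)) \<le> C * (1 + \<bar>t\<bar>) ^ 2"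
    "\<And>\<sigma> t. 1 \<le> \<sigma> \<Longrightarrow> \<sigma> \<le> 2 \<Longrightarrow> norm (deriv (deriv Zf) (Complex \<sigma> t)) \<le> C * (1 + \<bar>t\<bar>) ^ 2"
    using Zf_bound_strip by blast
  define A where "A = C / c"
  have A: "A > 0" using C cr by (simp add: A_def)
  have "norm (G_fun (Complex \<sigma> t)) \<le> (1 + A) ^ 2 * (1 + \<bar>t\<bar>) ^ 16 \<and>
        norm (deriv G_fun (Complex \<sigma> t)) \<le> (1 + A) ^ 2 * (1 + \<bar>t\<bar>) ^ 16" if \<sigma>: "1 < \<sigma>" "\<sigma> \<le> 1 + r" for \<sigma> t
  proof -
    define s where "s = Complex \<sigma> t"
    define \<tau> where "\<tau> = 1 + \<bar>t\<bar>"
    have sS: "s \<in> S" using \<sigma> by (simp add: S_def s_def)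
    have \<tau>: "\<tau> \<ge> 1" by (simp add: \<tau>_def)
    have ns: "norm s \<ge> 1" using complex_Re_le_cmod[of s] \<sigma> by (simp add: s_def)
    have quot: "norm (w / Zf s) \<le> A * \<tau> ^ 8" if "norm w \<le> C * \<tau> ^ 2" for w
    proof -
      have "norm (w / Zf s) \<le> (C * \<tau> ^ 2) / (c / \<tau> ^ 6)"
        unfolding norm_divide s_def using that cr(4)[OF \<sigma>, of t] cr C \<tau>
        by (intro frac_le) (auto simp: \<tau>_def)
      also have "\<dots> = A * \<tau> ^ 8" using cr \<tau> by (simp add: A_def eval_nat_numeral field_simps)
      finally show ?thesis .
    qed
    have q1: "norm (deriv Zf s / Zf s) \<le> A * \<tau> ^ 8"
      using C(2)[of \<sigma> t] \<sigma> cr by (intro quot) (simp add: s_def \<tau>_def)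
    have q2: "norm (deriv (deriv Zf) s / Zf s) \<le> A * \<tau> ^ 8"
      using C(3)[of \<sigma> t] \<sigma> cr by (intro quot) (simp add: s_def \<tau>_def)
    have div_le: "norm (w / s) \<le> norm w" "norm (w / s ^ 2) \<le> norm w" for w
      using ns by (auto simp: norm_divide norm_power divide_le_eq mult_le_cancel_left1 one_le_power)
    have \<tau>816: "\<tau> ^ 8 \<le> \<tau> ^ 16" "1 \<le> \<tau> ^ 16" using \<tau> by (auto intro: power_increasing one_le_power)
    have A816: "A * \<tau> ^ 8 \<le> A * \<tau> ^ 16" "0 \<le> A\<^sup>2 * \<tau> ^ 16" "0 \<le> A * \<tau> ^ 16" using A \<tau> \<tau>816 by auto
    have sq: "(1 + A)\<^sup>2 * \<tau> ^ 16 = \<tau> ^ 16 + 2 * (A * \<tau> ^ 16) + A\<^sup>2 * \<tau> ^ 16" by (simp add: power2_eq_square algebra_simps)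
    have n1: "norm (deriv Zf s / Zf s + 1) \<le> A * \<tau> ^ 8 + 1"
      using norm_triangle_ineq[of "deriv Zf s / Zf s" 1] q1 by simp
    have "norm (G_fun s) \<le> norm (-(deriv Zf s / Zf s + 1))"
      using div_le(1)[of "-(deriv Zf s / Zf s + 1)"] sS by (simp add: G_fun_eq S_def)
    also have "\<dots> \<le> A * \<tau> ^ 8 + 1" using n1 by (simp only: norm_minus_cancel)
    also have "\<dots> \<le> (1 + A)\<^sup>2 * \<tau> ^ 16"
      unfolding sq using A816 \<tau>816 by linarith
    finally have g1: "norm (G_fun s) \<le> (1 + A)\<^sup>2 * \<tau> ^ 16" .
    have "norm (deriv G_fun s) \<le> norm (-((deriv (deriv Zf) s / Zf s - (deriv Zf s / Zf s) ^ 2)) / s) + norm ((deriv Zf s / Zf s + 1) / s ^ 2)"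
      unfolding derG[OF sS] by (rule norm_triangle_ineq)
    also have "\<dots> \<le> norm (-((deriv (deriv Zf) s / Zf s - (deriv Zf s / Zf s) ^ 2))) + norm (deriv Zf s / Zf s + 1)"
      by (intro add_mono div_le)
    also have "norm (-((deriv (deriv Zf) s / Zf s - (deriv Zf s / Zf s) ^ 2))) \<le> A * \<tau> ^ 8 + (A * \<tau> ^ 8) ^ 2"
      unfolding norm_minus_cancel using q1 q2
      by (intro order_trans[OF norm_triangle_ineq4] add_mono) (auto simp: norm_power intro!: power_mono)
    also have "(A * \<tau> ^ 8) ^ 2 = A\<^sup>2 * \<tau> ^ 16" by (simp add: power_mult_distrib flip: power_mult)
    finally have "norm (deriv G_fun s) \<le> A * \<tau> ^ 8 + A\<^sup>2 * \<tau> ^ 16 + (A * \<tau> ^ 8 + 1)" using n1 by linarith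
    also have "\<dots> \<le> (1 + A)\<^sup>2 * \<tau> ^ 16"
      unfolding sq using A816 \<tau>816 by linarith
    finally show ?thesis using g1 by (simp add: s_def \<tau>_def)
  qed
  thus "\<exists>r>0. \<exists>C\<ge>0. \<forall>\<sigma> t. 1 < \<sigma> \<and> \<sigma> \<le> 1 + r \<longrightarrow>
     norm (G_fun (Complex \<sigma> t)) \<le> C * (1 + \<bar>t\<bar>) ^ 16 \<and> norm (deriv G_fun (Complex \<sigma> t)) \<le> C * (1 + \<bar>t\<bar>) ^ 16"
    using cr by (intro exI[of _ r] conjI exI[of _ "(1 + A)\<^sup>2"]) auto
qed

section \<open>The prime number theorem with an error term\<close>

lemma exp_integral_half_line:
  fixes z :: complex
  assumes "Re z > 0"
  shows "integrable lborel (\<lambda>u. indicator {a<..} u *\<^sub>R exp (-z * of_real u))"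
    and "integral\<^sup>L lborel (\<lambda>u. indicator {a<..} u *\<^sub>R exp (-z * of_real u)) = exp (-z * of_real a) / z"
proof -
  have real: "set_integrable lborel (einterval (ereal a) \<infinity>) (\<lambda>u. exp (-Re z * u))"
  proof (rule interval_integral_FTC_nonneg)
    show "((\<lambda>u. -exp (-Re z * u) / Re z) has_real_derivative exp (-Re z * u)) (at u)" for u
      using assms by (auto intro!: derivative_eq_intros)
    have "((\<lambda>u. -exp (-Re z * u) / Re z) \<longlongrightarrow> -exp (-Re z * a) / Re z) (at_right a)"
      using assms by (auto intro!: tendsto_eq_intros)
    thus "(((\<lambda>u. -exp (-Re z * u) / Re z) \<circ> real_of_ereal) \<longlongrightarrow> -exp (-Re z * a) / Re z) (at_right (ereal a))"
      by (simp add: ereal_tendsto_simps)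
    have "((\<lambda>u. -exp (-Re z * u) / Re z) \<longlongrightarrow> 0) at_top"
      using assms by real_asymp
    thus "(((\<lambda>u. -exp (-Re z * u) / Re z) \<circ> real_of_ereal) \<longlongrightarrow> 0) (at_left \<infinity>)"
      by (simp add: ereal_tendsto_simps)
  qed auto
  have int: "set_integrable lborel {a<..} (\<lambda>u. exp (-z * of_real u))"
    using real unfolding set_integrable_def
    by (rule Bochner_Integration.integrable_bound) (auto simp: indicator_def)
  thus "integrable lborel (\<lambda>u. indicator {a<..} u *\<^sub>R exp (-z * of_real u))"
    by (simp add: set_integrable_def)
  have z: "z \<noteq> 0" using assms by auto
  have "(LBINT u=ereal a..\<infinity>. exp (-z * of_real u)) = 0 - (-exp (-z * of_real a) / z)"
  proof (rule interval_integral_FTC_integrable)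
    fix u
    have "((\<lambda>w. -exp (-z * w) / z) has_field_derivative exp (-z * of_real u)) (at (of_real u))"
      using z by (auto intro!: derivative_eq_intros)
    thus "((\<lambda>u. -exp (-z * of_real u) / z) has_vector_derivative exp (-z * of_real u)) (at u)"
      by (rule has_vector_derivative_real_field)
    show "isCont (\<lambda>u. exp (-z * of_real u)) u" by (intro continuous_intros)
  next
    have "((\<lambda>u. -exp (-z * of_real u) / z) \<longlongrightarrow> -exp (-z * of_real a) / z) (at_right a)"
      using z by (intro tendsto_intros) auto
    thus "(((\<lambda>u. -exp (-z * of_real u) / z) \<circ> real_of_ereal) \<longlongrightarrow> -exp (-z * of_real a) / z) (at_right (ereal a))"
      by (simp add: ereal_tendsto_simps)
    have "((\<lambda>u. exp (-Re z * u) / norm z) \<longlongrightarrow> 0) at_top"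
      using assms z by real_asymp
    hence "((\<lambda>u. norm (-exp (-z * of_real u) / z)) \<longlongrightarrow> 0) at_top"
      by (simp add: norm_divide)
    hence "((\<lambda>u. -exp (-z * of_real u) / z) \<longlongrightarrow> 0) at_top" by (rule tendsto_norm_zero_cancel)
    thus "(((\<lambda>u. -exp (-z * of_real u) / z) \<circ> real_of_ereal) \<longlongrightarrow> 0) (at_left \<infinity>)"
      by (simp add: ereal_tendsto_simps)
  qed (use int in auto)
  thus "integral\<^sup>L lborel (\<lambda>u. indicator {a<..} u *\<^sub>R exp (-z * of_real u)) = exp (-z * of_real a) / z"
    by (simp add: interval_integral_to_infinity_eq set_lebesgue_integral_def)
qed

lemma exp_integral_half_line_real:
  fixes c :: real
  assumes "c > 0"
  shows "integrable lborel (\<lambda>u. indicator {a<..} u * exp (-c * u))"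
    and "integral\<^sup>L lborel (\<lambda>u. indicator {a<..} u * exp (-c * u)) = exp (-c * a) / c"
proof -
  define f where "f = (\<lambda>u. indicator {a<..} u * exp (-c * u))"
  have eq: "(\<lambda>u. indicator {a<..} u *\<^sub>R exp (-complex_of_real c * of_real u)) = (\<lambda>u. complex_of_real (f u))"
    by (auto simp: fun_eq_iff f_def indicator_def simp flip: exp_of_real)
  have 1: "integrable lborel (\<lambda>u. complex_of_real (f u))"
    using exp_integral_half_line(1)[of "of_real c" a] assms unfolding eq by simp
  have 2: "integral\<^sup>L lborel (\<lambda>u. complex_of_real (f u)) = complex_of_real (exp (-c * a) / c)"
    using exp_integral_half_line(2)[of "of_real c" a] assms unfolding eq by (simp flip: exp_of_real)
  show "integrable lborel (\<lambda>u. indicator {a<..} u * exp (-c * u))"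
    using 1 by (simp only: complex_of_real_integrable_eq f_def)
  show "integral\<^sup>L lborel (\<lambda>u. indicator {a<..} u * exp (-c * u)) = exp (-c * a) / c"
    using 2 unfolding integral_complex_of_real by (simp only: of_real_eq_iff f_def)
qed

lemma exp_integral_half_line_closed:
  fixes z :: complex
  assumes "Re z > 0"
  shows "integrable lborel (\<lambda>u. indicator {a..} u *\<^sub>R exp (-z * of_real u))"
    and "integral\<^sup>L lborel (\<lambda>u. indicator {a..} u *\<^sub>R exp (-z * of_real u)) = exp (-z * of_real a) / z"
proof -
  have ae: "AE u in lborel. indicator {a<..} u *\<^sub>R exp (-z * of_real u) = indicator {a..} u *\<^sub>R exp (-z * of_real u)"
    using AE_lborel_singleton[of a] by eventually_elim (auto simp: indicator_def)
  show "integrable lborel (\<lambda>u. indicator {a..} u *\<^sub>R exp (-z * of_real u))"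
    by (rule integrable_cong_AE_imp[OF exp_integral_half_line(1)[OF assms, of a]]) (use ae in auto)
  have "integral\<^sup>L lborel (\<lambda>u. indicator {a..} u *\<^sub>R exp (-z * of_real u)) =
        integral\<^sup>L lborel (\<lambda>u. indicator {a<..} u *\<^sub>R exp (-z * of_real u))"
    by (rule integral_cong_AE) (use ae in auto)
  thus "integral\<^sup>L lborel (\<lambda>u. indicator {a..} u *\<^sub>R exp (-z * of_real u)) = exp (-z * of_real a) / z"
    using exp_integral_half_line(2)[OF assms, of a] by simp
qed

text \<open>Normalised psi in the logarithmic variable u = ln x; the prime number theorem says that
  it tends to 1.\<close>

definition A_fun :: "real \<Rightarrow> real" where
  "A_fun u = psi (exp u) * exp (-u)"

lemma A_fun_bounds: "0 \<le> A_fun u" "A_fun u \<le> 4" "\<bar>A_fun u - 1\<bar> \<le> 4"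
proof -
  show 1: "0 \<le> A_fun u" by (simp add: A_fun_def psi_nonneg)
  have "A_fun u \<le> (4 * exp u) * exp (-u)" unfolding A_fun_def
    by (intro mult_right_mono psi_le) auto
  also have "(4 * exp u) * exp (-u) = 4" using exp_minus_inverse[of u] by simp
  finally show 2: "A_fun u \<le> 4" .
  show "\<bar>A_fun u - 1\<bar> \<le> 4" using 1 2 by linarith
qed

lemma A_fun_measurable [measurable]: "A_fun \<in> borel_measurable borel"
proof -
  have "mono (\<lambda>u. psi (exp u))" by (auto intro!: monoI psi_mono)
  hence [measurable]: "(\<lambda>u. psi (exp u)) \<in> borel_measurable borel" by (rule borel_measurable_mono)
  show ?thesis unfolding A_fun_def[abs_def] by measurable
qed

text \<open>psi(e^u) is a sum of steps of height \<open>mangoldt n\<close> that start at u = ln n,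
  and such a step has Laplace transform n^(-s) / s times its height. The integrals of the norms are
  summable, so sum and integral may be exchanged.\<close>

lemma laplace_psi:
  assumes s: "Re s > 1"
  shows "integrable lborel (\<lambda>u. complex_of_real (psi (exp u)) * exp (-s * of_real u))"
    and "integral\<^sup>L lborel (\<lambda>u. complex_of_real (psi (exp u)) * exp (-s * of_real u)) = mangoldt_series s / s"
proof -
  define f where "f = (\<lambda>n u. of_real (mangoldt (Suc n)) * (indicator {ln (real (Suc n))..} u *\<^sub>R exp (-s * of_real u)))"
  have s0: "Re s > 0" "s \<noteq> 0" using s by auto
  have int: "integrable lborel (f n)" for n
    unfolding f_def by (intro integrable_mult_right exp_integral_half_line_closed s0)
  have powr: "exp (-s * of_real (ln (real (Suc n)))) = of_nat (Suc n) powr (-s)" for n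
    by (simp add: powr_def Ln_of_nat del: of_nat_Suc)
  have integral: "integral\<^sup>L lborel (f n) = complex_of_real (mangoldt (Suc n)) * of_nat (Suc n) powr (-s) / s" for n
    unfolding f_def by (subst integral_mult_right_zero) (simp only: exp_integral_half_line_closed(2)[OF s0(1)] powr times_divide_eq_right)
  have fin: "finite {n. f n u \<noteq> 0}" for u
  proof (rule finite_subset)
    show "{n. f n u \<noteq> 0} \<subseteq> {n. real n \<le> exp u}"
    proof
      fix n assume "n \<in> {n. f n u \<noteq> 0}"
      hence "ln (real (Suc n)) \<le> u" by (auto simp: f_def indicator_def split: if_splits)
      hence "real (Suc n) \<le> exp u" by (metis exp_le_cancel_iff exp_ln of_nat_0_less_iff zero_less_Suc)
      thus "n \<in> {n. real n \<le> exp u}" by simp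
    qed
  qed simp
  have sums: "summable (\<lambda>n. \<integral>u. norm (f n u) \<partial>lborel)"
  proof -
    have eq: "(\<integral>u. norm (f n u) \<partial>lborel) = mangoldt (Suc n) * real (Suc n) powr (-Re s) / Re s" for n
    proof -
      have "(\<integral>u. complex_of_real (norm (f n u)) \<partial>lborel) =
            (\<integral>u. of_real (mangoldt (Suc n)) * (indicator {ln (real (Suc n))..} u *\<^sub>R exp (-complex_of_real (Re s) * of_real u)) \<partial>lborel)"
      proof (intro Bochner_Integration.integral_cong refl)
        fix u
        have "norm (f n u) = mangoldt (Suc n) * (indicator {ln (real (Suc n))..} u * exp (-Re s * u))"
          by (simp add: f_def norm_mult indicator_def)
        thus "complex_of_real (norm (f n u)) = of_real (mangoldt (Suc n)) * (indicator {ln (real (Suc n))..} u *\<^sub>R exp (-complex_of_real (Re s) * of_real u))"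
          by (simp add: scaleR_conv_of_real exp_of_real[symmetric] del: of_real_mangoldt of_nat_Suc)
      qed
      also have "\<dots> = of_real (mangoldt (Suc n)) * (exp (-complex_of_real (Re s) * of_real (ln (real (Suc n)))) / Re s)"
        using s0 by (subst integral_mult_right_zero) (simp only: exp_integral_half_line_closed(2)[of "of_real (Re s)"] Re_complex_of_real)
      also have "\<dots> = complex_of_real (mangoldt (Suc n) * exp (-Re s * ln (real (Suc n))) / Re s)"
        by (simp add: exp_of_real[symmetric] del: of_real_mangoldt of_nat_Suc)
      finally have "(\<integral>u. norm (f n u) \<partial>lborel) = mangoldt (Suc n) * exp (-Re s * ln (real (Suc n))) / Re s"
        unfolding integral_complex_of_real by (simp only: of_real_eq_iff)
      thus ?thesis by (simp add: powr_def)
    qed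
    have "summable (\<lambda>n. norm (complex_of_real (mangoldt (Suc n)) * of_nat (Suc n) powr (-s)))"
      by (rule summable_mangoldt_series[OF s])
    hence "summable (\<lambda>n. mangoldt (Suc n) * real (Suc n) powr (-Re s))"
      by (simp only: norm_mult norm_Suc_powr norm_of_real abs_mangoldt uminus_complex.sel)
    thus ?thesis unfolding eq by (intro summable_divide)
  qed
  have ae: "AE u in lborel. summable (\<lambda>n. norm (f n u))"
    by (intro always_eventually allI summable_finite[OF fin]) auto
  have eq: "(\<Sum>n. f n u) = complex_of_real (psi (exp u)) * exp (-s * of_real u)" for u
  proof -
    define N where "N = {n. n > 0 \<and> real n \<le> exp u}"
    have "(\<Sum>n. f n u) = (\<Sum>n\<in>(\<lambda>n. n - 1) ` N. f n u)"
    proof (rule suminf_finite)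
      fix n assume "n \<notin> (\<lambda>n. n - 1) ` N"
      hence "Suc n \<notin> N" by (metis diff_Suc_1 image_eqI)
      hence "\<not> real (Suc n) \<le> exp u" by (simp add: N_def)
      hence "\<not> ln (real (Suc n)) \<le> u" by (metis exp_le_cancel_iff exp_ln of_nat_0_less_iff zero_less_Suc)
      thus "f n u = 0" by (simp add: f_def)
    qed (simp add: N_def)
    also have "\<dots> = (\<Sum>n\<in>N. f (n - 1) u)"
      by (subst sum.reindex) (auto simp: inj_on_def N_def)
    also have "\<dots> = (\<Sum>n\<in>N. of_real (mangoldt n) * exp (-s * of_real u))"
    proof (intro sum.cong refl)
      fix n assume n: "n \<in> N"
      hence "ln (real n) \<le> u" unfolding N_def by (metis (mono_tags, lifting) exp_le_cancel_iff exp_ln mem_Collect_eq of_nat_0_less_iff)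
      thus "f (n - 1) u = of_real (mangoldt n) * exp (-s * of_real u)" using n by (simp add: f_def N_def)
    qed
    also have "\<dots> = complex_of_real (psi (exp u)) * exp (-s * of_real u)"
      by (simp add: psi_def N_def sum_distrib_right)
    finally show ?thesis .
  qed
  show "integrable lborel (\<lambda>u. complex_of_real (psi (exp u)) * exp (-s * of_real u))"
    using integrable_suminf[OF int ae sums] by (simp only: eq)
  have "(\<lambda>n. integral\<^sup>L lborel (f n)) sums integral\<^sup>L lborel (\<lambda>u. complex_of_real (psi (exp u)) * exp (-s * of_real u))"
    using sums_integral[OF int ae sums] by (simp only: eq)
  moreover have "(\<lambda>n. integral\<^sup>L lborel (f n)) sums (mangoldt_series s / s)"
    unfolding integral mangoldt_series_def
    by (rule sums_divide[OF summable_sums[OF summable_norm_cancel[OF summable_mangoldt_series[OF s]]]])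
  ultimately show "integral\<^sup>L lborel (\<lambda>u. complex_of_real (psi (exp u)) * exp (-s * of_real u)) = mangoldt_series s / s"
    by (rule sums_unique2)
qed

lemma laplace_A_fun:
  assumes s: "Re s > 1"
  shows "integrable lborel (\<lambda>u. indicator {0<..} u *\<^sub>R (of_real (A_fun u - 1) * exp (-(s - 1) * of_real u)))"
    and "integral\<^sup>L lborel (\<lambda>u. indicator {0<..} u *\<^sub>R (of_real (A_fun u - 1) * exp (-(s - 1) * of_real u))) = G_fun s"
proof -
  \<comment> \<open>This lets the integral over the whole line in \<open>laplace_psi\<close> be read
    as one over u > 0.\<close>
  have zero: "psi (exp u) = 0" if "u \<le> 0" for u
  proof -
    have "psi (exp u) = (\<Sum>n\<in>{n. n > 0 \<and> real n \<le> exp u}. 0)"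
      unfolding psi_def
    proof (rule sum.cong[OF refl])
      fix n assume "n \<in> {n. 0 < n \<and> real n \<le> exp u}"
      moreover have "exp u \<le> 1" using that by simp
      ultimately have "real n \<le> 1" "n > 0" by (simp_all, linarith)
      hence "n = 1" by simp
      thus "mangoldt n = 0" by simp
    qed
    thus ?thesis by simp
  qed
  have eq: "indicator {0<..} u *\<^sub>R (of_real (A_fun u - 1) * exp (-(s - 1) * of_real u)) =
        complex_of_real (psi (exp u)) * exp (-s * of_real u) - indicator {0<..} u *\<^sub>R exp (-(s - 1) * of_real u)" for u
  proof (cases "u > 0")
    case True
    have "complex_of_real (exp (-u)) * exp (-(s - 1) * of_real u) = exp (-s * of_real u)"
      by (simp add: algebra_simps flip: exp_of_real exp_add)
    thus ?thesis using True by (simp add: A_fun_def algebra_simps)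
  qed (simp add: zero)
  have s1: "Re (s - 1) > 0" using s by simp
  show "integrable lborel (\<lambda>u. indicator {0<..} u *\<^sub>R (of_real (A_fun u - 1) * exp (-(s - 1) * of_real u)))"
    unfolding eq by (intro Bochner_Integration.integrable_diff laplace_psi(1)[OF s] exp_integral_half_line(1)[OF s1])
  show "integral\<^sup>L lborel (\<lambda>u. indicator {0<..} u *\<^sub>R (of_real (A_fun u - 1) * exp (-(s - 1) * of_real u))) = G_fun s"
    unfolding eq
    by (subst Bochner_Integration.integral_diff)
       (use laplace_psi[OF s] exp_integral_half_line[OF s1, of 0] in \<open>simp_all add: G_fun_def\<close>)
qed

text \<open>The real part of 1 / (l + i w), with total mass pi rather than 1; l is the width of the
  smoothing.\<close>

definition poisson_kernel :: "real \<Rightarrow> real \<Rightarrow> real" where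
  "poisson_kernel l w = l / (l\<^sup>2 + w\<^sup>2)"

text \<open>The polynomial growth of \<open>G_fun\<close> is traded for half of the decay exp (-l
  t). The number 32 is twice 16: y \<le> e^y is applied at y = (1 + t) l / 32 and raised to the
  power 16.\<close>

lemma power16_le_exp:
  fixes l t :: real
  assumes "0 < l" "l \<le> 1" "t \<ge> 0"
  shows "(1 + t) ^ 16 \<le> (32 / l) ^ 16 * 2 * exp (l / 2 * t)"
proof -
  have "(1 + t) ^ 16 = (32 / l) ^ 16 * ((1 + t) * l / 32) ^ 16"
  proof -
    have "32 / l * ((1 + t) * l / 32) = 1 + t" using assms by simp
    thus ?thesis by (simp only: power_mult_distrib[symmetric])
  qed
  also have "\<dots> \<le> (32 / l) ^ 16 * exp ((1 + t) * l / 32) ^ 16"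
  proof (intro mult_left_mono power_mono)
    have "(1 + t) * l / 32 \<le> 1 + (1 + t) * l / 32" by simp
    also have "\<dots> \<le> exp ((1 + t) * l / 32)" by (rule exp_ge_add_one_self)
    finally show "(1 + t) * l / 32 \<le> exp ((1 + t) * l / 32)" .
  qed (use assms in auto)
  also have "exp ((1 + t) * l / 32) ^ 16 = exp (l / 2) * exp (l / 2 * t)"
    by (simp add: field_simps flip: exp_of_nat_mult exp_add)
  also have "\<dots> \<le> 2 * exp (l / 2 * t)"
  proof (intro mult_right_mono)
    have "exp (l / 2) \<le> 1 + l / 2 + (l / 2)\<^sup>2" using assms by (intro exp_bound) auto
    also have "\<dots> \<le> 1 + 1 / 2 + (1 / 2)\<^sup>2" using assms by (intro add_mono power_mono) auto
    finally show "exp (l / 2) \<le> 2" by (simp add: power2_eq_square)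
  qed auto
  finally show ?thesis using assms by (simp add: mult_left_mono algebra_simps)
qed

text \<open>Fubini for (A(u) - 1) exp (-(\<sigma> - 1) u) exp (-(l + i (u - w)) t): integrating over
  t first yields 1 / (l + i (u - w)), whose real part is the Poisson kernel, and over u first the
  transform \<open>G_fun\<close>. The damping by \<sigma> > 1 makes the double integral absolutely
  convergent.\<close>

lemma smoothed_A_fun_eq:
  assumes "\<sigma> > 1" "l > 0"
  shows "integral\<^sup>L lborel (\<lambda>u. indicator {0<..} u * ((A_fun u - 1) * exp (-(\<sigma> - 1) * u) * poisson_kernel l (w - u))) =
         Re (integral\<^sup>L lborel (\<lambda>t. indicator {0<..} t *\<^sub>R (exp (-(Complex l (-w)) * of_real t) * G_fun (Complex \<sigma> t))))"
proof -
  define f where "f = (\<lambda>t u. (indicator {0<..} t * indicator {0<..} u) *\<^sub>R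
     (of_real ((A_fun u - 1) * exp (-(\<sigma> - 1) * u)) * exp (-(Complex l (u - w)) * of_real t)))"
  have meas: "case_prod f \<in> borel_measurable (lborel \<Otimes>\<^sub>M lborel)"
  proof -
    have [measurable]: "(\<lambda>p. exp (-(Complex l (snd p - w)) * complex_of_real (fst p))) \<in> borel_measurable (lborel \<Otimes>\<^sub>M lborel)"
      by (simp add: Complex_eq)
    show ?thesis unfolding f_def case_prod_unfold by measurable
  qed
  have norm_f: "norm (f t u) = indicator {0<..} t * exp (-l * t) * (indicator {0<..} u * (\<bar>A_fun u - 1\<bar> * exp (-(\<sigma> - 1) * u)))" for t u
    by (simp add: f_def norm_mult abs_mult indicator_def del: of_real_diff of_real_mult)
  have int_u: "integrable lborel (\<lambda>u. indicator {0<..} u * (\<bar>A_fun u - 1\<bar> * exp (-(\<sigma> - 1) * u)))"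
  proof (rule Bochner_Integration.integrable_bound)
    show "integrable lborel (\<lambda>u. 4 * (indicator {0<..} u * exp (-(\<sigma> - 1) * u)))"
      using exp_integral_half_line_real(1)[of "\<sigma> - 1" 0] assms by (intro integrable_mult_right) auto
    show "AE u in lborel. norm (indicator {0<..} u * (\<bar>A_fun u - 1\<bar> * exp (-(\<sigma> - 1) * u))) \<le> norm (4 * (indicator {0<..} u * exp (-(\<sigma> - 1) * u)))"
      using A_fun_bounds(3) by (intro always_eventually allI) (auto simp: indicator_def abs_mult)
  qed measurable
  have int_f_u: "integrable lborel (f t)" for t
  proof (rule Bochner_Integration.integrable_bound)
    show "integrable lborel (\<lambda>u. indicator {0<..} t * exp (-l * t) * (indicator {0<..} u * (\<bar>A_fun u - 1\<bar> * exp (-(\<sigma> - 1) * u))))"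
      by (intro integrable_mult_right int_u)
    show "f t \<in> borel_measurable lborel"
      using measurable_compose[OF measurable_Pair1'[of t lborel lborel] meas] by simp
    show "AE u in lborel. norm (f t u) \<le> norm (indicator {0<..} t * exp (-l * t) * (indicator {0<..} u * (\<bar>A_fun u - 1\<bar> * exp (-(\<sigma> - 1) * u))))"
      unfolding norm_f by simp
  qed
  have int_f: "integrable (lborel \<Otimes>\<^sub>M lborel) (case_prod f)"
  proof (rule lborel_pair.Fubini_integrable[OF meas])
    show "integrable lborel (\<lambda>t. \<integral>u. norm (case (t, u) of (t, u) \<Rightarrow> f t u) \<partial>lborel)"
    proof -
      have "integrable lborel (\<lambda>t. (indicator {0<..} t * exp (-l * t)) * (\<integral>u. (indicator {0<..} u * (\<bar>A_fun u - 1\<bar> * exp (-(\<sigma> - 1) * u))) \<partial>lborel))"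
        using assms by (intro integrable_mult_left exp_integral_half_line_real(1))
      thus ?thesis by (simp only: case_prod_conv norm_f integral_mult_right_zero)
    qed
    show "AE t in lborel. integrable lborel (\<lambda>u. case (t, u) of (t, u) \<Rightarrow> f t u)"
      using int_f_u by simp
  qed
  have inner_u: "(\<integral>u. f t u \<partial>lborel) = indicator {0<..} t *\<^sub>R (exp (-(Complex l (-w)) * of_real t) * G_fun (Complex \<sigma> t))" for t
  proof -
    have "f t u = (indicator {0<..} t *\<^sub>R exp (-(Complex l (-w)) * of_real t)) *
            (indicator {0<..} u *\<^sub>R (of_real (A_fun u - 1) * exp (-(Complex \<sigma> t - 1) * of_real u)))" for u
    proof -
      have "complex_of_real (exp (-(\<sigma> - 1) * u)) * exp (-(Complex l (u - w)) * of_real t) =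
            exp (-(Complex l (-w)) * of_real t) * exp (-(Complex \<sigma> t - 1) * of_real u)"
        by (simp add: exp_add[symmetric] exp_of_real[symmetric] Complex_eq algebra_simps)
      thus ?thesis unfolding f_def by (simp add: indicator_def algebra_simps)
    qed
    hence "(\<integral>u. f t u \<partial>lborel) = (indicator {0<..} t *\<^sub>R exp (-(Complex l (-w)) * of_real t)) * G_fun (Complex \<sigma> t)"
      using assms by (simp only: integral_mult_right_zero laplace_A_fun(2)[of "Complex \<sigma> t"] complex.sel)
    thus ?thesis by simp
  qed
  have inner_t: "(\<integral>t. f t u \<partial>lborel) = indicator {0<..} u *\<^sub>R (of_real ((A_fun u - 1) * exp (-(\<sigma> - 1) * u)) / Complex l (u - w))" for u
  proof -
    have "f t u = (indicator {0<..} u *\<^sub>R of_real ((A_fun u - 1) * exp (-(\<sigma> - 1) * u))) *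
            (indicator {0<..} t *\<^sub>R exp (-(Complex l (u - w)) * of_real t))" for t
      by (simp add: f_def indicator_def)
    hence "(\<integral>t. f t u \<partial>lborel) = (indicator {0<..} u *\<^sub>R of_real ((A_fun u - 1) * exp (-(\<sigma> - 1) * u))) *
            (exp (-(Complex l (u - w)) * of_real 0) / Complex l (u - w))"
      using assms by (simp only: integral_mult_right_zero exp_integral_half_line(2)[of "Complex l (u - w)"] complex.sel)
    thus ?thesis by (simp add: scaleR_conv_of_real)
  qed
  have swap: "(\<integral>u. (\<integral>t. f t u \<partial>lborel) \<partial>lborel) = (\<integral>t. (\<integral>u. f t u \<partial>lborel) \<partial>lborel)"
    by (rule lborel_pair.Fubini_integral[OF int_f])
  have int_u': "integrable lborel (\<lambda>u. \<integral>t. f t u \<partial>lborel)"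
    by (rule lborel_pair.integrable_snd[OF int_f])
  have "(\<integral>u. Re (\<integral>t. f t u \<partial>lborel) \<partial>lborel) = Re (\<integral>u. (\<integral>t. f t u \<partial>lborel) \<partial>lborel)"
    by (rule integral_Re[OF int_u'])
  also have "\<dots> = Re (\<integral>t. indicator {0<..} t *\<^sub>R (exp (-(Complex l (-w)) * of_real t) * G_fun (Complex \<sigma> t)) \<partial>lborel)"
    unfolding swap inner_u ..
  also have "(\<lambda>u. Re (\<integral>t. f t u \<partial>lborel)) = (\<lambda>u. indicator {0<..} u * ((A_fun u - 1) * exp (-(\<sigma> - 1) * u) * poisson_kernel l (w - u)))"
    unfolding inner_t
    by (simp add: fun_eq_iff Re_divide poisson_kernel_def power2_commute)
  finally show ?thesis .
qed

text \<open>One integration by parts against exp (-z t), with z = l - i w, gains 1 / |z| \<le> 1 /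
  w. Of the powers in l^17, sixteen come from \<open>power16_le_exp\<close> and one from integrating
  exp (-l t / 2).\<close>

lemma smoothed_G_fun_bound:
  "\<exists>r>0. \<exists>K\<ge>0. \<forall>\<sigma> l w. 1 < \<sigma> \<and> \<sigma> \<le> 1 + r \<and> 0 < l \<and> l \<le> 1 \<and> w > 0 \<longrightarrow>
     norm (integral\<^sup>L lborel (\<lambda>t. indicator {0<..} t *\<^sub>R (exp (-(Complex l (-w)) * of_real t) * G_fun (Complex \<sigma> t))))
       \<le> K / (l ^ 17 * w)"
proof -
  obtain r C where r: "r > 0" and C: "C \<ge> 0"
    "\<And>\<sigma> t. 1 < \<sigma> \<Longrightarrow> \<sigma> \<le> 1 + r \<Longrightarrow> norm (G_fun (Complex \<sigma> t)) \<le> C * (1 + \<bar>t\<bar>) ^ 16"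
    "\<And>\<sigma> t. 1 < \<sigma> \<Longrightarrow> \<sigma> \<le> 1 + r \<Longrightarrow> norm (deriv G_fun (Complex \<sigma> t)) \<le> C * (1 + \<bar>t\<bar>) ^ 16"
    using G_fun_bounds by blast
  define K where "K = C * (1 + 4 * 32 ^ 16)"
  have "norm (integral\<^sup>L lborel (\<lambda>t. indicator {0<..} t *\<^sub>R (exp (-(Complex l (-w)) * of_real t) * G_fun (Complex \<sigma> t))))
       \<le> K / (l ^ 17 * w)"
    if *: "1 < \<sigma>" "\<sigma> \<le> 1 + r" "0 < l" "l \<le> 1" "w > 0" for \<sigma> l w
  proof -
    define z where "z = Complex l (-w)"
    have z: "z \<noteq> 0" "Re z = l" using * by (auto simp: z_def complex_eq_iff)
    have nz: "norm z \<ge> w" using abs_Im_le_cmod[of z] * by (simp add: z_def)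
    define g where "g = (\<lambda>t. exp (-z * complex_of_real t) * G_fun (Complex \<sigma> t))"
    define g' where "g' = (\<lambda>t. exp (-z * complex_of_real t) * (\<i> * deriv G_fun (Complex \<sigma> t)))"
    \<comment> \<open>The derivative of F is g + g' / (-z), so the integral of g is -F(0) minus the
      integral of g' / (-z), and both carry the factor 1 / z.\<close>
    define F where "F = (\<lambda>t. g t / (-z))"
    define B where "B = C * ((32 / l) ^ 16 * 2)"
    have B: "B \<ge> 0" using C * by (simp add: B_def)
    have openS: "open {s. Re s > 1}" by (rule open_halfspace_Re_gt)
    have G_der: "(G_fun has_field_derivative deriv G_fun s) (at s)" if "Re s > 1" for s
      by (rule holomorphic_derivI[OF G_fun_holomorphic openS]) (use that in auto)
    have line: "Complex \<sigma> t = of_real \<sigma> + \<i> * of_real t" for t by (simp add: Complex_eq)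
    have vd: "((\<lambda>t. G_fun (Complex \<sigma> t)) has_vector_derivative \<i> * deriv G_fun (Complex \<sigma> t)) (at t)" for t
    proof -
      have "((\<lambda>x. G_fun (of_real \<sigma> + \<i> * x)) has_field_derivative (deriv G_fun (of_real \<sigma> + \<i> * of_real t) * \<i>)) (at (of_real t))"
        by (rule DERIV_chain2[OF G_der]) (use * in \<open>auto intro!: derivative_eq_intros\<close>)
      thus ?thesis unfolding line by (subst mult.commute) (rule has_vector_derivative_real_field)
    qed
    have F_der: "(F has_vector_derivative (g t + g' t / (-z))) (at t)" for t
    proof -
      have e: "((\<lambda>t. exp (-z * of_real t)) has_vector_derivative (-z * exp (-z * of_real t))) (at t)"
        by (rule has_vector_derivative_real_field) (auto intro!: derivative_eq_intros)
      have "((\<lambda>t. exp (-z * of_real t) * G_fun (Complex \<sigma> t)) has_vector_derivative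
              (exp (-z * of_real t) * (\<i> * deriv G_fun (Complex \<sigma> t)) + (-z * exp (-z * of_real t)) * G_fun (Complex \<sigma> t))) (at t)"
        by (rule has_vector_derivative_mult[OF e vd])
      hence "(F has_vector_derivative
         ((exp (-z * of_real t) * (\<i> * deriv G_fun (Complex \<sigma> t)) + (-z * exp (-z * of_real t)) * G_fun (Complex \<sigma> t)) / (-z))) (at t)"
        unfolding F_def g_def by (rule has_vector_derivative_divide)
      moreover have "((exp (-z * of_real t) * (\<i> * deriv G_fun (Complex \<sigma> t)) + (-z * exp (-z * of_real t)) * G_fun (Complex \<sigma> t)) / (-z)) =
                     g t + g' t / (-z)"
        using z by (simp add: g_def g'_def field_simps)
      ultimately show ?thesis by (simp only:)
    qed
    have bnd: "norm (exp (-z * complex_of_real t) * v) \<le> B * exp (-(l / 2) * t)"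
      if "t \<ge> 0" "norm v \<le> C * (1 + \<bar>t\<bar>) ^ 16" for t v
    proof -
      have "norm (exp (-z * complex_of_real t) * v) = exp (-l * t) * norm v"
        using z by (simp add: norm_mult)
      also have "\<dots> \<le> exp (-l * t) * (C * ((32 / l) ^ 16 * 2 * exp (l / 2 * t)))"
        using that power16_le_exp[of l t] * C
        by (intro mult_left_mono order_trans[OF that(2)]) auto
      also have "\<dots> = B * (exp (-l * t) * exp (l / 2 * t))" by (simp add: B_def)
      also have "exp (-l * t) * exp (l / 2 * t) = exp (-(l / 2) * t)" by (simp flip: exp_add)
      finally show ?thesis .
    qed
    have g_bnd: "norm (g t) \<le> B * exp (-(l / 2) * t)" if "t \<ge> 0" for t
      unfolding g_def using that * by (intro bnd C(2)) auto
    have g'_bnd: "norm (g' t) \<le> B * exp (-(l / 2) * t)" if "t \<ge> 0" for t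
      unfolding g'_def using that * C(3)[of \<sigma> t] by (intro bnd) (auto simp: norm_mult)
    have cont_g: "isCont g t" for t
      unfolding g_def using has_vector_derivative_continuous[OF vd] by (intro continuous_intros) auto
    have cont_g': "isCont g' t" for t
    proof -
      have "deriv G_fun holomorphic_on {s. Re s > 1}"
        by (rule holomorphic_deriv[OF G_fun_holomorphic openS])
      hence "isCont (deriv G_fun) (Complex \<sigma> t)"
        using * openS by (intro continuous_on_interior[OF holomorphic_on_imp_continuous_on]) (auto simp: interior_open)
      moreover have "isCont (\<lambda>t. Complex \<sigma> t) t" unfolding line by (intro continuous_intros)
      ultimately have "isCont (\<lambda>t. deriv G_fun (Complex \<sigma> t)) t"
        by (rule isCont_o2[rotated])
      thus ?thesis unfolding g'_def by (intro continuous_intros)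
    qed
    have int: "set_integrable lborel {0<..} h"
      if "\<And>t. isCont h t" "\<And>t. t \<ge> 0 \<Longrightarrow> norm (h t) \<le> B * exp (-(l / 2) * t)" for h :: "real \<Rightarrow> complex"
      unfolding set_integrable_def
    proof (rule Bochner_Integration.integrable_bound)
      show "integrable lborel (\<lambda>t. B * (indicator {0<..} t * exp (-(l / 2) * t)))"
        using * by (intro integrable_mult_right exp_integral_half_line_real(1)) auto
      have "h \<in> borel_measurable borel"
        by (rule borel_measurable_continuous_onI) (use that(1) in \<open>simp add: continuous_at_imp_continuous_on\<close>)
      thus "(\<lambda>t. indicator {0<..} t *\<^sub>R h t) \<in> borel_measurable lborel" by simp
      show "AE t in lborel. norm (indicator {0<..} t *\<^sub>R h t) \<le> norm (B * (indicator {0<..} t * exp (-(l / 2) * t)))"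
        using that(2) B by (intro always_eventually allI) (auto simp: indicator_def)
    qed
    have int_g: "set_integrable lborel {0<..} g" and int_g': "set_integrable lborel {0<..} g'"
      using cont_g g_bnd cont_g' g'_bnd by (blast intro: int)+
    have int_q: "set_integrable lborel {0<..} (\<lambda>t. g' t / (-z))" by (rule set_integrable_divide) (rule int_g')
    have "(LBINT t=ereal 0..\<infinity>. g t + g' t / (-z)) = 0 - F 0"
    proof (rule interval_integral_FTC_integrable)
      show "(F has_vector_derivative (g t + g' t / (-z))) (at t)" for t by (rule F_der)
      show "isCont (\<lambda>t. g t + g' t / (-z)) t" for t using z by (intro continuous_intros cont_g cont_g') auto
      show "set_integrable lborel (einterval (ereal 0) \<infinity>) (\<lambda>t. g t + g' t / (-z))"
        using set_integral_add(1)[OF int_g int_q] by simp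
      have "isCont F 0" using has_vector_derivative_continuous[OF F_der] by auto
      hence "(F \<longlongrightarrow> F 0) (at_right 0)" by (auto simp: isCont_def intro: tendsto_within_subset)
      thus "((F \<circ> real_of_ereal) \<longlongrightarrow> F 0) (at_right (ereal 0))" by (simp only: ereal_tendsto_simps)
      have "((\<lambda>t. B * exp (-(l / 2) * t) / norm z) \<longlongrightarrow> B * 0 / norm z) at_top"
      proof (intro tendsto_intros)
        show "((\<lambda>t. exp (-(l / 2) * t)) \<longlongrightarrow> 0) at_top" using * by real_asymp
      qed (use z in auto)
      hence lim: "((\<lambda>t. B * exp (-(l / 2) * t) / norm z) \<longlongrightarrow> 0) at_top" by simp
      have "(F \<longlongrightarrow> 0) at_top"
      proof (rule Lim_null_comparison[OF _ lim])
        show "\<forall>\<^sub>F t in at_top. norm (F t) \<le> B * exp (-(l / 2) * t) / norm z"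
          using eventually_ge_at_top[of 0]
        proof eventually_elim
          case (elim t)
          thus ?case using g_bnd[of t] by (simp add: F_def norm_divide divide_right_mono)
        qed
      qed
      thus "((F \<circ> real_of_ereal) \<longlongrightarrow> 0) (at_left \<infinity>)" by (simp only: ereal_tendsto_simps)
    qed auto
    hence s: "(LBINT t:{0<..}. g t + g' t / (-z)) = - F 0" by (simp add: interval_integral_to_infinity_eq)
    have "(LBINT t:{0<..}. g t) + (LBINT t:{0<..}. g' t) / (-z) = - F 0"
      unfolding set_integral_divide_zero[symmetric] set_integral_add(2)[OF int_g int_q, symmetric] by (rule s)
    hence eq: "(LBINT t:{0<..}. g t) = - F 0 - (LBINT t:{0<..}. g' t) / (-z)"
      by (simp only: eq_diff_eq)
    have n0: "norm (F 0) \<le> C / w"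
    proof -
      have "norm (g 0) \<le> C" using C(2)[of \<sigma> 0] * by (simp add: g_def)
      thus ?thesis using nz * C by (simp add: F_def norm_divide frac_le)
    qed
    have n1: "norm (LBINT t:{0<..}. g' t) \<le> B * (2 / l)"
    proof -
      have "norm (LBINT t:{0<..}. g' t) \<le> (\<integral>t. B * (indicator {0<..} t * exp (-(l / 2) * t)) \<partial>lborel)"
        unfolding set_lebesgue_integral_def
      proof (rule order_trans[OF integral_norm_bound integral_mono])
        show "integrable lborel (\<lambda>t. norm (indicator {0<..} t *\<^sub>R g' t))"
          using int_g' unfolding set_integrable_def by (rule integrable_norm)
        show "integrable lborel (\<lambda>t. B * (indicator {0<..} t * exp (-(l / 2) * t)))"
          using * by (intro integrable_mult_right exp_integral_half_line_real(1)) auto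
        show "norm (indicator {0<..} t *\<^sub>R g' t) \<le> B * (indicator {0<..} t * exp (-(l / 2) * t))" for t
          using g'_bnd[of t] by (auto simp: indicator_def)
      qed
      also have "\<dots> = B * (2 / l)"
        using exp_integral_half_line_real(2)[of "l / 2" 0] * by simp
      finally show ?thesis .
    qed
    have "norm (LBINT t:{0<..}. g t) \<le> norm (F 0) + norm (LBINT t:{0<..}. g' t) / norm z"
      unfolding eq by (intro order_trans[OF norm_triangle_ineq4]) (simp add: norm_divide)
    also have "\<dots> \<le> C / w + B * (2 / l) / w"
      using n0 n1 nz * B by (intro add_mono frac_le) auto
    also have "C / w \<le> C / (l ^ 17 * w)"
      using * C power_le_one[of l 17] by (intro divide_left_mono) (auto simp: mult_le_cancel_right2)
    also have "B * (2 / l) / w = C * (4 * 32 ^ 16) / (l ^ 17 * w)"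
    proof -
      have "l ^ 17 = l ^ 16 * l" by (simp add: eval_nat_numeral)
      thus ?thesis by (simp add: B_def power_divide)
    qed
    also have "C / (l ^ 17 * w) + C * (4 * 32 ^ 16) / (l ^ 17 * w) = K / (l ^ 17 * w)"
      by (simp add: K_def algebra_simps flip: add_divide_distrib)
    finally show ?thesis by (simp add: set_lebesgue_integral_def g_def z_def)
  qed
  moreover have "K \<ge> 0" using C by (simp add: K_def)
  ultimately show ?thesis using r by blast
qed

section \<open>The Tauberian step with the Poisson kernel\<close>

lemma poisson_kernel_nonneg: "l > 0 \<Longrightarrow> poisson_kernel l w \<ge> 0"
  by (simp add: poisson_kernel_def)

lemma poisson_kernel_deriv:
  assumes "l > 0"
  shows "((\<lambda>u. arctan ((u - w) / l)) has_real_derivative poisson_kernel l (w - u)) (at u)"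
proof -
  have "((\<lambda>u. arctan ((u - w) / l)) has_real_derivative inverse (1 + ((u - w) / l)\<^sup>2) * (1 / l)) (at u)"
    using assms by (auto intro!: derivative_eq_intros)
  also have "inverse (1 + ((u - w) / l)\<^sup>2) * (1 / l) = poisson_kernel l (w - u)"
  proof -
    have "1 + ((u - w) / l)\<^sup>2 = (l\<^sup>2 + (w - u)\<^sup>2) / l\<^sup>2"
      using assms by (simp add: power_divide add_divide_distrib power2_commute[of u w])
    thus ?thesis using assms by (simp add: poisson_kernel_def power2_eq_square)
  qed
  finally show ?thesis .
qed

lemma poisson_kernel_isCont: "l > 0 \<Longrightarrow> isCont (\<lambda>u. poisson_kernel l (w - u)) u"
  unfolding poisson_kernel_def by (intro continuous_intros) (simp add: add_pos_nonneg less_imp_neq[symmetric])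

lemma poisson_kernel_integral:
  assumes "l > 0"
  shows "integrable lborel (\<lambda>u. poisson_kernel l (w - u))"
    and "integral\<^sup>L lborel (\<lambda>u. poisson_kernel l (w - u)) = pi"
proof -
  have bot: "(((\<lambda>u. arctan ((u - w) / l)) \<circ> real_of_ereal) \<longlongrightarrow> -(pi/2)) (at_right (-\<infinity>))"
  proof -
    have "((\<lambda>u. arctan ((u - w) / l)) \<longlongrightarrow> -(pi/2)) at_bot"
      using assms by (intro filterlim_compose[OF tendsto_arctan_at_bot]) real_asymp
    thus ?thesis by (simp add: ereal_tendsto_simps)
  qed
  have top: "(((\<lambda>u. arctan ((u - w) / l)) \<circ> real_of_ereal) \<longlongrightarrow> pi/2) (at_left \<infinity>)"
  proof -
    have "((\<lambda>u. arctan ((u - w) / l)) \<longlongrightarrow> pi/2) at_top"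
      using assms by (intro filterlim_compose[OF tendsto_arctan_at_top]) real_asymp
    thus ?thesis by (simp add: ereal_tendsto_simps)
  qed
  have 1: "set_integrable lborel (einterval (-\<infinity>) \<infinity>) (\<lambda>u. poisson_kernel l (w - u))"
    by (rule interval_integral_FTC_nonneg(1)[OF _ poisson_kernel_deriv[OF assms] poisson_kernel_isCont[OF assms] _ bot top])
       (use assms in \<open>auto simp: poisson_kernel_nonneg\<close>)
  have 2: "(LBINT u=-\<infinity>..\<infinity>. poisson_kernel l (w - u)) = pi/2 - (-(pi/2))"
    by (rule interval_integral_FTC_nonneg(2)[OF _ poisson_kernel_deriv[OF assms] poisson_kernel_isCont[OF assms] _ bot top])
       (use assms in \<open>auto simp: poisson_kernel_nonneg\<close>)
  show "integrable lborel (\<lambda>u. poisson_kernel l (w - u))"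
    using 1 by (simp add: set_integrable_def)
  show "integral\<^sup>L lborel (\<lambda>u. poisson_kernel l (w - u)) = pi"
    using 2 unfolding interval_lebesgue_integral_def set_lebesgue_integral_def by simp
qed

lemma poisson_kernel_window:
  assumes "l > 0" "h \<ge> 0"
  shows "integrable lborel (\<lambda>u. poisson_kernel l (w - u) * indicator {w - h..w + h} u)"
    and "integral\<^sup>L lborel (\<lambda>u. poisson_kernel l (w - u) * indicator {w - h..w + h} u) = 2 * arctan (h / l)"
proof -
  have "has_bochner_integral lborel (\<lambda>u. poisson_kernel l (w - u) * indicator {w - h..w + h} u)
          (arctan ((w + h - w) / l) - arctan ((w - h - w) / l))"
    by (rule has_bochner_integral_FTC_Icc_real[OF _ poisson_kernel_deriv[OF assms(1)] poisson_kernel_isCont[OF assms(1)]])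
       (use assms in auto)
  thus "integrable lborel (\<lambda>u. poisson_kernel l (w - u) * indicator {w - h..w + h} u)"
    and "integral\<^sup>L lborel (\<lambda>u. poisson_kernel l (w - u) * indicator {w - h..w + h} u) = 2 * arctan (h / l)"
    by (auto simp: has_bochner_integral_iff arctan_minus)
qed

text \<open>\<Phi> dominates c + 4 times the kernel on the window minus 4 times the kernel on the
  whole line, and both integrals are explicit. Since arctan (h / l) \<ge> pi/2 - l/h, the parts with
  factor 4 cancel up to 8 l / h; since h \<ge> l, arctan (h / l) \<ge> pi/4 > 3/4 handles the part
  with factor c.\<close>

lemma tauberian_window:
  assumes l: "l > 0" and h: "h \<ge> l" and c: "c \<ge> 0" and \<Phi>: "integrable lborel \<Phi>"
    and inside: "\<And>u. u \<in> {w - h..w + h} \<Longrightarrow> \<Phi> u \<ge> c * poisson_kernel l (w - u)"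
    and outside: "\<And>u. \<Phi> u \<ge> -4 * poisson_kernel l (w - u)"
  shows "integral\<^sup>L lborel \<Phi> \<ge> c * (3 / 2) - 8 * (l / h)"
proof -
  define P where "P = (\<lambda>u. poisson_kernel l (w - u))"
  define W where "W = (\<lambda>u. P u * indicator {w - h..w + h} u)"
  have hp: "h > 0" using l h by simp
  have int: "integrable lborel P" "integral\<^sup>L lborel P = pi"
    unfolding P_def using poisson_kernel_integral[OF l] by auto
  have intW: "integrable lborel W" "integral\<^sup>L lborel W = 2 * arctan (h / l)"
    unfolding W_def P_def using poisson_kernel_window[OF l, of h w] hp by auto
  have "(c + 4) * (2 * arctan (h / l)) - 4 * pi = integral\<^sup>L lborel (\<lambda>u. (c + 4) * W u - 4 * P u)"
    using int intW by simp
  also have "\<dots> \<le> integral\<^sup>L lborel \<Phi>"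
  proof (rule integral_mono)
    show "integrable lborel (\<lambda>u. (c + 4) * W u - 4 * P u)" using int intW by simp
    fix u
    show "(c + 4) * W u - 4 * P u \<le> \<Phi> u"
      using inside[of u] outside[of u] by (cases "u \<in> {w - h..w + h}") (auto simp: W_def P_def indicator_def algebra_simps)
  qed (rule \<Phi>)
  finally have 1: "(c + 4) * (2 * arctan (h / l)) - 4 * pi \<le> integral\<^sup>L lborel \<Phi>" .
  have q: "h / l > 0" "1 \<le> h / l" using l h hp by auto
  have "arctan (l / h) = pi / 2 - arctan (h / l)"
    using arctan_inverse[of "h / l"] q by (simp add: sgn_if)
  moreover have "arctan (l / h) \<le> l / h" using l hp by (intro arctan_le_self) auto
  ultimately have 2: "arctan (h / l) \<ge> pi / 2 - l / h" by simp
  have "arctan 1 \<le> arctan (h / l)" using q by (simp only: arctan_le_iff)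
  hence "arctan (h / l) \<ge> 3 / 4" using pi_gt3 by (simp add: arctan_one)
  hence "c * (3 / 4) \<le> c * arctan (h / l)" using c by (intro mult_left_mono)
  moreover have "(c + 4) * (2 * arctan (h / l)) = 2 * (c * arctan (h / l)) + 8 * arctan (h / l)"
    by (simp add: algebra_simps)
  ultimately show ?thesis using 1 2 by linarith
qed

text \<open>The Tauberian condition: psi increases, so its normalised form cannot fall faster than
  exp (-u).\<close>

lemma A_fun_growth: "v \<le> u \<Longrightarrow> A_fun v * exp (-(u - v)) \<le> A_fun u"
proof -
  assume "v \<le> u"
  hence "psi (exp v) * exp (-u) \<le> psi (exp u) * exp (-u)" by (intro mult_right_mono psi_mono) auto
  moreover have "A_fun v * exp (-(u - v)) = psi (exp v) * exp (-u)"
  proof -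
    have "exp (-v) * exp (-(u - v)) = exp (-u)" by (simp flip: exp_add)
    thus ?thesis by (simp only: A_fun_def mult.assoc)
  qed
  ultimately show ?thesis by (simp only: A_fun_def)
qed

text \<open>A deviation \<kappa> at v persists with size \<kappa> / 2 over a window of length
  \<kappa> / 4, to the right of v if \<open>A_fun\<close> is too large and to the left if it is too
  small. The smoothed deviation is small by \<open>smoothed_G_fun_bound\<close>, which limits
  \<kappa> in terms of the width l.\<close>

lemma A_fun_tauberian:
  "\<exists>r>0. \<exists>K\<ge>0. \<forall>v l \<kappa>. v \<ge> 1 / r \<and> v \<ge> 1 \<and> 0 < l \<and> l \<le> 1 \<and> 0 < \<kappa> \<and> \<kappa> \<le> 1 \<and> 8 * l \<le> \<kappa> \<and> \<bar>A_fun v - 1\<bar> > \<kappa> \<longrightarrow>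
     \<kappa> / 12 \<le> 64 * (l / \<kappa>) + K / (l ^ 17 * v)"
proof -
  obtain r K where r: "r > 0" and K: "K \<ge> 0"
    "\<And>\<sigma> l w. 1 < \<sigma> \<Longrightarrow> \<sigma> \<le> 1 + r \<Longrightarrow> 0 < l \<Longrightarrow> l \<le> 1 \<Longrightarrow> w > 0 \<Longrightarrow>
     norm (integral\<^sup>L lborel (\<lambda>t. indicator {0<..} t *\<^sub>R (exp (-(Complex l (-w)) * of_real t) * G_fun (Complex \<sigma> t))))
       \<le> K / (l ^ 17 * w)"
    using smoothed_G_fun_bound by blast
  have "\<kappa> / 12 \<le> 64 * (l / \<kappa>) + 2 * K / (l ^ 17 * v)"
    if *: "v \<ge> 1 / r" "v \<ge> 1" "0 < l" "l \<le> 1" "0 < \<kappa>" "\<kappa> \<le> 1" "8 * l \<le> \<kappa>" "\<bar>A_fun v - 1\<bar> > \<kappa>" for v l \<kappa>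
  proof -
    \<comment> \<open>The damping factor is then at least exp (-2) \<ge> 1/9 up to u = 2v, and
      \<sigma> \<le> 1 + r because v \<ge> 1 / r.\<close>
    define \<sigma> where "\<sigma> = 1 + 1 / v"
    have \<sigma>: "1 < \<sigma>" "\<sigma> \<le> 1 + r" using * r by (auto simp: \<sigma>_def field_simps)
    define h where "h = \<kappa> / 8"
    have h: "h \<ge> l" "h > 0" using * by (auto simp: h_def)
    define \<Phi> where "\<Phi> = (\<lambda>w u. indicator {0<..} u * ((A_fun u - 1) * exp (-(\<sigma> - 1) * u) * poisson_kernel l (w - u)))"
    have bnd: "\<bar>integral\<^sup>L lborel (\<Phi> w)\<bar> \<le> 2 * K / (l ^ 17 * v)" if "w \<ge> v / 2" for w
    proof -
      have "w > 0" using that * by simp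
      have "\<bar>integral\<^sup>L lborel (\<Phi> w)\<bar> \<le> K / (l ^ 17 * w)"
        unfolding \<Phi>_def smoothed_A_fun_eq[OF \<sigma>(1) *(3)]
        by (rule order_trans[OF abs_Re_le_cmod K(2)[OF \<sigma> *(3,4) \<open>w > 0\<close>]])
      also have "\<dots> \<le> K / (l ^ 17 * (v / 2))"
        using that * K by (intro divide_left_mono mult_left_mono mult_pos_pos) auto
      finally show ?thesis by (simp add: mult.commute)
    qed
    have \<Phi>_abs: "\<bar>\<Phi> w u\<bar> \<le> 4 * poisson_kernel l (w - u)" for w u
    proof -
      have "\<bar>\<Phi> w u\<bar> = indicator {0<..} u * (\<bar>A_fun u - 1\<bar> * exp (-(\<sigma> - 1) * u)) * poisson_kernel l (w - u)"
        using poisson_kernel_nonneg[OF *(3), of "w - u"] by (simp add: \<Phi>_def abs_mult)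
      also have "\<dots> \<le> 4 * poisson_kernel l (w - u)"
      proof (intro mult_right_mono poisson_kernel_nonneg)
        show "indicator {0<..} u * (\<bar>A_fun u - 1\<bar> * exp (-(\<sigma> - 1) * u)) \<le> 4"
        proof (cases "u > 0")
          case True
          have "\<bar>A_fun u - 1\<bar> * exp (-(\<sigma> - 1) * u) \<le> 4 * 1"
            using True \<sigma> by (intro mult_mono A_fun_bounds) (auto intro: mult_nonpos_nonneg)
          thus ?thesis using True by simp
        qed simp
      qed (use * in auto)
      finally show ?thesis .
    qed
    have \<Phi>_int: "integrable lborel (\<Phi> w)" for w
    proof (rule Bochner_Integration.integrable_bound)
      show "integrable lborel (\<lambda>u. 4 * poisson_kernel l (w - u))"
        using * by (intro integrable_mult_right poisson_kernel_integral)
      have [measurable]: "(\<lambda>u. poisson_kernel l (w - u)) \<in> borel_measurable borel"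
        unfolding poisson_kernel_def by measurable
      show "\<Phi> w \<in> borel_measurable lborel" unfolding \<Phi>_def by measurable
      show "AE u in lborel. norm (\<Phi> w u) \<le> norm (4 * poisson_kernel l (w - u))"
        using \<Phi>_abs[of w] poisson_kernel_nonneg[OF *(3)] by (intro always_eventually allI) auto
    qed
    have e2: "exp (-(\<sigma> - 1) * u) \<ge> 1 / 9" if "u \<le> 2 * v" for u
    proof -
      have "(\<sigma> - 1) * u \<le> 2" using that * by (simp add: \<sigma>_def field_simps)
      hence "exp (-2) \<le> exp (-((\<sigma> - 1) * u))" by simp
      hence "exp (-2) \<le> exp (-(\<sigma> - 1) * u)" by (simp only: mult_minus_left)
      moreover have "exp (2::real) \<le> 9"
      proof -
        have "exp (2::real) = exp 1 * exp 1" by (simp flip: exp_add)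
        also have "\<dots> \<le> 3 * 3" by (intro mult_mono exp_le) auto
        finally show ?thesis by simp
      qed
      hence "1 / 9 \<le> exp (-2::real)" by (simp add: exp_minus field_simps)
      ultimately show ?thesis by linarith
    qed
    \<comment> \<open>The window estimate with c = \<kappa> / 18 and h = \<kappa> / 8 produces
      \<kappa> / 12 and 64 l / \<kappa>.\<close>
    have fin: "\<kappa> / 12 \<le> 64 * (l / \<kappa>) + 2 * K / (l ^ 17 * v)"
      if "(\<kappa> / 2 * (1/9)) * (3 / 2) - 8 * (l / h) \<le> 2 * K / (l ^ 17 * v)"
      using that by (simp add: h_def)
    consider "A_fun v > 1 + \<kappa>" | "A_fun v < 1 - \<kappa>" using * by linarith
    thus ?thesis
    proof cases
      case 1
      \<comment> \<open>Centred so that the window begins at v; in the other case it ends at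
        v.\<close>
      define w where "w = v + h"
      have "(\<kappa> / 2 * (1/9)) * (3 / 2) - 8 * (l / h) \<le> integral\<^sup>L lborel (\<Phi> w)"
      proof (rule tauberian_window[OF *(3) h(1) _ \<Phi>_int])
        fix u assume u: "u \<in> {w - h..w + h}"
        have u': "v \<le> u" "u \<le> v + \<kappa> / 4" using u by (auto simp: w_def h_def)
        have "(1 + \<kappa>) * (1 - \<kappa> / 4) \<le> A_fun v * exp (-(u - v))"
        proof (rule mult_mono)
          have "1 + -(u - v) \<le> exp (-(u - v))" by (rule exp_ge_add_one_self)
          thus "1 - \<kappa> / 4 \<le> exp (-(u - v))" using u' by linarith
        qed (use 1 * in auto)
        also have "\<dots> \<le> A_fun u" by (rule A_fun_growth[OF u'(1)])
        finally have "(1 + \<kappa>) * (1 - \<kappa> / 4) \<le> A_fun u" .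
        moreover have "(1 + \<kappa>) * (1 - \<kappa> / 4) = 1 + \<kappa> / 2 + \<kappa> * (1 - \<kappa>) / 4" by (simp add: field_simps)
        moreover have "\<kappa> * (1 - \<kappa>) \<ge> 0" using * by simp
        ultimately have A: "\<kappa> / 2 \<le> A_fun u - 1" by linarith
        have "\<kappa> / 2 * (1/9) * poisson_kernel l (w - u) \<le> (A_fun u - 1) * exp (-(\<sigma> - 1) * u) * poisson_kernel l (w - u)"
          using A * u' e2[of u] by (intro mult_right_mono mult_mono poisson_kernel_nonneg) auto
        thus "\<kappa> / 2 * (1/9) * poisson_kernel l (w - u) \<le> \<Phi> w u"
          using u' * by (simp add: \<Phi>_def)
      next
        fix u show "-4 * poisson_kernel l (w - u) \<le> \<Phi> w u" using \<Phi>_abs[of w u] by (simp add: abs_le_iff)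
      qed (use * in auto)
      also have "\<dots> \<le> 2 * K / (l ^ 17 * v)" using bnd[of w] * h by (simp add: w_def)
      finally show ?thesis by (rule fin)
    next
      case 2
      define w where "w = v - h"
      have "(\<kappa> / 2 * (1/9)) * (3 / 2) - 8 * (l / h) \<le> integral\<^sup>L lborel (\<lambda>u. -\<Phi> w u)"
      proof (rule tauberian_window[OF *(3) h(1)])
        show "integrable lborel (\<lambda>u. -\<Phi> w u)" using \<Phi>_int by simp
        fix u assume u: "u \<in> {w - h..w + h}"
        have u': "u \<le> v" "u \<ge> v - \<kappa> / 4" using u by (auto simp: w_def h_def)
        have "A_fun u * (1 - \<kappa> / 4) \<le> A_fun u * exp (-(v - u))"
        proof (intro mult_left_mono A_fun_bounds)
          have "1 + -(v - u) \<le> exp (-(v - u))" by (rule exp_ge_add_one_self)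
          thus "1 - \<kappa> / 4 \<le> exp (-(v - u))" using u' by linarith
        qed
        also have "\<dots> \<le> A_fun v" by (rule A_fun_growth[OF u'(1)])
        also have "\<dots> \<le> (1 - \<kappa> / 2) * (1 - \<kappa> / 4)"
        proof -
          have "(1 - \<kappa> / 2) * (1 - \<kappa> / 4) = 1 - \<kappa> + (\<kappa> / 4 + \<kappa> * \<kappa> / 8)" by (simp add: field_simps)
          moreover have "0 \<le> \<kappa> * \<kappa>" by simp
          ultimately show ?thesis using 2 * by linarith
        qed
        finally have "A_fun u \<le> 1 - \<kappa> / 2" using * by (simp add: mult_le_cancel_right)
        hence A: "\<kappa> / 2 \<le> 1 - A_fun u" by simp
        have "\<kappa> / 2 * (1/9) * poisson_kernel l (w - u) \<le> (1 - A_fun u) * exp (-(\<sigma> - 1) * u) * poisson_kernel l (w - u)"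
          using A * u' e2[of u] by (intro mult_right_mono mult_mono poisson_kernel_nonneg) auto
        also have "\<dots> = -((A_fun u - 1) * exp (-(\<sigma> - 1) * u) * poisson_kernel l (w - u))" by (simp add: algebra_simps)
        finally show "\<kappa> / 2 * (1/9) * poisson_kernel l (w - u) \<le> -\<Phi> w u"
          using u' * by (simp add: \<Phi>_def)
      next
        fix u show "-4 * poisson_kernel l (w - u) \<le> -\<Phi> w u" using \<Phi>_abs[of w u] by (simp add: abs_le_iff)
      qed (use * in auto)
      also have "\<dots> \<le> 2 * K / (l ^ 17 * v)" using bnd[of w] * h by (simp add: w_def h_def)
      finally show ?thesis by (rule fin)
    qed
  qed
  thus ?thesis using r K(1) by (intro exI[of _ r] conjI exI[of _ "2 * K"]) auto
qed

text \<open>\<open>A_fun_tauberian\<close> is applied at v = ln x with \<kappa> = 60 / q and l = 1 /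
  q^2, where q = ln ln x. A larger deviation would give 5 / q \<le> (64/60) / q + K q^34 / ln x, and
  the last term is at most 1 / q for large x.\<close>

lemma prime_number_theorem_psi: "\<exists>C\<ge>0. \<forall>\<^sub>F x in at_top. \<bar>psi x - x\<bar> \<le> C * x / ln (ln x)"
proof -
  obtain r K where r: "r > 0" and K: "K \<ge> 0"
    "\<And>v l \<kappa>. v \<ge> 1 / r \<Longrightarrow> v \<ge> 1 \<Longrightarrow> 0 < l \<Longrightarrow> l \<le> 1 \<Longrightarrow> 0 < \<kappa> \<Longrightarrow> \<kappa> \<le> 1 \<Longrightarrow> 8 * l \<le> \<kappa> \<Longrightarrow> \<bar>A_fun v - 1\<bar> > \<kappa> \<Longrightarrow>
     \<kappa> / 12 \<le> 64 * (l / \<kappa>) + K / (l ^ 17 * v)"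
    using A_fun_tauberian by blast
  have e1: "\<forall>\<^sub>F x::real in at_top. ln x \<ge> 1 / r"
    by (rule filterlim_at_top[THEN iffD1, rule_format, OF ln_at_top])
  have e2: "\<forall>\<^sub>F x::real in at_top. ln x \<ge> 1 \<and> 1 / (ln (ln x))\<^sup>2 \<le> 1 \<and> 0 < 60 / ln (ln x) \<and> 60 / ln (ln x) \<le> 1 \<and> ln (ln x) > 1 \<and> x > 0"
    by (intro eventually_conj; real_asymp)
  have e3: "\<forall>\<^sub>F x::real in at_top. K * (ln (ln x)) ^ 35 / ln x \<le> 1"
  proof -
    have "((\<lambda>x::real. K * ((ln (ln x)) ^ 35 / ln x)) \<longlongrightarrow> K * 0) at_top"
      by (intro tendsto_mult tendsto_const) real_asymp
    hence "\<forall>\<^sub>F x::real in at_top. K * ((ln (ln x)) ^ 35 / ln x) < 1" by (rule order_tendstoD) simp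
    thus ?thesis by eventually_elim simp
  qed
  show ?thesis
  proof (intro exI[of _ 60] conjI)
    show "\<forall>\<^sub>F x in at_top. \<bar>psi x - x\<bar> \<le> 60 * x / ln (ln x)"
      using e1 e2 e3
    proof eventually_elim
      case (elim x)
      define q where "q = ln (ln x)"
      have q: "q > 1" "60 / q \<le> 1" using elim by (auto simp: q_def)
      have "\<bar>A_fun (ln x) - 1\<bar> \<le> 60 / q"
      proof (rule ccontr)
        assume "\<not> \<bar>A_fun (ln x) - 1\<bar> \<le> 60 / q"
        hence "60 / q / 12 \<le> 64 * ((1 / q\<^sup>2) / (60 / q)) + K / ((1 / q\<^sup>2) ^ 17 * ln x)"
          using elim q by (intro K(2)) (auto simp: q_def[symmetric] field_simps power2_eq_square)
        also have "64 * ((1 / q\<^sup>2) / (60 / q)) = (64 / 60) / q" using q by (simp add: power2_eq_square)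
        also have "K / ((1 / q\<^sup>2) ^ 17 * ln x) = (K * q ^ 35 / ln x) / q"
          using q by (simp add: power_divide flip: power_mult) (simp add: eval_nat_numeral)
        also have "\<dots> \<le> 1 / q" using elim q by (intro divide_right_mono) (auto simp: q_def)
        finally have "5 / q \<le> (64 / 60 + 1) / q" by (simp add: add_divide_distrib)
        thus False using q by (simp add: field_simps)
      qed
      hence "\<bar>A_fun (ln x) - 1\<bar> * x \<le> 60 / q * x" using elim by (intro mult_right_mono) auto
      moreover have "psi x - x = (A_fun (ln x) - 1) * x"
        using elim by (simp add: A_fun_def exp_minus field_simps)
      ultimately have "\<bar>psi x - x\<bar> \<le> 60 / q * x"
        using elim by (simp only: abs_mult) simp
      thus ?case by (simp add: q_def)
    qed
  qed simp
qed

lemma prime_number_theorem_pi: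
  "\<exists>K\<ge>0. \<forall>\<^sub>F x in at_top. \<bar>pi_fun x - x / ln x\<bar> \<le> K * x / (ln x * ln (ln x))"
  using prime_number_theorem_psi pi_fun_from_psi by blast

section \<open>Legendre and Jacobi symbols\<close>

lemma Legendre_values: "Legendre a p \<in> {-1, 0, 1}"
  by (simp add: Legendre_def)

lemma abs_Legendre_le: "\<bar>Legendre a p\<bar> \<le> 1"
  by (simp add: Legendre_def)

lemma Legendre_cong: "[a = b] (mod p) \<Longrightarrow> Legendre a p = Legendre b p"
proof -
  assume ab: "[a = b] (mod p)"
  have "[a = 0] (mod p) \<longleftrightarrow> [b = 0] (mod p)"
    using ab cong_trans[OF cong_sym[OF ab]] cong_trans[OF ab] by blast
  moreover have "QuadRes p a \<longleftrightarrow> QuadRes p b"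
    unfolding QuadRes_def using cong_trans[OF _ ab] cong_trans[OF _ cong_sym[OF ab]] by blast
  ultimately show ?thesis by (simp add: Legendre_def)
qed

lemma Legendre_eq_0_iff: "Legendre a p = 0 \<longleftrightarrow> p dvd a"
  by (simp add: Legendre_def cong_0_iff)

lemma small_cong_imp_eq:
  fixes a b :: int
  assumes "[a = b] (mod int p)" "a \<in> {-1, 0, 1}" "b \<in> {-1, 0, 1}" "p > 2"
  shows "a = b"
proof (rule ccontr)
  assume "a \<noteq> b"
  have "int p dvd (a - b)" using assms(1) by (simp add: cong_iff_dvd_diff)
  hence "int p \<le> \<bar>a - b\<bar>" using \<open>a \<noteq> b\<close> by (intro zdvd_imp_le) (auto simp: dvd_abs_iff)
  thus False using assms by auto
qed

text \<open>By Euler's criterion both sides are congruent modulo p, and for p > 2 two congruent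
  values from -1, 0, 1 are equal.\<close>

lemma Legendre_mult:
  assumes "prime p" "p > 2"
  shows "Legendre (a * b) (int p) = Legendre a (int p) * Legendre b (int p)"
proof (rule small_cong_imp_eq[OF _ _ _ assms(2)])
  have "[Legendre (a * b) (int p) = (a * b) ^ ((p - 1) div 2)] (mod int p)"
    by (rule euler_criterion[OF assms])
  moreover have "[Legendre a (int p) * Legendre b (int p) = a ^ ((p - 1) div 2) * b ^ ((p - 1) div 2)] (mod int p)"
    by (intro cong_mult euler_criterion assms)
  ultimately show "[Legendre (a * b) (int p) = Legendre a (int p) * Legendre b (int p)] (mod int p)"
    by (metis cong_sym cong_trans power_mult_distrib)
qed (auto simp: Legendre_def)

lemma Legendre_1: "prime p \<Longrightarrow> Legendre 1 (int p) = 1"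
proof -
  assume "prime p"
  hence "\<not> [1 = 0] (mod int p)" using prime_gt_1_nat[of p] by (simp add: cong_0_iff)
  moreover have "QuadRes (int p) 1" unfolding QuadRes_def by (rule exI[of _ 1]) simp
  ultimately show ?thesis by (simp add: Legendre_def)
qed

text \<open>As x and p - x have the same square, the squares of 1, ..., (p - 1)/2 are all the
  squares of units, too few to fill the p - 1 classes.\<close>

lemma Legendre_nonresidue_exists:
  assumes "prime p" "p > 2"
  obtains b where "Legendre b (int p) = -1"
proof (rule ccontr)
  assume no: "\<not> thesis"
  have "{1..<p} \<subseteq> (\<lambda>x. x\<^sup>2 mod p) ` {1..(p - 1) div 2}"
  proof
    fix a assume a: "a \<in> {1..<p}"
    hence "\<not> [int a = 0] (mod int p)" by (auto simp: cong_0_iff dest: zdvd_imp_le)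
    moreover have "Legendre (int a) (int p) \<noteq> -1" using no that by blast
    ultimately have "QuadRes (int p) (int a)" by (auto simp: Legendre_def split: if_splits)
    then obtain y where y: "[y\<^sup>2 = int a] (mod int p)" by (auto simp: QuadRes_def)
    define x where "x = nat (y mod int p)"
    have x: "int x = y mod int p" "x < p" using assms prime_gt_0_nat[of p]
      by (auto simp: x_def nat_less_iff)
    have "[int x ^ 2 = y ^ 2] (mod int p)" by (intro cong_pow) (simp add: x)
    hence xa: "[int x ^ 2 = int a] (mod int p)" using y cong_trans by blast
    have x0: "x \<noteq> 0"
    proof
      assume "x = 0"
      hence "[int a = 0] (mod int p)" using xa by (simp add: cong_sym)
      thus False using \<open>\<not> [int a = 0] (mod int p)\<close> by simp
    qed
    have sq: "z\<^sup>2 mod p = a" if "[int z ^ 2 = int a] (mod int p)" for z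
    proof -
      have "[z ^ 2 = a] (mod p)" using that by (simp flip: cong_int_iff)
      hence "z ^ 2 mod p = a mod p" by (simp only: unique_euclidean_semiring_class.cong_def)
      thus ?thesis using a by simp
    qed
    show "a \<in> (\<lambda>x. x\<^sup>2 mod p) ` {1..(p - 1) div 2}"
    proof (cases "x \<le> (p - 1) div 2")
      case True
      thus ?thesis using sq[OF xa] x0 by (intro image_eqI[of _ _ x]) auto
    next
      case False
      have "odd p" using assms prime_odd_nat by blast
      hence "p - x \<le> (p - 1) div 2" using False x(2) by presburger
      moreover have "[int (p - x) ^ 2 = int a] (mod int p)"
      proof -
        have "int (p - x) ^ 2 - int x ^ 2 = int p * (int p - 2 * int x)"
          using x by (simp add: of_nat_diff power2_eq_square algebra_simps)
        hence "[int (p - x) ^ 2 = int x ^ 2] (mod int p)" by (simp add: cong_iff_dvd_diff)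
        thus ?thesis using xa cong_trans by blast
      qed
      ultimately show ?thesis using sq x by (intro image_eqI[of _ _ "p - x"]) auto
    qed
  qed
  hence "card {1..<p} \<le> card ((\<lambda>x. x\<^sup>2 mod p) ` {1..(p - 1) div 2})" by (intro card_mono) auto
  also have "\<dots> \<le> card {1..(p - 1) div 2}" by (rule card_image_le) simp
  finally show False using assms by simp
qed

text \<open>The product runs over the distinct prime factors, so this is the Jacobi symbol (a / m)
  for odd squarefree m.\<close>

definition jac :: "nat \<Rightarrow> int \<Rightarrow> int" where
  "jac m a = (\<Prod>q\<in>prime_factors m. Legendre a (int q))"

lemma abs_jac_le: "\<bar>jac m a\<bar> \<le> 1"
  unfolding jac_def abs_prod by (intro prod_le_1) (simp add: abs_Legendre_le)

lemma jac_cong: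
  assumes "[a = b] (mod int m)"
  shows "jac m a = jac m b"
  unfolding jac_def
proof (intro prod.cong refl Legendre_cong)
  fix q assume "q \<in> prime_factors m"
  hence "int q dvd int m" by auto
  thus "[a = b] (mod int q)" using assms cong_dvd_modulus by blast
qed

lemma odd_prime_factor: "odd (m::nat) \<Longrightarrow> q \<in> prime_factors m \<Longrightarrow> prime q \<and> q > 2"
  using prime_ge_2_nat[of q] by (cases "q = 2") (auto simp: in_prime_factors_iff)

lemma jac_mult: "odd m \<Longrightarrow> jac m (a * b) = jac m a * jac m b"
  unfolding jac_def prod.distrib[symmetric]
  by (intro prod.cong refl Legendre_mult) (auto dest: odd_prime_factor)

lemma jac_1: "jac m 1 = 1"
  unfolding jac_def by (intro prod.neutral ballI Legendre_1) (auto simp: in_prime_factors_iff)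

lemma jac_eq_0_iff:
  assumes "m > 0"
  shows "jac m a = 0 \<longleftrightarrow> \<not> coprime a (int m)"
proof
  assume "jac m a = 0"
  then obtain q where q: "q \<in> prime_factors m" "int q dvd a"
    by (auto simp: jac_def Legendre_eq_0_iff)
  hence "int q dvd int m" "\<not> is_unit (int q)" by (auto simp: in_prime_factors_iff)
  with q show "\<not> coprime a (int m)" by (meson coprime_common_divisor)
next
  assume "\<not> coprime a (int m)"
  hence "gcd a (int m) \<noteq> 1" by (simp add: coprime_iff_gcd_eq_1)
  define g where "g = nat (gcd a (int m))"
  have g: "int g = gcd a (int m)" "g \<noteq> 1" using \<open>gcd a (int m) \<noteq> 1\<close> by (auto simp: g_def)
  then obtain q where q: "prime q" "q dvd g" using prime_factor_nat by blast
  have "int q dvd a" "int q dvd int m" using q g by (metis gcd_dvd1 gcd_dvd2 dvd_trans int_dvd_int_iff)+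
  hence "q \<in> prime_factors m" using q assms by (auto simp: in_prime_factors_iff)
  thus "jac m a = 0" using \<open>int q dvd a\<close> by (auto simp: jac_def Legendre_eq_0_iff)
qed

lemma squarefree_coprime_div:
  assumes "squarefree m" "prime p" "p dvd (m::nat)"
  shows "coprime p (m div p)"
proof -
  have "\<not> p dvd m div p"
  proof
    assume "p dvd m div p"
    hence "p * p dvd p * (m div p)" by simp
    hence "p ^ 2 dvd m" using assms by (simp add: power2_eq_square)
    thus False using assms by (auto simp: squarefree_def)
  qed
  thus ?thesis using assms prime_imp_coprime by blast
qed

text \<open>By the Chinese remainder theorem a is a nonresidue modulo p and 1 modulo everything
  else. The extra modulus k is 1 when primitivity is proved and the second conductor when products
  of two symbols are summed.\<close>

lemma jac_nonprincipal:
  assumes "odd m" "squarefree m" "prime p" "p dvd m" "\<not> p dvd k"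
  obtains a where "[a = 1] (mod int ((m div p) * k))" "jac m a = -1" "coprime a (int m)"
proof -
  have m0: "m > 0" using assms by (auto intro: Nat.gr0I)
  have pm: "p \<in> prime_factors m" using assms m0 by (auto simp: in_prime_factors_iff)
  have p: "prime p" "p > 2" using odd_prime_factor[OF assms(1) pm] by auto
  obtain b where b: "Legendre b (int p) = -1" using Legendre_nonresidue_exists[OF p] .
  have "coprime p ((m div p) * k)"
    using squarefree_coprime_div[OF assms(2,3,4)] assms(3,5) prime_imp_coprime by auto
  hence "coprime (int p) (int ((m div p) * k))" by (simp only: coprime_int_iff)
  then obtain a where a: "[a = b] (mod int p)" "[a = 1] (mod int ((m div p) * k))"
    using binary_chinese_remainder_int by blast
  have "jac m a = Legendre a (int p) * (\<Prod>q\<in>prime_factors m - {p}. Legendre a (int q))"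
    unfolding jac_def by (rule prod.remove) (use pm in auto)
  also have "Legendre a (int p) = -1" using b Legendre_cong[OF a(1)] by simp
  also have "(\<Prod>q\<in>prime_factors m - {p}. Legendre a (int q)) = 1"
  proof (intro prod.neutral ballI)
    fix q assume q: "q \<in> prime_factors m - {p}"
    hence "prime q" "q dvd m" "q \<noteq> p" by (auto simp: in_prime_factors_iff)
    hence "q dvd p * (m div p)" "\<not> q dvd p" using assms by (auto simp: primes_dvd_imp_eq)
    hence "q dvd m div p" using \<open>prime q\<close> by (simp add: prime_dvd_mult_iff)
    hence "int q dvd int ((m div p) * k)" by (metis dvd_mult2 int_dvd_int_iff)
    hence "[a = 1] (mod int q)" using a(2) cong_dvd_modulus by blast
    thus "Legendre a (int q) = 1" using Legendre_cong Legendre_1[OF \<open>prime q\<close>] by metis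
  qed
  finally have "jac m a = -1" by simp
  moreover from this have "coprime a (int m)" using jac_eq_0_iff[OF m0, of a] by auto
  ultimately show ?thesis using a(2) that by blast
qed

lemma jac_dirichlet_character:
  assumes "odd m"
  shows "dirichlet_character m (\<lambda>a. complex_of_int (jac m a))"
proof -
  have m0: "m > 0" using assms by (auto intro: Nat.gr0I)
  moreover have "jac m (a + int m) = jac m a" for a by (rule jac_cong) (simp add: cong_iff_dvd_diff)
  ultimately show ?thesis
    unfolding dirichlet_character_def using jac_mult[OF assms] jac_eq_0_iff[OF m0] by auto
qed

lemma dirichlet_character_cong:
  assumes "dirichlet_character e \<psi>" "[a = b] (mod int e)"
  shows "\<psi> a = \<psi> b"
proof -
  have per: "\<psi> (c + int e) = \<psi> c" for c using assms(1) by (simp add: dirichlet_character_def)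
  have nat: "\<psi> (c + int n * int e) = \<psi> c" for c n
    by (induction n) (use per[of "c + int n * int e" for n] in \<open>auto simp: algebra_simps\<close>)
  obtain k where k: "b = a + k * int e"
    using assms(2) by (metis cong_iff_lin mult.commute)
  show ?thesis
  proof (cases "k \<ge> 0")
    case True
    thus ?thesis using nat[of a "nat k"] k by simp
  next
    case False
    thus ?thesis using nat[of b "nat (-k)"] k by simp
  qed
qed

text \<open>A proper divisor e of m divides m / p for some prime p, and the witness of
  \<open>jac_nonprincipal\<close> is 1 modulo m / p but has symbol -1, so the symbol is not induced
  from e. Taking e = 1 excludes the principal character.\<close>

lemma jac_quadratic_character:
  assumes "odd m" "squarefree m" "m > 1"
  shows "quadratic_character m (\<lambda>a. complex_of_int (jac m a))"
proof -
  define \<chi> where "\<chi> = (\<lambda>a. complex_of_int (jac m a))"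
  have dc: "dirichlet_character m \<chi>" unfolding \<chi>_def by (rule jac_dirichlet_character[OF assms(1)])
  have not_induced: False if ind: "induced_from_modulus m \<chi> e" and em: "e \<noteq> m" for e
  proof -
    obtain \<psi> where \<psi>: "e dvd m" "dirichlet_character e \<psi>" "\<And>a. coprime a (int m) \<Longrightarrow> \<chi> a = \<psi> a"
      using ind by (auto simp: induced_from_modulus_def)
    obtain k where k: "m = e * k" using \<psi>(1) by blast
    have "k \<noteq> 1" using k em by auto
    then obtain p where p: "prime p" "p dvd k" using prime_factor_nat by blast
    have pm: "p dvd m" using p k by simp
    obtain k' where k': "k = p * k'" using p by blast
    have "m div p = e * k'" using k k' prime_gt_0_nat[OF p(1)] by simp
    hence edvd: "e dvd m div p" by simp
    have "\<not> p dvd 1" using p prime_gt_1_nat[of p] by auto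
    then obtain a where a: "[a = 1] (mod int ((m div p) * 1))" "jac m a = -1" "coprime a (int m)"
      using jac_nonprincipal[OF assms(1,2) p(1) pm] by blast
    have "[a = 1] (mod int e)" using a(1) edvd by (metis cong_dvd_modulus int_dvd_int_iff mult.right_neutral)
    hence "\<psi> a = \<psi> 1" by (rule dirichlet_character_cong[OF \<psi>(2)])
    moreover have "\<psi> 1 = 1"
    proof -
      have "\<psi> (1 * 1) = \<psi> 1 * \<psi> 1" "\<psi> 1 \<noteq> 0" using \<psi>(2) unfolding dirichlet_character_def by (blast, simp)
      thus ?thesis by simp
    qed
    ultimately have "\<chi> a = 1" using \<psi>(3)[OF a(3)] by simp
    thus False using a(2) by (simp add: \<chi>_def)
  qed
  have "induced_from_modulus m \<chi> m" using dc by (auto simp: induced_from_modulus_def)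
  hence "induced_from_modulus m \<chi> (conductor m \<chi>)" unfolding conductor_def by (rule LeastI)
  hence "conductor m \<chi> = m" using not_induced by blast
  moreover have "\<chi> \<noteq> principal_character m"
  proof
    assume eq: "\<chi> = principal_character m"
    have "dirichlet_character 1 (\<lambda>_. 1)" by (simp add: dirichlet_character_def)
    hence "induced_from_modulus m \<chi> 1"
      unfolding induced_from_modulus_def eq principal_character_def by (intro conjI exI[of _ "\<lambda>_. 1"]) auto
    thus False using not_induced[of 1] assms by simp
  qed
  moreover have "range \<chi> \<subseteq> \<real>" by (auto simp: \<chi>_def)
  ultimately show ?thesis using dc by (simp add: quadratic_character_def primitive_character_def \<chi>_def)
qed

lemma squarefree_prod_prime_factors:
  assumes "squarefree m" "(m::nat) > 0"
  shows "\<Prod>(prime_factors m) = m"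
proof -
  have "(\<Prod>q\<in>prime_factors m. q ^ multiplicity q m) = m"
    using assms by (simp add: prime_factorization_nat[symmetric])
  moreover have "(\<Prod>q\<in>prime_factors m. q ^ multiplicity q m) = \<Prod>(prime_factors m)"
  proof (intro prod.cong refl)
    fix q assume q: "q \<in> prime_factors m"
    have "multiplicity q m = 1" using squarefree_factorial_semiring'[of m] assms q by auto
    thus "q ^ multiplicity q m = q" by simp
  qed
  ultimately show ?thesis by simp
qed

text \<open>Reciprocity is applied factor by factor: every prime factor that is 3 modulo 4
  contributes the sign (-1)^((p - 1)/2), and these signs cancel when the product is 1 modulo 4. A
  character evaluated at p thus becomes a function of m modulo p, which the choice of a residue
  class controls.\<close>

lemma jac_reciprocity:
  assumes m: "odd m" "squarefree m" "[m = 1] (mod 4)" and p: "prime p" "p > 2"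
  shows "jac m (int p) = Legendre (int m) (int p)"
proof (cases "p dvd m")
  case True
  have "m > 0" using m by (auto intro: Nat.gr0I)
  hence "p \<in> prime_factors m" using True p by (auto simp: in_prime_factors_iff)
  hence "jac m (int p) = 0" unfolding jac_def by (intro prod_zero bexI[of _ p]) (auto simp: Legendre_eq_0_iff)
  moreover have "Legendre (int m) (int p) = 0" using True by (simp add: Legendre_eq_0_iff)
  ultimately show ?thesis by simp
next
  case False
  have gen: "(\<Prod>q\<in>A. Legendre (int p) (int q)) = Legendre (int (\<Prod>A)) (int p) \<or> (\<Prod>A) mod 4 = 3"
    "(\<Prod>A) mod 4 = 3 \<Longrightarrow> (\<Prod>q\<in>A. Legendre (int p) (int q)) = (-1) ^ ((p - 1) div 2) * Legendre (int (\<Prod>A)) (int p)"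
    "odd (\<Prod>A)"
    if "finite A" "\<And>q. q \<in> A \<Longrightarrow> prime q \<and> q > 2 \<and> q \<noteq> p" for A
  proof -
    define s where "s = (-1::int) ^ ((p - 1) div 2)"
    have ss: "s * s = 1" by (simp add: s_def flip: power_add)
    have "odd (\<Prod>A) \<and> (\<Prod>q\<in>A. Legendre (int p) (int q)) = (if (\<Prod>A) mod 4 = 3 then s else 1) * Legendre (int (\<Prod>A)) (int p)"
      using that
    proof (induction A rule: finite_induct)
      case empty
      thus ?case using Legendre_1[OF p(1)] by simp
    next
      case (insert q A)
      have q: "prime q" "q > 2" "q \<noteq> p" using insert.prems by auto
      have oq: "odd q" using q prime_odd_nat by blast
      define P where "P = \<Prod>A"
      have IH: "odd P" "(\<Prod>q\<in>A. Legendre (int p) (int q)) = (if P mod 4 = 3 then s else 1) * Legendre (int P) (int p)"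
        using insert unfolding P_def by auto
      have rec: "Legendre (int p) (int q) * Legendre (int q) (int p) = (-1) ^ ((p - 1) div 2 * ((q - 1) div 2))"
        by (rule Quadratic_Reciprocity) (use p q in auto)
      have L1: "Legendre (int q) (int p) * Legendre (int q) (int p) = 1"
      proof -
        have "\<not> int p dvd int q" using p q primes_dvd_imp_eq by auto
        hence "Legendre (int q) (int p) \<noteq> 0" by (simp add: Legendre_eq_0_iff)
        thus ?thesis using Legendre_values[of "int q" "int p"] by auto
      qed
      have sq: "(-1) ^ ((p - 1) div 2 * ((q - 1) div 2)) = (if q mod 4 = 3 then s else 1)"
      proof (cases "q mod 4 = 3")
        case True
        hence "odd ((q - 1) div 2)" by presburger
        thus ?thesis using True by (simp add: s_def power_mult minus_one_power_iff)
      next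
        case False
        hence "even ((q - 1) div 2)" using oq by presburger
        thus ?thesis using False by (simp add: s_def power_mult minus_one_power_iff)
      qed
      have "Legendre (int p) (int q) = Legendre (int p) (int q) * (Legendre (int q) (int p) * Legendre (int q) (int p))"
        using L1 by simp
      also have "\<dots> = (if q mod 4 = 3 then s else 1) * Legendre (int q) (int p)"
        using rec sq by (simp flip: mult.assoc)
      finally have L2: "Legendre (int p) (int q) = (if q mod 4 = 3 then s else 1) * Legendre (int q) (int p)" .
      \<comment> \<open>The sign attached to being 3 modulo 4 is multiplicative on odd numbers
        because \<open>s * s = 1\<close>.\<close>
      have mod: "(if (q * P) mod 4 = 3 then s else 1) = (if q mod 4 = 3 then s else 1) * (if P mod 4 = 3 then s else 1)"
      proof -
        have "q mod 4 = 1 \<or> q mod 4 = 3" "P mod 4 = 1 \<or> P mod 4 = 3" using oq IH(1) by presburger+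
        moreover have "(q * P) mod 4 = ((q mod 4) * (P mod 4)) mod 4" by (simp add: mod_mult_eq)
        ultimately show ?thesis by (elim disjE) (simp_all add: ss)
      qed
      have "(\<Prod>q\<in>insert q A. Legendre (int p) (int q)) = Legendre (int p) (int q) * ((if P mod 4 = 3 then s else 1) * Legendre (int P) (int p))"
        using insert.hyps IH by simp
      also have "\<dots> = (if (q * P) mod 4 = 3 then s else 1) * Legendre (int (q * P)) (int p)"
        unfolding L2 mod by (simp add: Legendre_mult[OF p])
      finally show ?case using insert.hyps oq IH(1) by (simp add: P_def)
    qed
    thus "(\<Prod>q\<in>A. Legendre (int p) (int q)) = Legendre (int (\<Prod>A)) (int p) \<or> (\<Prod>A) mod 4 = 3"
      "(\<Prod>A) mod 4 = 3 \<Longrightarrow> (\<Prod>q\<in>A. Legendre (int p) (int q)) = (-1) ^ ((p - 1) div 2) * Legendre (int (\<Prod>A)) (int p)"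
      "odd (\<Prod>A)" by (auto simp: s_def)
  qed
  have prod: "\<Prod>(prime_factors m) = m"
    by (rule squarefree_prod_prime_factors) (use m in \<open>auto intro: Nat.gr0I\<close>)
  have "m mod 4 \<noteq> 3" using m(3) by (simp add: unique_euclidean_semiring_class.cong_def)
  thus ?thesis
    using gen(1)[of "prime_factors m"] odd_prime_factor[OF m(1)] False unfolding prod jac_def
    by (auto simp: in_prime_factors_iff)
qed

section \<open>Sums of Jacobi symbols over residue classes and moduli\<close>

text \<open>The map from n to c + a n permutes the residues modulo N.\<close>

lemma complete_sum_affine:
  fixes f :: "int \<Rightarrow> int"
  assumes N: "N > 0" and per: "\<And>a b. [a = b] (mod int N) \<Longrightarrow> f a = f b" and a: "coprime a (int N)"
  shows "(\<Sum>n<N. f (c + a * int n)) = (\<Sum>n<N. f (int n))"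
proof -
  define h where "h = (\<lambda>n. nat ((c + a * int n) mod int N))"
  have h: "int (h n) = (c + a * int n) mod int N" "h n < N" for n
    using N by (auto simp: h_def nat_less_iff)
  have "inj_on h {..<N}"
  proof (rule inj_onI)
    fix m n assume mn: "m \<in> {..<N}" "n \<in> {..<N}" "h m = h n"
    hence "[c + a * int m = c + a * int n] (mod int N)"
      using h(1)[of m] h(1)[of n] by (simp add: unique_euclidean_semiring_class.cong_def)
    hence "[a * int m = a * int n] (mod int N)" by (simp only: cong_add_lcancel)
    hence "[int m = int n] (mod int N)" using a by (simp only: cong_mult_lcancel)
    hence "[m = n] (mod N)" by (simp only: cong_int_iff)
    thus "m = n" using mn by (simp add: unique_euclidean_semiring_class.cong_def)
  qed
  moreover have "h ` {..<N} \<subseteq> {..<N}" using h(2) by auto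
  ultimately have "bij_betw h {..<N} {..<N}"
    by (metis bij_betw_def endo_inj_surj finite_lessThan)
  hence "(\<Sum>n<N. f (int n)) = (\<Sum>n<N. f (int (h n)))" by (rule sum.reindex_bij_betw[symmetric])
  also have "\<dots> = (\<Sum>n<N. f (c + a * int n))"
    by (intro sum.cong refl per) (simp add: h unique_euclidean_semiring_class.cong_def)
  finally show ?thesis by simp
qed

text \<open>Whole periods drop out, and fewer than N terms of size at most 1 remain.\<close>

lemma periodic_sum_bound:
  fixes g :: "nat \<Rightarrow> int"
  assumes N: "N > 0" and per: "\<And>n. g (n + N) = g n" and z: "(\<Sum>n<N. g n) = 0" and b: "\<And>n. \<bar>g n\<bar> \<le> 1"
  shows "\<bar>\<Sum>n<J. g n\<bar> \<le> int N"
proof (induction J rule: less_induct)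
  case (less J)
  show ?case
  proof (cases "J < N")
    case True
    have "\<bar>\<Sum>n<J. g n\<bar> \<le> (\<Sum>n<J. 1)" by (intro order_trans[OF sum_abs] sum_mono b)
    thus ?thesis using True by simp
  next
    case False
    have "(\<Sum>n<J. g n) = (\<Sum>n<N. g n) + (\<Sum>n\<in>{N..<J}. g n)"
      using False by (subst sum.union_disjoint[symmetric]) (auto intro!: sum.cong)
    also have "(\<Sum>n\<in>{N..<J}. g n) = (\<Sum>n<J - N. g (n + N))"
      using False by (intro sum.reindex_bij_witness[of _ "\<lambda>n. n + N" "\<lambda>n. n - N"]) auto
    finally have "(\<Sum>n<J. g n) = (\<Sum>n<J - N. g n)" using z by (simp add: per)
    thus ?thesis using less.IH[of "J - N"] False N by simp
  qed
qed

text \<open>Multiplying the variable by b permutes the residues and reverses the sign of the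
  complete sum, which is therefore 0; \<open>periodic_sum_bound\<close> does the rest.\<close>

lemma nonprincipal_progression_sum:
  fixes f :: "int \<Rightarrow> int"
  assumes N: "N > 0" and per: "\<And>a b. [a = b] (mod int N) \<Longrightarrow> f a = f b"
    and mult: "\<And>a b. f (a * b) = f a * f b" and b: "coprime b (int N)" "f b = -1"
    and bound: "\<And>a. \<bar>f a\<bar> \<le> 1" and M: "coprime M (int N)"
  shows "\<bar>\<Sum>j<J. f (r + M * int j)\<bar> \<le> int N"
proof (rule periodic_sum_bound[OF N])
  show "f (r + M * int (n + N)) = f (r + M * int n)" for n
    by (rule per) (simp add: cong_iff_dvd_diff algebra_simps)
  have "(\<Sum>n<N. f (int n)) = (\<Sum>n<N. f (0 + b * int n))"
    by (rule complete_sum_affine[symmetric, OF N per b(1)])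
  also have "\<dots> = -(\<Sum>n<N. f (int n))" by (simp add: mult b sum_negf)
  finally have "(\<Sum>n<N. f (int n)) = 0" by simp
  thus "(\<Sum>n<N. f (r + M * int n)) = 0" using complete_sum_affine[where f = f and c = r, OF N per M] by simp
qed (rule bound)

lemma jac_progression_sum:
  assumes "odd m" "squarefree m" "m > 1" "coprime M m"
  shows "\<bar>\<Sum>j<J. jac m (int (r + M * j))\<bar> \<le> int m"
proof -
  obtain p where p: "prime p" "p dvd m" using prime_factor_nat[of m] assms by auto
  hence "\<not> p dvd 1" using prime_gt_1_nat[of p] by auto
  then obtain b where b: "jac m b = -1" "coprime b (int m)"
    using jac_nonprincipal[OF assms(1,2) p] by blast
  have "\<bar>\<Sum>j<J. jac m (int r + int M * int j)\<bar> \<le> int m"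
    by (rule nonprincipal_progression_sum[where b = b])
       (use assms b in \<open>auto intro: jac_cong simp: jac_mult abs_jac_le\<close>)
  thus ?thesis by simp
qed

lemma squarefree_distinct_prime:
  assumes "squarefree d" "squarefree d'" "d \<noteq> d'" "(d::nat) > 0" "d' > 0"
  obtains p where "prime p" "p dvd d \<and> \<not> p dvd d' \<or> p dvd d' \<and> \<not> p dvd d"
proof -
  have "prime_factors d \<noteq> prime_factors d'"
    using squarefree_prod_prime_factors[of d] squarefree_prod_prime_factors[of d'] assms by metis
  then obtain p where "p \<in> prime_factors d \<and> p \<notin> prime_factors d' \<or> p \<in> prime_factors d' \<and> p \<notin> prime_factors d" by blast
  with that[of p] assms show ?thesis by (auto simp: in_prime_factors_iff)
qed

text \<open>Distinct squarefree d and d' differ in some prime p, and \<open>jac_nonprincipal\<close>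
  at p, with k the conductor that p does not divide, gives a b at which the product of the two
  symbols is -1.\<close>

lemma jac_pair_sum:
  assumes "odd d" "squarefree d" "odd d'" "squarefree d'" "d \<noteq> d'"
  shows "\<bar>\<Sum>n=1..k. jac d (int n) * jac d' (int n)\<bar> \<le> int (d * d')"
proof -
  have pos: "d > 0" "d' > 0" using assms by (auto intro: Nat.gr0I)
  have main: "\<exists>b. coprime b (int (d * d')) \<and> jac d b * jac d' b = -1"
    if *: "odd d" "squarefree d" "prime p" "p dvd d" "\<not> p dvd d'" "d' > 0" for d d' p
  proof -
    obtain b where b: "[b = 1] (mod int ((d div p) * d'))" "jac d b = -1" "coprime b (int d)"
      using jac_nonprincipal[OF *(1-5)] by blast
    have "[b = 1] (mod int d')" by (rule cong_dvd_modulus[OF b(1)]) simp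
    hence 1: "jac d' b = 1" using jac_cong jac_1 by metis
    hence "coprime b (int d')" using jac_eq_0_iff[OF *(6), of b] by simp
    thus ?thesis using b 1 by (intro exI[of _ b]) simp
  qed
  obtain p where p: "prime p" "p dvd d \<and> \<not> p dvd d' \<or> p dvd d' \<and> \<not> p dvd d"
    using squarefree_distinct_prime[OF assms(2,4,5) pos] .
  have "\<exists>b. coprime b (int (d * d')) \<and> jac d b * jac d' b = -1"
    using p(2)
  proof
    assume "p dvd d \<and> \<not> p dvd d'"
    thus ?thesis using main[of d p d'] assms p pos by auto
  next
    assume "p dvd d' \<and> \<not> p dvd d"
    thus ?thesis using main[of d' p d] assms p pos by (auto simp: mult.commute)
  qed
  then obtain b where b: "coprime b (int (d * d'))" "jac d b * jac d' b = -1" by blast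
  have "\<bar>\<Sum>j<k. (\<lambda>a. jac d a * jac d' a) (1 + 1 * int j)\<bar> \<le> int (d * d')"
  proof (rule nonprincipal_progression_sum[where b = b])
    fix x y assume xy: "[x = y] (mod int (d * d'))"
    have "[x = y] (mod int d)" "[x = y] (mod int d')" by (rule cong_dvd_modulus[OF xy], simp)+
    thus "jac d x * jac d' x = jac d y * jac d' y" using jac_cong by metis
  next
    show "\<bar>jac d a * jac d' a\<bar> \<le> 1" for a
      using abs_jac_le[of d a] abs_jac_le[of d' a] by (simp add: abs_mult mult_le_one)
  qed (use assms b pos in \<open>auto simp: jac_mult\<close>)
  also have "(\<Sum>j<k. (\<lambda>a. jac d a * jac d' a) (1 + 1 * int j)) = (\<Sum>n=1..k. jac d (int n) * jac d' (int n))"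
    by (intro sum.reindex_bij_witness[of _ "\<lambda>n. n - 1" Suc]) auto
  finally show ?thesis .
qed

section \<open>A large sieve by duality and a second moment over a progression\<close>

lemma weighted_sum_bound:
  fixes g :: "nat \<Rightarrow> real"
  assumes "\<And>k. k \<le> m \<Longrightarrow> \<bar>\<Sum>n=1..k. g n\<bar> \<le> B"
  shows "\<bar>\<Sum>n=1..m. real n * g n\<bar> \<le> 2 * real m * B"
proof -
  have "(\<Sum>n=1..m. real n * g n) = real m * (\<Sum>n=1..m. g n) - (\<Sum>k<m. \<Sum>n=1..k. g n)"
    by (induction m) (auto simp: algebra_simps)
  also have "\<bar>\<dots>\<bar> \<le> \<bar>real m * (\<Sum>n=1..m. g n)\<bar> + \<bar>\<Sum>k<m. \<Sum>n=1..k. g n\<bar>" by simp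
  also have "\<bar>real m * (\<Sum>n=1..m. g n)\<bar> \<le> real m * B"
    unfolding abs_mult using assms[of m] by (intro mult_mono) auto
  also have "\<bar>\<Sum>k<m. \<Sum>n=1..k. g n\<bar> \<le> (\<Sum>k<m. B)"
    by (intro order_trans[OF sum_abs] sum_mono assms) auto
  finally show ?thesis by (simp add: mult_ac)
qed

text \<open>Each d comes with its own length u d, so Cauchy-Schwarz over n uses the weights 1/n and
  n: they make the inequality insensitive to scale, at the price of a harmonic sum. In the dual sum
  the diagonal contributes at most 1 for each d. Each other pair contributes at most 2 D^2 / Z by
  \<open>jac_pair_sum\<close>, which again totals at most 1 for each d, as Z \<ge> 2 D^3.\<close>

lemma large_sieve_exceptions:
  fixes S :: "nat set" and a :: "nat \<Rightarrow> real" and D Z \<delta> :: real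
  assumes fin: "finite S"
    and S: "\<And>d. d \<in> S \<Longrightarrow> odd d \<and> squarefree d \<and> real d \<le> D"
    and a: "\<And>n. \<bar>a n\<bar> \<le> 1"
    and u: "\<And>d. d \<in> S \<Longrightarrow> Z \<le> real (u d) \<and> u d \<le> N"
    and big: "\<And>d. d \<in> S \<Longrightarrow> \<bar>\<Sum>n=1..u d. a n * of_int (jac d (int n))\<bar> \<ge> \<delta> * real (u d)"
    and \<delta>: "\<delta> > 0" and Z: "Z > 0" "Z \<ge> 2 * D ^ 3" and card: "real (card S) \<le> D"
  shows "\<delta>\<^sup>2 * real (card S) \<le> 2 * (\<Sum>n=1..N. 1 / real n)"
proof (cases "S = {}")
  case True
  thus ?thesis by (simp add: sum_nonneg)
next
  case False
  have D: "D \<ge> 0" using card by linarith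
  define X where "X = (\<lambda>d n. real_of_int (jac d (int n)))"
  have X: "\<bar>X d n\<bar> \<le> 1" for d n
  proof -
    have "\<bar>X d n\<bar> = of_int \<bar>jac d (int n)\<bar>" by (simp add: X_def)
    also have "\<dots> \<le> of_int 1" by (subst of_int_le_iff) (rule abs_jac_le)
    finally show ?thesis by simp
  qed
  define T where "T = (\<lambda>d. \<Sum>n=1..u d. a n * X d n)"
  \<comment> \<open>The dual coefficients: the sign turns T d into its absolute value, and the
    division by the length makes every member of S contribute at least \<delta>.\<close>
  define c where "c = (\<lambda>d. sgn (T d) / real (u d))"
  have up: "real (u d) > 0" if "d \<in> S" for d using u[OF that] Z by linarith
  have c_abs: "\<bar>c d\<bar> \<le> 1 / real (u d)" if "d \<in> S" for d
    using up[OF that] by (simp add: c_def sgn_if divide_right_mono)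
  define g where "g = (\<lambda>n. \<Sum>d\<in>S. if n \<le> u d then c d * X d n else 0)"
  define Q where "Q = (\<lambda>d d'. \<Sum>n=1..N. real n * ((if n \<le> u d then X d n else 0) * (if n \<le> u d' then X d' n else 0)))"
  have "\<delta> * real (card S) = (\<Sum>d\<in>S. \<delta>)" by simp
  also have "\<dots> \<le> (\<Sum>d\<in>S. c d * T d)"
  proof (rule sum_mono)
    fix d assume d: "d \<in> S"
    have "c d * T d = \<bar>T d\<bar> / real (u d)" by (simp add: c_def abs_sgn mult.commute)
    moreover have "\<bar>T d\<bar> \<ge> \<delta> * real (u d)" using big[OF d] by (simp add: T_def X_def)
    ultimately show "\<delta> \<le> c d * T d" using up[OF d] by (simp only: pos_le_divide_eq)
  qed
  also have "\<dots> = (\<Sum>d\<in>S. \<Sum>n=1..N. a n * (if n \<le> u d then c d * X d n else 0))"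
  proof (rule sum.cong[OF refl])
    fix d assume d: "d \<in> S"
    have "T d = (\<Sum>n=1..N. if n \<le> u d then a n * X d n else 0)"
      unfolding T_def using u[OF d] by (intro sum.mono_neutral_cong_left) auto
    thus "c d * T d = (\<Sum>n=1..N. a n * (if n \<le> u d then c d * X d n else 0))"
      by (simp add: sum_distrib_left if_distrib mult_ac cong: if_cong)
  qed
  also have "\<dots> = (\<Sum>n=1..N. a n * g n)"
    unfolding g_def by (subst sum.swap) (simp add: sum_distrib_left)
  also have "\<dots> = (\<Sum>n=1..N. (a n / sqrt (real n)) * (sqrt (real n) * g n))"
    by (intro sum.cong refl) auto
  finally have lower: "\<delta> * real (card S) \<le> (\<Sum>n=1..N. (a n / sqrt (real n)) * (sqrt (real n) * g n))" .
  have "(\<delta> * real (card S))\<^sup>2 \<le> (\<Sum>n=1..N. (a n / sqrt (real n)) * (sqrt (real n) * g n))\<^sup>2"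
    by (rule power_mono[OF lower]) (use \<delta> in auto)
  also have "\<dots> \<le> (\<Sum>n=1..N. (a n / sqrt (real n))\<^sup>2) * (\<Sum>n=1..N. (sqrt (real n) * g n)\<^sup>2)"
    by (rule Cauchy_Schwarz_ineq_sum)
  also have "\<dots> \<le> (\<Sum>n=1..N. 1 / real n) * (2 * real (card S))"
  proof (rule mult_mono)
    show "(\<Sum>n=1..N. (a n / sqrt (real n))\<^sup>2) \<le> (\<Sum>n=1..N. 1 / real n)"
    proof (rule sum_mono)
      fix n
      have "(a n)\<^sup>2 \<le> 1" using a[of n] by (simp add: abs_square_le_1)
      thus "(a n / sqrt (real n))\<^sup>2 \<le> 1 / real n" by (simp add: power_divide divide_right_mono)
    qed
    have "(\<Sum>n=1..N. (sqrt (real n) * g n)\<^sup>2) = (\<Sum>n=1..N. \<Sum>d\<in>S. \<Sum>d'\<in>S. c d * c d' * (real n * ((if n \<le> u d then X d n else 0) * (if n \<le> u d' then X d' n else 0))))"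
    proof (rule sum.cong[OF refl])
      fix n
      have "(sqrt (real n) * g n)\<^sup>2 = real n * (g n * g n)" by (simp add: power_mult_distrib power2_eq_square)
      also have "g n * g n = (\<Sum>d\<in>S. \<Sum>d'\<in>S. (if n \<le> u d then c d * X d n else 0) * (if n \<le> u d' then c d' * X d' n else 0))"
        unfolding g_def by (rule sum_product)
      also have "real n * \<dots> = (\<Sum>d\<in>S. \<Sum>d'\<in>S. c d * c d' * (real n * ((if n \<le> u d then X d n else 0) * (if n \<le> u d' then X d' n else 0))))"
        unfolding sum_distrib_left by (intro sum.cong refl) (simp add: mult_ac)
      finally show "(sqrt (real n) * g n)\<^sup>2 = \<dots>" .
    qed
    also have "\<dots> = (\<Sum>d\<in>S. \<Sum>n=1..N. \<Sum>d'\<in>S. c d * c d' * (real n * ((if n \<le> u d then X d n else 0) * (if n \<le> u d' then X d' n else 0))))"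
      by (rule sum.swap)
    also have "\<dots> = (\<Sum>d\<in>S. \<Sum>d'\<in>S. c d * c d' * Q d d')"
      unfolding Q_def sum_distrib_left by (rule sum.cong[OF refl], rule sum.swap)
    also have "\<dots> \<le> (\<Sum>d\<in>S. \<Sum>d'\<in>S. (if d = d' then 1 else 0) + 2 * D\<^sup>2 / Z)"
    proof (intro sum_mono)
      fix d d' assume d: "d \<in> S" and d': "d' \<in> S"
      define m where "m = min (u d) (u d')"
      have Q: "Q d d' = (\<Sum>n=1..m. real n * (X d n * X d' n))"
        unfolding Q_def using u[OF d] by (intro sum.mono_neutral_cong_right) (auto simp: m_def)
      have cc: "\<bar>c d * c d'\<bar> \<le> 1 / (real (u d) * real (u d'))"
        using mult_mono[OF c_abs[OF d] c_abs[OF d']] by (simp add: abs_mult)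
      have "c d * c d' * Q d d' \<le> \<bar>c d * c d'\<bar> * \<bar>Q d d'\<bar>" by (metis abs_ge_self abs_mult)
      also have "\<dots> \<le> 1 / (real (u d) * real (u d')) * \<bar>Q d d'\<bar>" using cc by (rule mult_right_mono) simp
      also have "\<dots> \<le> (if d = d' then 1 else 0) + 2 * D\<^sup>2 / Z"
      proof (cases "d = d'")
        case True
        have "\<bar>Q d d'\<bar> \<le> (\<Sum>n=1..m. \<bar>real n * (X d n * X d' n)\<bar>)" unfolding Q by (rule sum_abs)
        also have "\<dots> \<le> (\<Sum>n=1..m. real (u d) * 1)"
        proof (rule sum_mono)
          fix n assume n: "n \<in> {1..m}"
          have "\<bar>X d n * X d' n\<bar> \<le> 1" using X by (simp add: abs_mult mult_le_one)
          thus "\<bar>real n * (X d n * X d' n)\<bar> \<le> real (u d) * 1"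
            using n unfolding abs_mult[of "real n"] by (intro mult_mono) (auto simp: m_def)
        qed
        also have "\<dots> = real (u d) * real (u d')" using True by (simp add: m_def)
        finally have "1 / (real (u d) * real (u d')) * \<bar>Q d d'\<bar> \<le> 1"
          using up[OF d] up[OF d'] by (simp add: field_simps)
        moreover have "2 * D\<^sup>2 / Z \<ge> 0" using Z by simp
        ultimately show ?thesis using True by simp
      next
        case False
        have "\<bar>Q d d'\<bar> \<le> 2 * real m * D\<^sup>2"
          unfolding Q
        proof (rule weighted_sum_bound)
          fix k
          have "\<bar>\<Sum>n=1..k. jac d (int n) * jac d' (int n)\<bar> \<le> int (d * d')"
            using S[OF d] S[OF d'] False by (intro jac_pair_sum) auto
          hence "real_of_int \<bar>\<Sum>n=1..k. jac d (int n) * jac d' (int n)\<bar> \<le> real_of_int (int (d * d'))"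
            by (simp only: of_int_le_iff)
          hence "\<bar>\<Sum>n=1..k. X d n * X d' n\<bar> \<le> real d * real d'" by (simp add: X_def)
          also have "\<dots> \<le> D * D" using S[OF d] S[OF d'] D by (intro mult_mono) auto
          finally show "\<bar>\<Sum>n=1..k. X d n * X d' n\<bar> \<le> D\<^sup>2" by (simp add: power2_eq_square)
        qed
        hence "1 / (real (u d) * real (u d')) * \<bar>Q d d'\<bar> \<le> 1 / (real (u d) * real (u d')) * (2 * real m * D\<^sup>2)"
          by (intro mult_left_mono) auto
        also have "\<dots> = 2 * D\<^sup>2 * (real m / (real (u d) * real (u d')))" by simp
        also have "real m / (real (u d) * real (u d')) \<le> 1 / Z"
        proof -
          \<comment> \<open>Since m is the smaller of the two lengths, this asks only that the
            larger one be at least Z.\<close>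
          have "real m * Z \<le> real (u d) * real (u d')"
          proof (cases "u d \<le> u d'")
            case True
            thus ?thesis using u[OF d'] Z by (auto simp: m_def intro!: mult_mono)
          next
            case False
            have "real (u d') * Z \<le> real (u d') * real (u d)" using u[OF d] by (intro mult_left_mono) auto
            thus ?thesis using False by (simp add: m_def mult.commute)
          qed
          thus ?thesis using up[OF d] up[OF d'] Z by (simp add: field_simps)
        qed
        finally show ?thesis using False by (simp add: mult_left_mono)
      qed
      finally show "c d * c d' * Q d d' \<le> (if d = d' then 1 else 0) + 2 * D\<^sup>2 / Z" .
    qed
    also have "\<dots> = real (card S) + real (card S) * (real (card S) * (2 * D\<^sup>2 / Z))"
      using fin by (simp add: sum.distrib algebra_simps)
    also have "\<dots> \<le> real (card S) + real (card S) * 1"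
    proof (intro add_left_mono mult_left_mono)
      have "real (card S) * (2 * D\<^sup>2 / Z) \<le> D * (2 * D\<^sup>2 / Z)" using card Z by (intro mult_right_mono) auto
      also have "\<dots> \<le> 1" using Z by (simp add: field_simps power2_eq_square power3_eq_cube)
      finally show "real (card S) * (2 * D\<^sup>2 / Z) \<le> 1" .
    qed auto
    finally show "(\<Sum>n=1..N. (sqrt (real n) * g n)\<^sup>2) \<le> 2 * real (card S)" by simp
  qed (auto intro!: sum_nonneg)
  finally have "(\<delta> * real (card S))\<^sup>2 \<le> (\<Sum>n=1..N. 1 / real n) * (2 * real (card S))" .
  hence "(\<delta>\<^sup>2 * real (card S)) * real (card S) \<le> (2 * (\<Sum>n=1..N. 1 / real n)) * real (card S)"
    by (simp add: power2_eq_square mult_ac)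
  moreover have "real (card S) > 0" using False fin by (simp add: card_gt_0_iff)
  ultimately show ?thesis by (simp only: mult_le_cancel_right_pos)
qed

text \<open>After expansion the diagonal gives J / p^2. For distinct primes the product of the
  symbols is \<open>jac (p * q)\<close>, whose sum over j is at most p q by
  \<open>jac_progression_sum\<close>; the weights 1 / (p q) reduce this to 1 for each pair.\<close>

lemma second_moment:
  fixes P :: "nat set"
  assumes fin: "finite P" and P: "\<And>p. p \<in> P \<Longrightarrow> prime p \<and> p > 2 \<and> coprime M p"
  shows "(\<Sum>j<J. (\<Sum>p\<in>P. of_int (Legendre (int (r + M * j)) (int p)) / real p)\<^sup>2)
           \<le> real J * (\<Sum>p\<in>P. 1 / (real p)\<^sup>2) + (real (card P))\<^sup>2"
proof -
  define L where "L = (\<lambda>p j. real_of_int (Legendre (int (r + M * j)) (int p)))"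
  have L: "\<bar>L p j\<bar> \<le> 1" for p j
  proof -
    have "\<bar>L p j\<bar> = of_int \<bar>Legendre (int (r + M * j)) (int p)\<bar>" by (simp add: L_def)
    also have "\<dots> \<le> of_int 1" by (subst of_int_le_iff) (rule abs_Legendre_le)
    finally show ?thesis by simp
  qed
  have "(\<Sum>j<J. (\<Sum>p\<in>P. L p j / real p)\<^sup>2) = (\<Sum>j<J. \<Sum>p\<in>P. \<Sum>q\<in>P. (L p j / real p) * (L q j / real q))"
    by (simp only: power2_eq_square sum_product)
  also have "\<dots> = (\<Sum>p\<in>P. \<Sum>j<J. \<Sum>q\<in>P. (L p j / real p) * (L q j / real q))" by (rule sum.swap)
  also have "\<dots> = (\<Sum>p\<in>P. \<Sum>q\<in>P. \<Sum>j<J. (L p j / real p) * (L q j / real q))"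
    by (rule sum.cong[OF refl], rule sum.swap)
  also have "\<dots> \<le> (\<Sum>p\<in>P. \<Sum>q\<in>P. (if p = q then real J / (real p)\<^sup>2 else 0) + 1)"
  proof (intro sum_mono)
    fix p q assume p: "p \<in> P" and q: "q \<in> P"
    have pos: "real p > 0" "real q > 0" using P[OF p] P[OF q] by auto
    have eq: "(\<Sum>j<J. (L p j / real p) * (L q j / real q)) = (\<Sum>j<J. L p j * L q j) / (real p * real q)"
      by (simp add: sum_divide_distrib)
    show "(\<Sum>j<J. (L p j / real p) * (L q j / real q)) \<le> (if p = q then real J / (real p)\<^sup>2 else 0) + 1"
    proof (cases "p = q")
      case True
      have "(\<Sum>j<J. L p j * L q j) \<le> (\<Sum>j<J. 1)"
      proof (rule sum_mono)
        fix j
        have "\<bar>L p j * L q j\<bar> \<le> 1" using L by (simp add: abs_mult mult_le_one)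
        thus "L p j * L q j \<le> 1" by linarith
      qed
      hence "(\<Sum>j<J. L p j * L q j) / (real p * real q) \<le> real J / (real p * real q)"
        using pos by (intro divide_right_mono) auto
      thus ?thesis unfolding eq using True by (simp add: power2_eq_square)
    next
      case False
      have pq: "prime p" "prime q" "p > 2" "q > 2" "coprime M p" "coprime M q" using P[OF p] P[OF q] by auto
      have cop: "coprime p q" using pq False primes_coprime by blast
      have fac: "prime_factors (p * q) = {p, q}"
        using pq by (auto simp: prime_factorization_mult prime_factorization_prime)
      have jac: "jac (p * q) x = Legendre x (int p) * Legendre x (int q)" for x
        using False unfolding jac_def fac by simp
      have "odd p" "odd q" using pq prime_odd_nat by blast+
      moreover have "squarefree (p * q)"
        using pq cop by (simp add: squarefree_mult_coprime squarefree_prime)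
      moreover have "p * q > 1" using less_1_mult[of p q] pq(3,4) by simp
      ultimately have "\<bar>\<Sum>j<J. jac (p * q) (int (r + M * j))\<bar> \<le> int (p * q)"
        using pq by (intro jac_progression_sum) auto
      hence "real_of_int \<bar>\<Sum>j<J. jac (p * q) (int (r + M * j))\<bar> \<le> real_of_int (int (p * q))"
        by (simp only: of_int_le_iff)
      hence "\<bar>\<Sum>j<J. L p j * L q j\<bar> \<le> real p * real q"
        by (simp add: L_def jac)
      hence "(\<Sum>j<J. L p j * L q j) / (real p * real q) \<le> 1" using pos by (simp add: field_simps)
      thus ?thesis unfolding eq using False by simp
    qed
  qed
  also have "\<dots> = real J * (\<Sum>p\<in>P. 1 / (real p)\<^sup>2) + (real (card P))\<^sup>2"
    using fin by (simp add: sum.distrib sum_distrib_left power2_eq_square)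
  finally show ?thesis by (simp add: L_def)
qed

text \<open>Telescoping with 1 / n^2 \<le> 1 / (n - 1) - 1 / n.\<close>

lemma sum_inverse_squares_le:
  assumes "y \<ge> 1"
  shows "(\<Sum>n\<in>{y<..s}. 1 / (real n)\<^sup>2) \<le> 1 / real y"
proof (cases "y \<le> s")
  case True
  have "(\<Sum>n\<in>{y<..s}. 1 / (real n)\<^sup>2) \<le> 1 / real y - 1 / real s"
    using True
  proof (induction s rule: dec_induct)
    case (step s)
    have "{y<..Suc s} = insert (Suc s) {y<..s}" using step by auto
    moreover have "1 / (real (Suc s))\<^sup>2 \<le> 1 / real s - 1 / real (Suc s)"
    proof -
      have s: "real s > 0" using step assms by simp
      have "1 / (real (Suc s))\<^sup>2 \<le> 1 / (real s * real (Suc s))"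
        using s by (intro divide_left_mono) (auto simp: power2_eq_square)
      also have "\<dots> = 1 / real s - 1 / real (Suc s)" using s by (simp add: field_simps)
      finally show ?thesis .
    qed
    ultimately show ?case using step by simp
  qed simp
  moreover have "1 / real s \<ge> 0" by simp
  ultimately show ?thesis by linarith
qed simp

text \<open>A prime whose square divides r + M j does not divide M, because r is coprime to M, so it
  lies in (y, s]. For each such p the index j is confined to one class modulo p^2, which has at most
  J / p^2 + 1 members.\<close>

lemma non_squarefree_count:
  assumes r: "coprime r M" "M > 0" and y: "y \<ge> 1" and sm: "\<And>p. prime p \<Longrightarrow> \<not> p dvd M \<Longrightarrow> p > y"
    and X: "\<And>j. j < J \<Longrightarrow> 0 < r + M * j \<and> r + M * j \<le> s\<^sup>2"
  shows "real (card {j. j < J \<and> \<not> squarefree (r + M * j)}) \<le> real J / real y + real s"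
proof -
  define B where "B = (\<lambda>p. {j. j < J \<and> p\<^sup>2 dvd r + M * j})"
  define Ps where "Ps = {p\<in>{y<..s}. prime p \<and> coprime p M}"
  have "{j. j < J \<and> \<not> squarefree (r + M * j)} \<subseteq> (\<Union>p\<in>Ps. B p)"
  proof
    fix j assume "j \<in> {j. j < J \<and> \<not> squarefree (r + M * j)}"
    hence j: "j < J" "\<not> squarefree (r + M * j)" by auto
    have n: "0 < r + M * j" "r + M * j \<le> s\<^sup>2" using X[OF j(1)] by auto
    obtain p where p: "prime p" "p\<^sup>2 dvd r + M * j"
      using j(2) n squarefree_factorial_semiring[of "r + M * j"] by auto
    have "p dvd r + M * j" using p(2) by (meson dvd_trans dvd_power zero_less_numeral)
    have "\<not> p dvd M"
    proof
      assume "p dvd M"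
      hence "p dvd r" using \<open>p dvd r + M * j\<close> by (simp add: dvd_add_left_iff)
      thus False using r \<open>p dvd M\<close> p(1) by (meson coprime_common_divisor not_prime_unit)
    qed
    moreover have "p\<^sup>2 \<le> s\<^sup>2" using p(2) n by (meson dvd_imp_le le_trans)
    hence "p \<le> s" by (simp add: power_mono_iff)
    ultimately have "p \<in> Ps" using sm p(1) prime_imp_coprime by (auto simp: Ps_def)
    thus "j \<in> (\<Union>p\<in>Ps. B p)" using j p by (auto simp: B_def)
  qed
  hence "card {j. j < J \<and> \<not> squarefree (r + M * j)} \<le> card (\<Union>p\<in>Ps. B p)"
    by (intro card_mono) (auto simp: Ps_def B_def)
  also have "\<dots> \<le> (\<Sum>p\<in>Ps. card (B p))" by (intro card_UN_le) (auto simp: Ps_def)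
  finally have "real (card {j. j < J \<and> \<not> squarefree (r + M * j)}) \<le> (\<Sum>p\<in>Ps. real (card (B p)))"
    by (metis of_nat_le_iff of_nat_sum)
  also have "\<dots> \<le> (\<Sum>p\<in>Ps. real J / (real p)\<^sup>2 + 1)"
  proof (rule sum_mono)
    fix p assume "p \<in> Ps"
    hence p: "p > 0" "coprime p M" by (auto simp: Ps_def)
    have "inj_on (\<lambda>j. j div p\<^sup>2) (B p)"
    proof (rule inj_onI)
      fix i j assume ij: "i \<in> B p" "j \<in> B p" "i div p\<^sup>2 = j div p\<^sup>2"
      have "[r + M * i = r + M * j] (mod p\<^sup>2)"
        using ij by (auto simp: B_def unique_euclidean_semiring_class.cong_def)
      hence "[M * i = M * j] (mod p\<^sup>2)" by (simp only: cong_add_lcancel_nat)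
      moreover have "coprime M (p\<^sup>2)" using p by (simp add: coprime_commute)
      ultimately have "[i = j] (mod p\<^sup>2)" by (simp only: cong_mult_lcancel_nat)
      hence "i mod p\<^sup>2 = j mod p\<^sup>2" by (simp only: unique_euclidean_semiring_class.cong_def)
      thus "i = j" using ij(3) by (metis div_mult_mod_eq)
    qed
    hence "card (B p) = card ((\<lambda>j. j div p\<^sup>2) ` B p)" by (simp add: card_image)
    also have "\<dots> \<le> card {..J div p\<^sup>2}" by (intro card_mono) (auto simp: B_def div_le_mono)
    finally have "real (card (B p)) \<le> real (J div p\<^sup>2) + 1" by simp
    also have "real (J div p\<^sup>2) \<le> real J / real (p\<^sup>2)" by (rule of_nat_div_le_of_nat)
    finally show "real (card (B p)) \<le> real J / (real p)\<^sup>2 + 1" by simp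
  qed
  also have "\<dots> \<le> (\<Sum>p\<in>{y<..s}. real J / (real p)\<^sup>2 + 1)"
    by (intro sum_mono2) (auto simp: Ps_def)
  also have "\<dots> = real J * (\<Sum>p\<in>{y<..s}. 1 / (real p)\<^sup>2) + real (s - y)"
    by (simp add: sum.distrib sum_distrib_left)
  also have "\<dots> \<le> real J * (1 / real y) + real s"
    using sum_inverse_squares_le[OF y, of s] by (intro add_mono mult_left_mono) auto
  finally show ?thesis by simp
qed

section \<open>Products of two primes and character sums\<close>

text \<open>Ordered pairs, so that sums can be taken over one prime at a time; the counted integers
  correspond to the pairs with p \<le> q.\<close>

definition PP :: "real \<Rightarrow> (nat \<times> nat) set" where
  "PP x = {(p, q). prime p \<and> prime q \<and> real (p * q) \<le> x}"

lemma PP_subset: "PP x \<subseteq> {p. prime p \<and> real p \<le> x} \<times> {q. prime q \<and> real q \<le> x}"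
proof
  fix z assume "z \<in> PP x"
  then obtain p q where z: "z = (p, q)" "prime p" "prime q" "real (p * q) \<le> x" by (auto simp: PP_def)
  have "p \<le> p * q" "q \<le> p * q" using z prime_gt_0_nat[of p] prime_gt_0_nat[of q] by auto
  hence "real p \<le> real (p * q)" "real q \<le> real (p * q)" by (simp_all only: of_nat_le_iff)
  thus "z \<in> {p. prime p \<and> real p \<le> x} \<times> {q. prime q \<and> real q \<le> x}" using z by auto
qed

lemma finite_PP [simp]: "finite (PP x)"
  by (rule finite_subset[OF PP_subset]) auto

lemma PP_swap: "(\<Sum>(p,q)\<in>PP x. f p q) = (\<Sum>(p,q)\<in>PP x. f q p)"
  by (intro sum.reindex_bij_witness[of _ prod.swap prod.swap]) (auto simp: PP_def mult.commute)

context
  fixes x :: real and P :: "nat \<Rightarrow> nat \<Rightarrow> bool"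
  assumes sym: "\<And>p q. P p q \<longleftrightarrow> P q p" and x0: "x \<ge> 0"
begin

private definition "Al = {(p, q) \<in> PP x. P p q \<and> p < q}"
private definition "Ag = {(p, q) \<in> PP x. P p q \<and> p > q}"
private definition "Ae = {(p, q) \<in> PP x. P p q \<and> p = q}"

private lemma finA: "finite Al" "finite Ag" "finite Ae"
  by (auto simp: Al_def Ag_def Ae_def intro: finite_subset[OF _ finite_PP[of x]])

private lemma card_A: "card {(p, q) \<in> PP x. P p q} = 2 * card Al + card Ae"
proof -
  have "{(p, q) \<in> PP x. P p q} = (Al \<union> Ag) \<union> Ae" by (auto simp: Al_def Ag_def Ae_def)
  also have "card \<dots> = card Al + card Ag + card Ae"
    by (subst card_Un_disjoint, use finA in \<open>auto simp: Al_def Ag_def Ae_def\<close>)+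
  also have "card Ag = card Al"
    by (rule bij_betw_same_card[of prod.swap], rule bij_betwI[of _ _ _ prod.swap])
       (use sym in \<open>auto simp: Al_def Ag_def PP_def mult.commute\<close>)
  finally show ?thesis by simp
qed

private lemma count_set: "{n. real n \<le> x \<and> (\<exists>p q. prime p \<and> prime q \<and> n = p * q \<and> P p q)} = (\<lambda>(p, q). p * q) ` (Al \<union> Ae)"
proof (intro equalityI subsetI)
  fix n assume "n \<in> {n. real n \<le> x \<and> (\<exists>p q. prime p \<and> prime q \<and> n = p * q \<and> P p q)}"
  then obtain p q where pq: "real n \<le> x" "prime p" "prime q" "n = p * q" "P p q" by auto
  show "n \<in> (\<lambda>(p, q). p * q) ` (Al \<union> Ae)"
  proof (cases "p \<le> q")
    case True
    thus ?thesis using pq by (intro image_eqI[of _ _ "(p, q)"]) (auto simp: Al_def Ae_def PP_def)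
  next
    case False
    thus ?thesis using pq sym by (intro image_eqI[of _ _ "(q, p)"]) (auto simp: Al_def Ae_def PP_def mult.commute)
  qed
qed (auto simp: Al_def Ae_def PP_def; blast)

private lemma card_Ae: "real (card Ae) \<le> sqrt x"
proof -
  have "card Ae \<le> card {1..nat \<lfloor>sqrt x\<rfloor>}"
  proof (rule card_inj_on_le[of fst])
    show "inj_on fst Ae" by (auto simp: inj_on_def Ae_def)
    show "fst ` Ae \<subseteq> {1..nat \<lfloor>sqrt x\<rfloor>}"
    proof
      fix p assume "p \<in> fst ` Ae"
      hence "prime p" "real (p * p) \<le> x" by (auto simp: Ae_def PP_def)
      moreover from this have "real p \<le> sqrt x" by (intro real_le_rsqrt) (simp add: power2_eq_square)
      ultimately show "p \<in> {1..nat \<lfloor>sqrt x\<rfloor>}" using prime_gt_0_nat[of p] by (auto simp: le_nat_floor)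
    qed
  qed simp
  hence "real (card Ae) \<le> real (nat \<lfloor>sqrt x\<rfloor>)" by simp
  also have "\<dots> \<le> sqrt x" using x0 by (intro of_nat_floor) simp
  finally show ?thesis .
qed

text \<open>Off the diagonal a product arises from two ordered pairs, on the diagonal from one.
  Doubling therefore overcounts only the squares p^2, of which there are at most sqrt x.\<close>

lemma prime_product_count_le_pairs: "2 * real (prime_product_count x P) \<le> real (card {(p, q) \<in> PP x. P p q}) + sqrt x"
proof -
  have "prime_product_count x P \<le> card (Al \<union> Ae)"
    unfolding prime_product_count_def count_set by (rule card_image_le) (use finA in auto)
  also have "\<dots> \<le> card Al + card Ae" by (rule card_Un_le)
  finally have "2 * real (prime_product_count x P) \<le> real (2 * card Al + card Ae) + real (card Ae)" by linarith
  thus ?thesis using card_Ae unfolding card_A by linarith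
qed

text \<open>Unique factorisation: among the pairs with p \<le> q the product determines the
  pair.\<close>

lemma pairs_le_prime_product_count: "real (card {(p, q) \<in> PP x. P p q}) \<le> 2 * real (prime_product_count x P)"
proof -
  have "inj_on (\<lambda>(p, q). p * q) (Al \<union> Ae)"
  proof (rule inj_onI)
    fix u v assume u: "u \<in> Al \<union> Ae" and v: "v \<in> Al \<union> Ae" and eq: "(\<lambda>(p, q). p * q) u = (\<lambda>(p, q). p * q) v"
    obtain p q where pq: "u = (p, q)" "prime p" "prime q" "p \<le> q" using u by (auto simp: Al_def Ae_def PP_def)
    obtain p' q' where pq': "v = (p', q')" "prime p'" "prime q'" "p' \<le> q'" using v by (auto simp: Al_def Ae_def PP_def)
    have e: "p * q = p' * q'" using eq pq pq' by simp
    have "p dvd p' * q'" by (metis e dvd_triv_left)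
    hence 1: "p = p' \<or> p = q'" using pq pq' by (metis prime_dvd_mult_iff primes_dvd_imp_eq)
    have "p' dvd p * q" by (metis e dvd_triv_left)
    hence 2: "p' = p \<or> p' = q" using pq pq' by (metis prime_dvd_mult_iff primes_dvd_imp_eq)
    have "p = p'" using 1 2 pq(4) pq'(4) by auto
    thus "u = v" using e pq pq' prime_gt_0_nat[of p] by auto
  qed
  hence "prime_product_count x P = card (Al \<union> Ae)"
    unfolding prime_product_count_def count_set by (rule card_image)
  also have "\<dots> = card Al + card Ae"
    by (rule card_Un_disjoint) (use finA in \<open>auto simp: Al_def Ae_def\<close>)
  finally show ?thesis unfolding card_A by simp
qed

end

text \<open>The product formula for the indicator is summed over ordered pairs, where the two mixed
  terms agree by symmetry; passing to integers halves everything and leaves the mixed sum with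
  coefficient 1. The absolute values record that the other prime must not divide the
  conductor.\<close>

lemma character_pair_inequality:
  fixes X :: "nat \<Rightarrow> real" and e :: real
  assumes x: "x \<ge> 0" and X: "\<And>n. X n \<in> {-1, 0, 1}" and e: "e \<in> {-1, 1}"
  shows "4 * real (prime_product_count x (\<lambda>p q. X p = e \<and> X q = e)) \<le>
           real (prime_product_count x (\<lambda>p q. X p \<noteq> 0 \<and> X q \<noteq> 0)) +
           e * (\<Sum>(p,q)\<in>PP x. X p * \<bar>X q\<bar>) + 1 / 2 * (\<Sum>(p,q)\<in>PP x. X p * X q) + 2 * sqrt x"
proof -
  define N2 where "N2 = real (card {(p, q) \<in> PP x. X p = e \<and> X q = e})"
  define T2 where "T2 = real (card {(p, q) \<in> PP x. X p \<noteq> 0 \<and> X q \<noteq> 0})"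
  define S1 where "S1 = (\<Sum>(p,q)\<in>PP x. X p * \<bar>X q\<bar>)"
  define S2 where "S2 = (\<Sum>(p,q)\<in>PP x. X p * X q)"
  have ind: "real (card {(p, q) \<in> PP x. R p q}) = (\<Sum>(p,q)\<in>PP x. if R p q then 1 else 0)" for R
  proof -
    have "{(p, q) \<in> PP x. R p q} = {z \<in> PP x. case z of (p, q) \<Rightarrow> R p q}" by auto
    hence "real (card {(p, q) \<in> PP x. R p q}) = (\<Sum>z\<in>PP x. if (case z of (p, q) \<Rightarrow> R p q) then 1 else 0)"
      by (simp add: sum.If_cases Int_def)
    thus ?thesis by (simp add: case_prod_unfold)
  qed
  have "4 * N2 = (\<Sum>(p,q)\<in>PP x. (if X p \<noteq> 0 \<and> X q \<noteq> 0 then 1 else 0) + e * (X p * \<bar>X q\<bar>) + e * (X q * \<bar>X p\<bar>) + X p * X q)"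
    unfolding N2_def ind sum_distrib_left
  proof (intro sum.cong refl, clarify)
    fix p q
    show "4 * (if X p = e \<and> X q = e then 1 else 0) =
          (if X p \<noteq> 0 \<and> X q \<noteq> 0 then 1 else 0) + e * (X p * \<bar>X q\<bar>) + e * (X q * \<bar>X p\<bar>) + X p * X q"
      using X[of p] X[of q] e by auto
  qed
  also have "\<dots> = T2 + e * S1 + e * (\<Sum>(p,q)\<in>PP x. X q * \<bar>X p\<bar>) + S2"
    unfolding T2_def ind S1_def S2_def by (simp add: case_prod_unfold sum.distrib sum_distrib_left)
  also have "(\<Sum>(p,q)\<in>PP x. X q * \<bar>X p\<bar>) = S1" unfolding S1_def by (rule PP_swap)
  finally have "4 * N2 = T2 + 2 * e * S1 + S2" by simp
  moreover have "2 * real (prime_product_count x (\<lambda>p q. X p = e \<and> X q = e)) \<le> N2 + sqrt x"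
    unfolding N2_def by (rule prime_product_count_le_pairs) (use x in auto)
  moreover have "T2 \<le> 2 * real (prime_product_count x (\<lambda>p q. X p \<noteq> 0 \<and> X q \<noteq> 0))"
    unfolding T2_def by (rule pairs_le_prime_product_count) (use x in auto)
  ultimately show ?thesis unfolding S1_def[symmetric] S2_def[symmetric] by linarith
qed

section \<open>Character sums over pairs of primes\<close>

lemma harmonic_sum_le: "N \<ge> 1 \<Longrightarrow> (\<Sum>n=1..N. 1 / real n) \<le> 1 + ln (real N)"
proof (induction N rule: dec_induct)
  case (step N)
  have "ln (real N) - ln (real (Suc N)) \<le> (real N - real (Suc N)) / real (Suc N)"
    using step by (intro ln_diff_le) auto
  hence "1 / real (Suc N) \<le> ln (real (Suc N)) - ln (real N)" by simp
  thus ?case using step by simp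
qed simp

lemma sum_prime_reciprocal_le:
  assumes "y \<ge> 1"
  shows "(\<Sum>q | prime q \<and> real q \<le> y. 1 / real q) \<le> 1 + ln y"
proof -
  define N where "N = nat \<lfloor>y\<rfloor>"
  have N: "N \<ge> 1" "real N \<le> y" using assms unfolding N_def by linarith+
  have "(\<Sum>q | prime q \<and> real q \<le> y. 1 / real q) \<le> (\<Sum>n=1..N. 1 / real n)"
    by (rule sum_mono2) (auto simp: N_def le_nat_floor dest: prime_gt_0_nat)
  also have "\<dots> \<le> 1 + ln (real N)" by (rule harmonic_sum_le[OF N(1)])
  also have "ln (real N) \<le> ln y" using N by simp
  finally show ?thesis by simp
qed

text \<open>For fixed q the primes p in (Z, x / q] give a difference of two initial sums, each at
  most \<delta> x / q; summing 1 / q over q costs the factor 1 + ln x.\<close>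

lemma pair_tail_bound:
  fixes X b :: "nat \<Rightarrow> real"
  assumes Z: "1 \<le> Z" "Z \<le> x" and \<delta>: "\<delta> \<ge> 0" and b: "\<And>q. \<bar>b q\<bar> \<le> 1"
    and G: "\<And>u. Z \<le> u \<Longrightarrow> u \<le> x \<Longrightarrow> \<bar>\<Sum>p | prime p \<and> real p \<le> u. X p\<bar> \<le> \<delta> * u"
  shows "\<bar>\<Sum>(p,q)\<in>{(p, q) \<in> PP x. real p > Z}. X p * b q\<bar> \<le> 2 * \<delta> * x * (1 + ln x)"
proof -
  define Q where "Q = {q. prime q \<and> real q \<le> x / Z}"
  have finQ: "finite Q" by (simp add: Q_def)
  define R where "R = (\<lambda>q. {p. prime p \<and> Z < real p \<and> real p \<le> x / real q})"
  have finR: "finite (R q)" for q by (rule finite_subset[of _ "{p. real p \<le> x / real q}"]) (auto simp: R_def)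
  have "(\<Sum>(p,q)\<in>{(p, q) \<in> PP x. real p > Z}. X p * b q) = (\<Sum>(q,p)\<in>Sigma Q R. X p * b q)"
  proof (rule sum.reindex_bij_witness[of _ prod.swap prod.swap])
    fix z assume z: "z \<in> {(p, q) \<in> PP x. Z < real p}"
    then obtain p q where pq: "z = (p, q)" "prime p" "prime q" "real (p * q) \<le> x" "Z < real p" by (auto simp: PP_def)
    have q0: "real q > 0" using pq(3) prime_gt_0_nat by simp
    have "real q * Z \<le> real q * real p" using pq q0 by simp
    hence "real q \<le> x / Z" using pq Z by (simp add: field_simps)
    moreover have "real p \<le> x / real q" using pq q0 by (simp add: field_simps)
    ultimately show "prod.swap z \<in> Sigma Q R" using pq by (simp add: Q_def R_def)
  next
    fix z assume "z \<in> Sigma Q R"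
    then obtain p q where pq: "z = (q, p)" "prime p" "prime q" "real p \<le> x / real q" "Z < real p"
      by (auto simp: Q_def R_def)
    have "real q > 0" using pq(3) prime_gt_0_nat by simp
    thus "prod.swap z \<in> {(p, q) \<in> PP x. Z < real p}" using pq by (simp add: PP_def field_simps)
  qed auto
  also have "\<dots> = (\<Sum>q\<in>Q. \<Sum>p\<in>R q. X p * b q)" by (rule sum.Sigma[symmetric]) (use finQ finR in auto)
  also have "\<bar>\<dots>\<bar> \<le> (\<Sum>q\<in>Q. 2 * \<delta> * x * (1 / real q))"
  proof (rule order_trans[OF sum_abs], rule sum_mono)
    fix q assume q: "q \<in> Q"
    have q0: "real q > 0" "prime q" using q prime_gt_0_nat by (auto simp: Q_def)
    have q1: "real q \<ge> 1" using q0 by simp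
    have Zq: "Z \<le> x / real q" using q q0 Z by (simp add: Q_def field_simps)
    have "x / real q \<le> x" using q1 Z by (simp add: field_simps mult_le_cancel_left1)
    define A where "A = {p. prime p \<and> real p \<le> x / real q}"
    define B where "B = {p. prime p \<and> real p \<le> Z}"
    have "A = B \<union> R q" "B \<inter> R q = {}" using Zq by (auto simp: A_def B_def R_def)
    hence "(\<Sum>p\<in>A. X p) = (\<Sum>p\<in>B. X p) + (\<Sum>p\<in>R q. X p)"
      using finR by (simp add: sum.union_disjoint B_def)
    moreover have "\<bar>\<Sum>p\<in>A. X p\<bar> \<le> \<delta> * (x / real q)" unfolding A_def by (rule G[OF Zq \<open>x / real q \<le> x\<close>])
    moreover have "\<bar>\<Sum>p\<in>B. X p\<bar> \<le> \<delta> * Z" unfolding B_def using Z by (intro G) auto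
    moreover have "\<delta> * Z \<le> \<delta> * (x / real q)" using Zq \<delta> by (rule mult_left_mono)
    ultimately have s: "\<bar>\<Sum>p\<in>R q. X p\<bar> \<le> 2 * (\<delta> * (x / real q))" by linarith
    have "\<bar>\<Sum>p\<in>R q. X p * b q\<bar> = \<bar>\<Sum>p\<in>R q. X p\<bar> * \<bar>b q\<bar>" by (simp add: abs_mult flip: sum_distrib_right)
    also have "\<dots> \<le> 2 * (\<delta> * (x / real q)) * 1" using s b by (intro mult_mono) auto
    finally show "\<bar>\<Sum>p\<in>R q. X p * b q\<bar> \<le> 2 * \<delta> * x * (1 / real q)" by simp
  qed
  also have "\<dots> = 2 * \<delta> * x * (\<Sum>q\<in>Q. 1 / real q)" by (simp add: sum_distrib_left)
  also have "\<dots> \<le> 2 * \<delta> * x * (1 + ln x)"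
  proof (intro mult_left_mono)
    have "(\<Sum>q\<in>Q. 1 / real q) \<le> 1 + ln (x / Z)"
      unfolding Q_def using Z by (intro sum_prime_reciprocal_le) auto
    also have "ln (x / Z) \<le> ln x" using Z by (simp add: field_simps mult_le_cancel_left1)
    finally show "(\<Sum>q\<in>Q. 1 / real q) \<le> 1 + ln x" by simp
  qed (use \<delta> Z in auto)
  finally show ?thesis .
qed

lemma sum_PP_split:
  "(\<Sum>(p,q)\<in>PP x. f p q) = (\<Sum>(p,q)\<in>{(p, q) \<in> PP x. real p > Z}. f p q) + (\<Sum>(p,q)\<in>{(p, q) \<in> PP x. real p \<le> Z}. f p q)"
proof -
  have "PP x = {(p, q) \<in> PP x. real p > Z} \<union> {(p, q) \<in> PP x. real p \<le> Z}" by auto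
  moreover have "finite {(p, q) \<in> PP x. real p > Z}" "finite {(p, q) \<in> PP x. real p \<le> Z}"
    by (auto intro: finite_subset[OF _ finite_PP[of x]])
  ultimately show ?thesis by (subst sum.union_disjoint[symmetric]) auto
qed

text \<open>Pairs with p > Z fall under \<open>pair_tail_bound\<close>. For p \<le> Z the two primes
  exchange roles, with \<open>b\<close> cutting the symbol off at Z so that the same bound applies
  again; at most Z^2 pairs with both primes small remain.\<close>

lemma pair_sum_chi_chi:
  fixes X :: "nat \<Rightarrow> real"
  assumes Z: "1 \<le> Z" "Z \<le> x" and \<delta>: "\<delta> \<ge> 0" and X: "\<And>q. \<bar>X q\<bar> \<le> 1"
    and G: "\<And>u. Z \<le> u \<Longrightarrow> u \<le> x \<Longrightarrow> \<bar>\<Sum>p | prime p \<and> real p \<le> u. X p\<bar> \<le> \<delta> * u"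
  shows "\<bar>\<Sum>(p,q)\<in>PP x. X p * X q\<bar> \<le> 4 * \<delta> * x * (1 + ln x) + Z\<^sup>2"
proof -
  define b where "b = (\<lambda>q. if real q \<le> Z then X q else 0)"
  have fin: "finite {(p, q) \<in> PP x. R p q}" for R by (auto intro: finite_subset[OF _ finite_PP[of x]])
  have 1: "\<bar>\<Sum>(p,q)\<in>{(p, q) \<in> PP x. real p > Z}. X p * X q\<bar> \<le> 2 * \<delta> * x * (1 + ln x)"
    by (rule pair_tail_bound[OF Z \<delta> X G])
  have 2: "\<bar>\<Sum>(p,q)\<in>{(p, q) \<in> PP x. real p > Z}. X p * b q\<bar> \<le> 2 * \<delta> * x * (1 + ln x)"
    by (rule pair_tail_bound[OF Z \<delta> _ G]) (use X in \<open>auto simp: b_def\<close>)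
  define C where "C = {(p, q) \<in> PP x. real p \<le> Z \<and> real q \<le> Z}"
  have "(\<Sum>(p,q)\<in>{(p, q) \<in> PP x. real p \<le> Z}. X p * X q) = (\<Sum>(p,q)\<in>PP x. b p * X q)"
    by (intro sum.mono_neutral_cong_left) (auto simp: b_def split: if_splits)
  also have "\<dots> = (\<Sum>(p,q)\<in>PP x. X p * b q)" by (subst PP_swap) (simp add: mult.commute)
  also have "\<dots> = (\<Sum>(p,q)\<in>{(p, q) \<in> PP x. real p > Z}. X p * b q) + (\<Sum>(p,q)\<in>{(p, q) \<in> PP x. real p \<le> Z}. X p * b q)"
    by (rule sum_PP_split)
  also have "(\<Sum>(p,q)\<in>{(p, q) \<in> PP x. real p \<le> Z}. X p * b q) = (\<Sum>(p,q)\<in>C. X p * X q)"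
    by (rule sum.mono_neutral_cong_right) (use fin in \<open>auto simp: b_def C_def split: if_splits\<close>)
  finally have 3: "(\<Sum>(p,q)\<in>{(p, q) \<in> PP x. real p \<le> Z}. X p * X q) =
    (\<Sum>(p,q)\<in>{(p, q) \<in> PP x. real p > Z}. X p * b q) + (\<Sum>(p,q)\<in>C. X p * X q)" .
  have 4: "\<bar>\<Sum>(p,q)\<in>C. X p * X q\<bar> \<le> Z\<^sup>2"
  proof -
    have "\<bar>\<Sum>(p,q)\<in>C. X p * X q\<bar> \<le> (\<Sum>z\<in>C. 1)"
    proof (intro order_trans[OF sum_abs] sum_mono)
      fix z assume "z \<in> C"
      show "\<bar>case z of (p, q) \<Rightarrow> X p * X q\<bar> \<le> 1" using X by (cases z) (simp add: abs_mult mult_le_one)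
    qed
    also have "\<dots> = real (card C)" by simp
    also have "card C \<le> card ({1..nat \<lfloor>Z\<rfloor>} \<times> {1..nat \<lfloor>Z\<rfloor>})"
      by (intro card_mono) (auto simp: C_def PP_def le_nat_floor dest: prime_gt_0_nat)
    hence "real (card C) \<le> real (nat \<lfloor>Z\<rfloor>) * real (nat \<lfloor>Z\<rfloor>)" by (simp flip: of_nat_mult)
    also have "\<dots> \<le> Z * Z" using Z by (intro mult_mono) (auto simp: of_nat_floor)
    finally show ?thesis by (simp add: power2_eq_square)
  qed
  show ?thesis using 1 2 3 4 sum_PP_split[of "\<lambda>p q. X p * X q" x Z] by linarith
qed

text \<open>For p \<le> Z the inner sum of |X q| is \<open>pi_fun (x / real p)\<close> less the
  number of primes that divide d, which is at most d.\<close>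

lemma pair_sum_chi_abs:
  fixes X :: "nat \<Rightarrow> real"
  assumes Z: "1 \<le> Z" "Z \<le> x" and \<delta>: "\<delta> \<ge> 0" and X: "\<And>q. X q \<in> {-1, 0, 1}" and d: "d > 0"
    and zero: "\<And>q. prime q \<Longrightarrow> X q = 0 \<Longrightarrow> q dvd d"
    and G: "\<And>u. Z \<le> u \<Longrightarrow> u \<le> x \<Longrightarrow> \<bar>\<Sum>p | prime p \<and> real p \<le> u. X p\<bar> \<le> \<delta> * u"
  shows "\<bar>(\<Sum>(p,q)\<in>PP x. X p * \<bar>X q\<bar>) - (\<Sum>p | prime p \<and> real p \<le> Z. X p * pi_fun (x / real p))\<bar>
           \<le> 2 * \<delta> * x * (1 + ln x) + Z * real d"
proof -
  have Xabs: "\<bar>X q\<bar> \<le> 1" for q using X[of q] by auto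
  have 1: "\<bar>\<Sum>(p,q)\<in>{(p, q) \<in> PP x. real p > Z}. X p * \<bar>X q\<bar>\<bar> \<le> 2 * \<delta> * x * (1 + ln x)"
    by (rule pair_tail_bound[OF Z \<delta> _ G]) (use Xabs in auto)
  define A where "A = {p. prime p \<and> real p \<le> Z}"
  define R where "R = (\<lambda>p. {q. prime q \<and> real q \<le> x / real p})"
  have finA: "finite A" "finite (R p)" for p by (auto simp: A_def R_def)
  have set_eq: "{(p, q) \<in> PP x. real p \<le> Z} = Sigma A R"
  proof -
    have "real (p * q) \<le> x \<longleftrightarrow> real q \<le> x / real p" if "prime p" for p q
      using prime_gt_0_nat[OF that] by (simp add: field_simps)
    thus ?thesis by (auto simp: PP_def A_def R_def)
  qed
  have "(\<Sum>(p,q)\<in>{(p, q) \<in> PP x. real p \<le> Z}. X p * \<bar>X q\<bar>) = (\<Sum>p\<in>A. \<Sum>q\<in>R p. X p * \<bar>X q\<bar>)"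
    unfolding set_eq by (rule sum.Sigma[symmetric]) (use finA in auto)
  also have "\<dots> = (\<Sum>p\<in>A. X p * (\<Sum>q\<in>R p. \<bar>X q\<bar>))" by (simp add: sum_distrib_left)
  finally have 2: "(\<Sum>(p,q)\<in>{(p, q) \<in> PP x. real p \<le> Z}. X p * \<bar>X q\<bar>) = \<dots>" .
  have 3: "\<bar>(\<Sum>p\<in>A. X p * (\<Sum>q\<in>R p. \<bar>X q\<bar>)) - (\<Sum>p\<in>A. X p * pi_fun (x / real p))\<bar> \<le> Z * real d"
  proof -
    have "(\<Sum>p\<in>A. X p * (\<Sum>q\<in>R p. \<bar>X q\<bar>)) - (\<Sum>p\<in>A. X p * pi_fun (x / real p)) =
          (\<Sum>p\<in>A. X p * ((\<Sum>q\<in>R p. \<bar>X q\<bar>) - pi_fun (x / real p)))"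
      by (simp add: sum_subtractf right_diff_distrib)
    also have "\<bar>\<dots>\<bar> \<le> (\<Sum>p\<in>A. real d)"
    proof (intro order_trans[OF sum_abs] sum_mono)
      fix p assume p: "p \<in> A"
      have "(\<Sum>q\<in>R p. \<bar>X q\<bar>) - pi_fun (x / real p) = (\<Sum>q\<in>R p. \<bar>X q\<bar> - 1)"
        using finA by (simp add: pi_fun_def R_def sum_subtractf)
      also have "\<dots> = (\<Sum>q\<in>{q\<in>R p. X q = 0}. -1)"
      proof (rule sum.mono_neutral_cong_right)
        show "\<forall>q\<in>R p - {q \<in> R p. X q = 0}. \<bar>X q\<bar> - 1 = 0"
        proof
          fix q assume "q \<in> R p - {q \<in> R p. X q = 0}"
          thus "\<bar>X q\<bar> - 1 = 0" using X[of q] by auto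
        qed
      qed (use finA in auto)
      also have "\<dots> = -real (card {q\<in>R p. X q = 0})" by simp
      finally have eq: "\<bar>(\<Sum>q\<in>R p. \<bar>X q\<bar>) - pi_fun (x / real p)\<bar> = real (card {q\<in>R p. X q = 0})" by simp
      have "card {q\<in>R p. X q = 0} \<le> card {1..d}"
      proof (intro card_mono subsetI)
        fix q assume "q \<in> {q\<in>R p. X q = 0}"
        hence "prime q" "q dvd d" using zero by (auto simp: R_def)
        thus "q \<in> {1..d}" using d prime_gt_0_nat[of q] by (auto dest: dvd_imp_le)
      qed simp
      hence "real (card {q\<in>R p. X q = 0}) \<le> real d" by simp
      with eq have "\<bar>(\<Sum>q\<in>R p. \<bar>X q\<bar>) - pi_fun (x / real p)\<bar> \<le> real d" by simp
      hence "\<bar>X p\<bar> * \<bar>(\<Sum>q\<in>R p. \<bar>X q\<bar>) - pi_fun (x / real p)\<bar> \<le> 1 * real d"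
        using Xabs by (intro mult_mono) auto
      thus "\<bar>X p * ((\<Sum>q\<in>R p. \<bar>X q\<bar>) - pi_fun (x / real p))\<bar> \<le> real d" by (simp add: abs_mult)
    qed
    also have "\<dots> = real (card A) * real d" by simp
    also have "\<dots> \<le> Z * real d"
    proof (intro mult_right_mono)
      have "card A \<le> card {1..nat \<lfloor>Z\<rfloor>}"
        by (intro card_mono) (auto simp: A_def le_nat_floor dest: prime_gt_0_nat)
      hence "real (card A) \<le> real (nat \<lfloor>Z\<rfloor>)" by simp
      also have "\<dots> \<le> Z" using Z by (intro of_nat_floor) simp
      finally show "real (card A) \<le> Z" .
    qed simp
    finally show ?thesis .
  qed
  show ?thesis using 1 2 3 sum_PP_split[of "\<lambda>p q. X p * \<bar>X q\<bar>" x Z] unfolding A_def[symmetric] by linarith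
qed

section \<open>Evaluating pi(x / p) by the prime number theorem\<close>

lemma prime_product_count_le_pi_sum:
  assumes "x \<ge> 0"
  shows "real (prime_product_count x R) \<le> (\<Sum>p | prime p \<and> real p \<le> sqrt x. pi_fun (x / real p))"
proof -
  define A where "A = {p. prime p \<and> real p \<le> sqrt x}"
  define Q where "Q = (\<lambda>p. {q. prime q \<and> real q \<le> x / real p})"
  have fin: "finite A" "finite (Q p)" for p by (auto simp: A_def Q_def)
  have "{n. real n \<le> x \<and> (\<exists>p q. prime p \<and> prime q \<and> n = p * q \<and> R p q)} \<subseteq> (\<lambda>(p, q). p * q) ` Sigma A Q"
  proof
    fix n assume "n \<in> {n. real n \<le> x \<and> (\<exists>p q. prime p \<and> prime q \<and> n = p * q \<and> R p q)}"
    then obtain p q where pq: "real n \<le> x" "prime p" "prime q" "n = p * q" by auto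
    have main: "n \<in> (\<lambda>(p, q). p * q) ` Sigma A Q" if "prime p" "prime q" "n = p * q" "p \<le> q" for p q
    proof -
      have "p * p \<le> n" using that by simp
      hence "real (p * p) \<le> x" using pq(1) by linarith
      hence "real p \<le> sqrt x" by (intro real_le_rsqrt) (simp add: power2_eq_square)
      moreover have "real q \<le> x / real p" using that pq(1) prime_gt_0_nat[of p] by (simp add: field_simps)
      ultimately show ?thesis using that by (intro image_eqI[of _ _ "(p, q)"]) (auto simp: A_def Q_def)
    qed
    show "n \<in> (\<lambda>(p, q). p * q) ` Sigma A Q"
      using main[of p q] main[of q p] pq by (cases "p \<le> q") (auto simp: mult.commute)
  qed
  hence "prime_product_count x R \<le> card ((\<lambda>(p, q). p * q) ` Sigma A Q)"
    unfolding prime_product_count_def using fin by (intro card_mono) auto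
  also have "\<dots> \<le> card (Sigma A Q)" using fin by (intro card_image_le) auto
  also have "\<dots> = (\<Sum>p\<in>A. card (Q p))" using fin by simp
  finally have "real (prime_product_count x R) \<le> real (\<Sum>p\<in>A. card (Q p))" by (simp only: of_nat_le_iff)
  thus ?thesis by (simp add: A_def Q_def pi_fun_def)
qed

text \<open>As x / t \<ge> sqrt x, both ln and ln ln of x / t are at least half of their values at
  x. The last estimate keeps ln (x / t), because for t near sqrt x this is not close to ln
  x.\<close>

lemma pi_fun_scaled:
  "\<exists>K\<ge>0. \<forall>\<^sub>F x in at_top. \<forall>t. 1 \<le> t \<and> t \<le> sqrt x \<longrightarrow>
     \<bar>pi_fun (x / t) - (x / t) / ln (x / t)\<bar> \<le> K * (x / t) / (ln x * ln (ln x)) \<and>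
     ln x / 2 \<le> ln (x / t) \<and> pi_fun (x / t) \<le> (x / t) / ln (x / t) * (1 + K / ln (ln x))"
proof -
  obtain K where K: "K \<ge> 0" "\<forall>\<^sub>F x in at_top. \<bar>pi_fun x - x / ln x\<bar> \<le> K * x / (ln x * ln (ln x))"
    using prime_number_theorem_pi by blast
  then obtain x1 where x1: "\<And>x. x \<ge> x1 \<Longrightarrow> \<bar>pi_fun x - x / ln x\<bar> \<le> K * x / (ln x * ln (ln x))"
    by (auto simp: eventually_at_top_linorder)
  have e1: "\<forall>\<^sub>F x::real in at_top. sqrt x \<ge> x1"
    by (rule filterlim_at_top[THEN iffD1, rule_format, OF sqrt_at_top])
  have e2: "\<forall>\<^sub>F x::real in at_top. x > 1 \<and> ln x > 2 \<and> ln (ln x) > 2 \<and> ln (ln x) / 2 \<le> ln (ln x / 2)"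
    by (intro eventually_conj; real_asymp)
  show ?thesis
  proof (intro exI[of _ "4 * K"] conjI)
    show "\<forall>\<^sub>F x in at_top. \<forall>t. 1 \<le> t \<and> t \<le> sqrt x \<longrightarrow>
     \<bar>pi_fun (x / t) - (x / t) / ln (x / t)\<bar> \<le> 4 * K * (x / t) / (ln x * ln (ln x)) \<and>
     ln x / 2 \<le> ln (x / t) \<and> pi_fun (x / t) \<le> (x / t) / ln (x / t) * (1 + 4 * K / ln (ln x))"
      using e1 e2
    proof eventually_elim
      case (elim x)
      show ?case
      proof (intro allI impI)
        fix t assume t: "1 \<le> t \<and> t \<le> sqrt x"
        define u where "u = x / t"
        define l where "l = ln (ln x)"
        have u1: "u \<ge> sqrt x"
        proof -
          have "sqrt x * t \<le> sqrt x * sqrt x" using t elim by (intro mult_left_mono) auto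
          thus ?thesis using t elim by (simp add: u_def field_simps)
        qed
        have u0: "u > 0" using t elim by (simp add: u_def)
        have lnu: "ln u \<ge> ln x / 2"
        proof -
          have "ln (sqrt x) \<le> ln u" using u1 u0 elim by (subst ln_le_cancel_iff) auto
          thus ?thesis using elim by (simp add: ln_sqrt)
        qed
        have l: "l > 2" using elim by (simp add: l_def)
        have lnlnu: "ln (ln u) \<ge> l / 2"
        proof -
          have "ln (ln x / 2) \<le> ln (ln u)" using lnu elim by (subst ln_le_cancel_iff) auto
          thus ?thesis using elim by (simp add: l_def)
        qed
        have lnu0: "ln u > 0" using lnu elim by linarith
        hence u11: "u > 1" using u0 by simp
        have lnu1: "ln u > 1"
        proof -
          have "ln (ln u) > 0" using lnlnu l by linarith
          thus ?thesis using lnu0 by simp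
        qed
        have p: "\<bar>pi_fun u - u / ln u\<bar> \<le> K * u / (ln u * ln (ln u))" using x1[of u] u1 elim by linarith
        have "K * u / (ln u * ln (ln u)) \<le> K * u / ((ln x / 2) * (l / 2))"
          using lnu lnlnu K u0 u11 lnu1 elim l by (intro divide_left_mono mult_mono mult_pos_pos) auto
        also have "\<dots> = 4 * K * u / (ln x * l)" by simp
        finally have 1: "\<bar>pi_fun u - u / ln u\<bar> \<le> 4 * K * u / (ln x * l)" using p by linarith
        have "K * u / (ln u * ln (ln u)) \<le> 4 * K * u / (ln u * l)"
        proof -
          have "K * u / (ln u * ln (ln u)) \<le> K * u / (ln u * (l / 2))"
            using lnlnu K u0 u11 lnu0 lnu1 l by (intro divide_left_mono mult_mono mult_pos_pos) auto
          also have "\<dots> = 2 * (K * u / (ln u * l))" by simp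
          also have "\<dots> \<le> 4 * (K * u / (ln u * l))" using K u0 lnu0 l by (intro mult_right_mono) auto
          finally show ?thesis by simp
        qed
        hence "pi_fun u \<le> u / ln u + 4 * K * u / (ln u * l)" using p by linarith
        also have "\<dots> = u / ln u * (1 + 4 * K / l)" using lnu0 l by (simp add: field_simps)
        finally show "\<bar>pi_fun (x / t) - (x / t) / ln (x / t)\<bar> \<le> 4 * K * (x / t) / (ln x * ln (ln x)) \<and>
           ln x / 2 \<le> ln (x / t) \<and> pi_fun (x / t) \<le> (x / t) / ln (x / t) * (1 + 4 * K / ln (ln x))"
          using 1 lnu by (simp add: u_def l_def)
      qed
    qed
  qed (use K in auto)
qed

text \<open>For t up to exp (4 sqrt (ln x)) replacing ln (x / t) by ln x is a relative change of at
  most 8 / sqrt (ln x), smaller than the error 1 / ln ln x of the prime number theorem.\<close>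

lemma pi_fun_ratio:
  "\<exists>K\<ge>0. \<forall>\<^sub>F x in at_top. \<forall>t. 1 \<le> t \<and> t \<le> exp (4 * sqrt (ln x)) \<longrightarrow>
     \<bar>pi_fun (x / t) - x / ln x * (1 / t)\<bar> \<le> K * (x / ln x * (1 / t)) / ln (ln x)"
proof -
  obtain K where K: "K \<ge> 0" and ev: "\<forall>\<^sub>F x in at_top. \<forall>t. 1 \<le> t \<and> t \<le> sqrt x \<longrightarrow>
     \<bar>pi_fun (x / t) - (x / t) / ln (x / t)\<bar> \<le> K * (x / t) / (ln x * ln (ln x)) \<and>
     ln x / 2 \<le> ln (x / t) \<and> pi_fun (x / t) \<le> (x / t) / ln (x / t) * (1 + K / ln (ln x))"
    using pi_fun_scaled by blast
  have e2: "\<forall>\<^sub>F x::real in at_top. x > 1 \<and> ln x > 2 \<and> ln (ln x) > 2 \<and> exp (4 * sqrt (ln x)) \<le> sqrt x \<and> ln (ln x) \<le> sqrt (ln x)"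
    by (intro eventually_conj; real_asymp)
  show ?thesis
  proof (intro exI[of _ "K + 8"] conjI)
    show "\<forall>\<^sub>F x in at_top. \<forall>t. 1 \<le> t \<and> t \<le> exp (4 * sqrt (ln x)) \<longrightarrow>
     \<bar>pi_fun (x / t) - x / ln x * (1 / t)\<bar> \<le> (K + 8) * (x / ln x * (1 / t)) / ln (ln x)"
      using ev e2
    proof eventually_elim
      case (elim x)
      show ?case
      proof (intro allI impI)
        fix t assume t: "1 \<le> t \<and> t \<le> exp (4 * sqrt (ln x))"
        define L where "L = ln x"
        define l where "l = ln L"
        define u where "u = x / t"
        have L: "L > 2" "l > 2" "l \<le> sqrt L" using elim by (auto simp: L_def l_def)
        have u0: "u > 0" using t elim by (simp add: u_def)
        have 1: "\<bar>pi_fun u - u / ln u\<bar> \<le> K * u / (L * l)" "L / 2 \<le> ln u"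
          using elim t by (auto simp: u_def L_def l_def)
        have lnt: "ln u = L - ln t" using t elim by (simp add: u_def L_def ln_div)
        have "ln u > 0" using 1(2) L by linarith
        hence u11: "u > 1" using u0 by simp
        have t2: "0 \<le> ln t" "ln t \<le> 4 * sqrt L" using t by (auto simp: L_def ln_ge_iff)
          (metis exp_gt_zero ln_exp ln_le_cancel_iff less_le_trans zero_less_one)
        have "\<bar>u / ln u - u / L\<bar> = u * ln t / (L * ln u)"
        proof -
          have "u / ln u - u / L = u * (L - ln u) / (L * ln u)" using 1(2) L by (simp add: field_simps)
          hence "u / ln u - u / L = u * ln t / (L * ln u)" using lnt by simp
          moreover have "u * ln t / (L * ln u) \<ge> 0"
            using u0 u11 t2 L 1(2) by (intro divide_nonneg_nonneg mult_nonneg_nonneg) auto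
          ultimately show ?thesis by (simp only: abs_of_nonneg)
        qed
        also have "\<dots> \<le> u * (4 * sqrt L) / (L * (L / 2))"
          using u0 u11 t2 L 1(2) by (intro frac_le mult_left_mono mult_pos_pos mult_nonneg_nonneg) auto
        also have "\<dots> = 8 * (u / L) / sqrt L"
          using L real_sqrt_mult_self[of L] by (simp add: field_simps)
        also have "\<dots> \<le> 8 * (u / L) / l" using L u0 by (intro divide_left_mono mult_pos_pos) auto
        finally have "\<bar>pi_fun u - u / L\<bar> \<le> K * u / (L * l) + 8 * (u / L) / l" using 1(1) by linarith
        also have "\<dots> = (K + 8) * (u / L) / l" by (simp add: distrib_right add_divide_distrib)
        finally show "\<bar>pi_fun (x / t) - x / ln x * (1 / t)\<bar> \<le> (K + 8) * (x / ln x * (1 / t)) / ln (ln x)"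
          by (simp add: u_def L_def l_def mult.commute)
      qed
    qed
  qed (use K in auto)
qed

text \<open>The main terms x / (p ln (x / p)) are summed over p \<le> sqrt x with 1 / (L - a) \<le>
  1 / L + 2a / L^2 for a = ln p \<le> L / 2; Mertens' sum of ln p / p bounds the correction. The
  factor 1 + K / ln ln x changes ln ln x + O(1) only by a constant.\<close>

lemma prime_product_count_upper:
  "\<exists>K\<ge>0. \<forall>\<^sub>F x in at_top. \<forall>R. real (prime_product_count x R) \<le> x / ln x * (ln (ln x) + K)"
proof -
  obtain K where K: "K \<ge> 0" and ev: "\<forall>\<^sub>F x in at_top. \<forall>t. 1 \<le> t \<and> t \<le> sqrt x \<longrightarrow>
     \<bar>pi_fun (x / t) - (x / t) / ln (x / t)\<bar> \<le> K * (x / t) / (ln x * ln (ln x)) \<and>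
     ln x / 2 \<le> ln (x / t) \<and> pi_fun (x / t) \<le> (x / t) / ln (x / t) * (1 + K / ln (ln x))"
    using pi_fun_scaled by blast
  obtain C1 where C1: "C1 \<ge> 0" "\<And>x. x \<ge> 2 \<Longrightarrow> \<bar>(\<Sum>p | prime p \<and> real p \<le> x. 1 / real p) - ln (ln x)\<bar> \<le> C1"
    using mertens_reciprocal by blast
  obtain C2 where C2: "C2 \<ge> 0" "\<And>x. x \<ge> 1 \<Longrightarrow> (\<Sum>p | prime p \<and> real p \<le> x. ln (real p) / real p) \<le> ln x + C2"
    using mertens_prime_le by blast
  define C where "C = C1 + 1 + 2 * C2"
  have e2: "\<forall>\<^sub>F x::real in at_top. x > 1 \<and> ln x > 1 \<and> ln (ln x) > 1 \<and> sqrt x \<ge> 2"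
    by (intro eventually_conj; real_asymp)
  show ?thesis
  proof (intro exI[of _ "K + C + K * C"] conjI)
    show "\<forall>\<^sub>F x in at_top. \<forall>R. real (prime_product_count x R) \<le> x / ln x * (ln (ln x) + (K + C + K * C))"
      using ev e2
    proof eventually_elim
      case (elim x)
      define L where "L = ln x"
      define l where "l = ln L"
      have L: "L > 1" "l > 1" "x > 1" using elim by (auto simp: L_def l_def)
      define A where "A = {p. prime p \<and> real p \<le> sqrt x}"
      have "(\<Sum>p\<in>A. pi_fun (x / real p)) \<le> (\<Sum>p\<in>A. x * (1 + K / l) / L * (1 / real p) + x * (1 + K / l) / L * (2 / L) * (ln (real p) / real p))"
      proof (rule sum_mono)
        fix p assume p: "p \<in> A"
        have p1: "real p \<ge> 1" "real p \<le> sqrt x" using p prime_gt_0_nat[of p] by (auto simp: A_def)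
        define a where "a = ln (real p)"
        have lnu: "ln (x / real p) = L - a" using p1 L by (simp add: a_def L_def ln_div)
        have "L / 2 \<le> ln (x / real p)" using elim p1 unfolding L_def by blast
        hence a: "0 \<le> a" "a \<le> L / 2" using p1 lnu by (auto simp: a_def)
        have "pi_fun (x / real p) \<le> (x / real p) / ln (x / real p) * (1 + K / l)"
          using elim p1 by (auto simp: l_def L_def)
        also have "\<dots> = x / real p * (1 + K / l) * (1 / (L - a))" by (simp add: lnu)
        also have "\<dots> \<le> x / real p * (1 + K / l) * (1 / L + 2 * a / L\<^sup>2)"
        proof (intro mult_left_mono)
          have "(1 / L + 2 * a / L\<^sup>2) * (L - a) = 1 + a / L * (1 - 2 * a / L)"
            using L by (simp add: field_simps power2_eq_square)
          moreover have "a / L * (1 - 2 * a / L) \<ge> 0" using a L by (intro mult_nonneg_nonneg) (auto simp: field_simps)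
          ultimately have "1 \<le> (1 / L + 2 * a / L\<^sup>2) * (L - a)" by simp
          thus "1 / (L - a) \<le> 1 / L + 2 * a / L\<^sup>2" using a L by (simp add: pos_divide_le_eq)
        qed (use L K p1 in auto)
        also have "\<dots> = x * (1 + K / l) / L * (1 / real p) + x * (1 + K / l) / L * (2 / L) * (a / real p)"
          using L p1 by (simp add: power2_eq_square field_simps)
        finally show "pi_fun (x / real p) \<le> x * (1 + K / l) / L * (1 / real p) + x * (1 + K / l) / L * (2 / L) * (ln (real p) / real p)"
          by (simp add: a_def)
      qed
      also have "\<dots> = x * (1 + K / l) / L * ((\<Sum>p\<in>A. 1 / real p) + (2 / L) * (\<Sum>p\<in>A. ln (real p) / real p))"
      proof -
        have "(\<Sum>p\<in>A. c * f p + c * b * g p) = c * ((\<Sum>p\<in>A. f p) + b * (\<Sum>p\<in>A. g p))" for c b and f g :: "nat \<Rightarrow> real"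
          by (simp add: sum.distrib sum_distrib_left distrib_left mult.assoc)
        thus ?thesis .
      qed
      also have "\<dots> \<le> x * (1 + K / l) / L * (l + C)"
      proof (intro mult_left_mono)
        have "(\<Sum>p\<in>A. 1 / real p) \<le> ln (ln (sqrt x)) + C1" using C1(2)[of "sqrt x"] elim unfolding A_def by linarith
        also have "ln (ln (sqrt x)) \<le> l" using L by (simp add: ln_sqrt l_def L_def)
        finally have 1: "(\<Sum>p\<in>A. 1 / real p) \<le> l + C1" by simp
        have "(\<Sum>p\<in>A. ln (real p) / real p) \<le> ln (sqrt x) + C2" using C2(2)[of "sqrt x"] elim unfolding A_def by simp
        hence "(2 / L) * (\<Sum>p\<in>A. ln (real p) / real p) \<le> (2 / L) * (L / 2 + C2)"
          using L by (intro mult_left_mono) (auto simp: ln_sqrt L_def)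
        also have "\<dots> = 1 + 2 * C2 / L" using L by (simp add: field_simps)
        also have "2 * C2 / L \<le> 2 * C2" using L C2(1) by (simp add: divide_le_eq mult_le_cancel_left1)
        finally show "(\<Sum>p\<in>A. 1 / real p) + (2 / L) * (\<Sum>p\<in>A. ln (real p) / real p) \<le> l + C"
          using 1 by (simp add: C_def)
      qed (use L K in auto)
      also have "\<dots> = x / L * (l + (K + C + K * C / l))" using L by (simp add: field_simps)
      also have "\<dots> \<le> x / L * (l + (K + C + K * C))"
      proof (intro mult_left_mono add_left_mono)
        have "0 \<le> K * C" using K C1 C2 by (simp add: C_def)
        thus "K * C / l \<le> K * C" using L by (simp add: divide_le_eq mult_le_cancel_left1)
      qed (use L in auto)
      finally have "(\<Sum>p\<in>A. pi_fun (x / real p)) \<le> x / L * (l + (K + C + K * C))" .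
      thus ?case using prime_product_count_le_pi_sum[of x] L unfolding A_def L_def l_def by (meson less_eq_real_def order_trans zero_less_one)
    qed
  qed (use K C1 C2 in \<open>auto simp: C_def\<close>)
qed

text \<open>The sum of X p / p up to exp (4 sqrt (ln x)) is split at the ends of the prescribed
  range and of the middle range. Up to the sign e, the three parts are -ln ln ln x + O(1) by
  prescription, at most 1 by hypothesis, and at most ln 32 + O(1) by Mertens. Beyond them the bias 1
  / (ln x)^2 is what absorbs the factor x (1 + ln x) of the pair sums into O(x / ln x).\<close>

lemma character_bias_bound:
  "\<exists>K\<ge>0. \<forall>\<^sub>F x in at_top. \<forall>(X :: nat \<Rightarrow> real) d e.
     (\<forall>n. X n \<in> {-1, 0, 1}) \<and> d > 0 \<and> real d \<le> exp (sqrt (ln x)) \<and> (\<forall>q. prime q \<longrightarrow> X q = 0 \<longrightarrow> q dvd d) \<and>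
     e \<in> {-1, 1} \<and> (\<forall>p. prime p \<longrightarrow> p > 2 \<longrightarrow> real p \<le> ln x powr (1/4) \<longrightarrow> X p = -e) \<and>
     \<bar>\<Sum>p | prime p \<and> ln x powr (1/4) < real p \<and> real p \<le> exp (sqrt (ln x) / 8). X p / real p\<bar> \<le> 1 \<and>
     (\<forall>u. exp (4 * sqrt (ln x)) \<le> u \<longrightarrow> u \<le> x \<longrightarrow> \<bar>\<Sum>p | prime p \<and> real p \<le> u. X p\<bar> \<le> 1 / (ln x)\<^sup>2 * u) \<longrightarrow>
     4 * real (prime_product_count x (\<lambda>p q. X p = e \<and> X q = e)) \<le>
       real (prime_product_count x (\<lambda>p q. X p \<noteq> 0 \<and> X q \<noteq> 0)) - x / ln x * (ln (ln (ln x)) - K)"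
proof -
  obtain K1 where K1: "K1 \<ge> 0" and ev: "\<forall>\<^sub>F x in at_top. \<forall>t. 1 \<le> t \<and> t \<le> exp (4 * sqrt (ln x)) \<longrightarrow>
     \<bar>pi_fun (x / t) - x / ln x * (1 / t)\<bar> \<le> K1 * (x / ln x * (1 / t)) / ln (ln x)"
    using pi_fun_ratio by blast
  obtain C where C: "C \<ge> 0" "\<And>x. x \<ge> 2 \<Longrightarrow> \<bar>(\<Sum>p | prime p \<and> real p \<le> x. 1 / real p) - ln (ln x)\<bar> \<le> C"
    using mertens_reciprocal by blast
  define K2 where "K2 = ln 4 + ln 32 + 3 * C + 2"
  define K where "K = K2 + K1 * (1 + C) + 9"
  have e1: "\<forall>\<^sub>F x::real in at_top. x > 1 \<and> ln x > 1 \<and> ln (ln x) > 1 \<and> exp (4 * sqrt (ln x)) \<le> x \<and>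
      2 \<le> ln x powr (1/4) \<and> ln x powr (1/4) \<le> exp (sqrt (ln x) / 8) \<and> ln (4 * sqrt (ln x)) \<le> ln (ln x) \<and>
      exp (4 * sqrt (ln x)) * exp (sqrt (ln x)) + (exp (4 * sqrt (ln x)))\<^sup>2 / 2 + 2 * sqrt x \<le> x / ln x"
    by (intro eventually_conj; real_asymp)
  show ?thesis
  proof (intro exI[of _ K] conjI)
    show "K \<ge> 0" using K1 C by (simp add: K_def K2_def)
    show "\<forall>\<^sub>F x in at_top. \<forall>(X :: nat \<Rightarrow> real) d e.
     (\<forall>n. X n \<in> {-1, 0, 1}) \<and> d > 0 \<and> real d \<le> exp (sqrt (ln x)) \<and> (\<forall>q. prime q \<longrightarrow> X q = 0 \<longrightarrow> q dvd d) \<and>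
     e \<in> {-1, 1} \<and> (\<forall>p. prime p \<longrightarrow> p > 2 \<longrightarrow> real p \<le> ln x powr (1/4) \<longrightarrow> X p = -e) \<and>
     \<bar>\<Sum>p | prime p \<and> ln x powr (1/4) < real p \<and> real p \<le> exp (sqrt (ln x) / 8). X p / real p\<bar> \<le> 1 \<and>
     (\<forall>u. exp (4 * sqrt (ln x)) \<le> u \<longrightarrow> u \<le> x \<longrightarrow> \<bar>\<Sum>p | prime p \<and> real p \<le> u. X p\<bar> \<le> 1 / (ln x)\<^sup>2 * u) \<longrightarrow>
     4 * real (prime_product_count x (\<lambda>p q. X p = e \<and> X q = e)) \<le>
       real (prime_product_count x (\<lambda>p q. X p \<noteq> 0 \<and> X q \<noteq> 0)) - x / ln x * (ln (ln (ln x)) - K)"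
      using ev e1
    proof eventually_elim
      case (elim x)
      show ?case
      proof (intro allI impI, elim conjE)
        fix X :: "nat \<Rightarrow> real" and d :: nat and e :: real
        assume X: "\<forall>n. X n \<in> {-1, 0, 1}" and d: "d > 0" "real d \<le> exp (sqrt (ln x))"
          and zero: "\<forall>q. prime q \<longrightarrow> X q = 0 \<longrightarrow> q dvd d" and e: "e \<in> {-1, 1}"
          and small: "\<forall>p. prime p \<longrightarrow> p > 2 \<longrightarrow> real p \<le> ln x powr (1/4) \<longrightarrow> X p = -e"
          and mid: "\<bar>\<Sum>p | prime p \<and> ln x powr (1/4) < real p \<and> real p \<le> exp (sqrt (ln x) / 8). X p / real p\<bar> \<le> 1"
          and G: "\<forall>u. exp (4 * sqrt (ln x)) \<le> u \<longrightarrow> u \<le> x \<longrightarrow> \<bar>\<Sum>p | prime p \<and> real p \<le> u. X p\<bar> \<le> 1 / (ln x)\<^sup>2 * u"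
        define L where "L = ln x"
        define l where "l = ln L"
        define w where "w = x / L"
        define y where "y = L powr (1/4)"
        define z where "z = exp (sqrt L / 8)"
        define Z where "Z = exp (4 * sqrt L)"
        define \<delta> where "\<delta> = 1 / L\<^sup>2"
        have L: "x > 1" "L > 1" "l > 1" and Zx: "1 \<le> Z" "Z \<le> x" and y2: "2 \<le> y" and yz: "y \<le> z"
          using elim by (auto simp: L_def l_def Z_def y_def z_def)
        have zZ: "z \<le> Z" using L by (simp add: z_def Z_def)
        have w0: "w > 0" using L by (simp add: w_def)
        have Xabs: "\<bar>X n\<bar> \<le> 1" for n using X[rule_format, of n] by auto
        have eX: "e * X n \<le> 1" for n using X[rule_format, of n] e by auto
        have Xv: "X q \<in> {-1, 0, 1}" for q using X by blast
        have zero': "q dvd d" if "prime q" "X q = 0" for q using zero that by blast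
        have G': "\<bar>\<Sum>p | prime p \<and> real p \<le> u. X p\<bar> \<le> \<delta> * u" if "Z \<le> u" "u \<le> x" for u
          using G that unfolding Z_def \<delta>_def L_def by blast
        have \<delta>0: "\<delta> \<ge> 0" by (simp add: \<delta>_def)
        define S1 where "S1 = (\<Sum>(p,q)\<in>PP x. X p * \<bar>X q\<bar>)"
        define S2 where "S2 = (\<Sum>(p,q)\<in>PP x. X p * X q)"
        define A where "A = {p. prime p \<and> real p \<le> Z}"
        define A1 where "A1 = {p. prime p \<and> real p \<le> y}"
        define A2 where "A2 = {p. prime p \<and> y < real p \<and> real p \<le> z}"
        define A3 where "A3 = {p. prime p \<and> z < real p \<and> real p \<le> Z}"
        have fin: "finite A" "finite A1" "finite A2" "finite A3"
          by (auto simp: A_def A1_def A2_def A3_def)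
        have split: "A = (A1 \<union> A2) \<union> A3" "A1 \<inter> A2 = {}" "(A1 \<union> A2) \<inter> A3 = {}"
          "A1 \<union> A2 = {p. prime p \<and> real p \<le> z}"
          using yz zZ by (auto simp: A_def A1_def A2_def A3_def)
        have sumA: "(\<Sum>p\<in>A. f p) = (\<Sum>p\<in>A1. f p) + (\<Sum>p\<in>A2. f p) + (\<Sum>p\<in>A3. f p)" for f :: "nat \<Rightarrow> real"
          unfolding split(1) using fin split(2,3) by (simp add: sum.union_disjoint)
        have b1: "4 * real (prime_product_count x (\<lambda>p q. X p = e \<and> X q = e)) \<le>
           real (prime_product_count x (\<lambda>p q. X p \<noteq> 0 \<and> X q \<noteq> 0)) + e * S1 + 1 / 2 * S2 + 2 * sqrt x"
          unfolding S1_def S2_def by (rule character_pair_inequality) (use L Xv e in auto)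
        have b2: "\<bar>S2\<bar> \<le> 4 * \<delta> * x * (1 + L) + Z\<^sup>2"
          unfolding S2_def L_def by (rule pair_sum_chi_chi[OF Zx \<delta>0 Xabs G'])
        have b3: "\<bar>S1 - (\<Sum>p\<in>A. X p * pi_fun (x / real p))\<bar> \<le> 2 * \<delta> * x * (1 + L) + Z * real d"
          unfolding S1_def A_def L_def by (rule pair_sum_chi_abs[OF Zx \<delta>0 Xv d(1) zero' G'])
        have "\<bar>(\<Sum>p\<in>A. X p * pi_fun (x / real p)) - (\<Sum>p\<in>A. X p * (w * (1 / real p)))\<bar> \<le> K1 * (1 + C) * w"
        proof -
          have "(\<Sum>p\<in>A. X p * pi_fun (x / real p)) - (\<Sum>p\<in>A. X p * (w * (1 / real p))) =
                (\<Sum>p\<in>A. X p * (pi_fun (x / real p) - w * (1 / real p)))"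
            by (simp add: right_diff_distrib sum_subtractf)
          also have "\<bar>\<dots>\<bar> \<le> (\<Sum>p\<in>A. K1 * w / l * (1 / real p))"
          proof (rule order_trans[OF sum_abs], rule sum_mono)
            fix p assume "p \<in> A"
            hence "1 \<le> real p" "real p \<le> Z" using prime_gt_0_nat[of p] by (auto simp: A_def)
            hence "\<bar>pi_fun (x / real p) - w * (1 / real p)\<bar> \<le> K1 * (w * (1 / real p)) / l"
              using elim unfolding w_def L_def l_def Z_def by blast
            hence "\<bar>X p\<bar> * \<bar>pi_fun (x / real p) - w * (1 / real p)\<bar> \<le> 1 * (K1 * (w * (1 / real p)) / l)"
              using Xabs by (intro mult_mono) auto
            thus "\<bar>X p * (pi_fun (x / real p) - w * (1 / real p))\<bar> \<le> K1 * w / l * (1 / real p)"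
              by (simp add: abs_mult mult_ac)
          qed
          also have "\<dots> = K1 * w / l * (\<Sum>p\<in>A. 1 / real p)" by (simp add: sum_distrib_left)
          also have "\<dots> \<le> K1 * w / l * (l * (1 + C))"
          proof (intro mult_left_mono)
            have "(\<Sum>p\<in>A. 1 / real p) \<le> ln (ln Z) + C" using C(2)[of Z] y2 yz zZ unfolding A_def by linarith
            also have "ln (ln Z) \<le> l" using elim by (simp add: Z_def l_def L_def)
            also have "l + C \<le> l * (1 + C)" using L C by (simp add: distrib_left mult_le_cancel_right1)
            finally show "(\<Sum>p\<in>A. 1 / real p) \<le> l * (1 + C)" by simp
          qed (use K1 w0 L in auto)
          also have "\<dots> = K1 * (1 + C) * w" using L by simp
          finally show ?thesis .
        qed
        moreover have "(\<Sum>p\<in>A. X p * (w * (1 / real p))) = w * (\<Sum>p\<in>A. X p / real p)"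
          by (simp add: sum_distrib_left mult_ac)
        ultimately have b4: "\<bar>(\<Sum>p\<in>A. X p * pi_fun (x / real p)) - w * (\<Sum>p\<in>A. X p / real p)\<bar> \<le> K1 * (1 + C) * w"
          by simp
        have b5: "e * (\<Sum>p\<in>A. X p / real p) \<le> -ln l + K2"
        proof -
          have "e * (\<Sum>p\<in>A1. X p / real p) = (\<Sum>p\<in>A1. e * X p / real p)" by (simp add: sum_distrib_left)
          also have "\<dots> \<le> (\<Sum>p\<in>A1. -(1 / real p) + (if p = 2 then 1 else 0))"
          proof (rule sum_mono)
            fix p assume p: "p \<in> A1"
            \<comment> \<open>The value at 2 is not prescribed: at worst it contributes 1/2 instead
              of -1/2, a loss of 1.\<close>
            show "e * X p / real p \<le> -(1 / real p) + (if p = 2 then 1 else 0)"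
            proof (cases "p = 2")
              case True
              thus ?thesis using eX[of 2] by simp
            next
              case False
              hence "p > 2" using p prime_ge_2_nat[of p] by (auto simp: A1_def)
              hence "X p = -e" using small p by (auto simp: A1_def y_def L_def)
              thus ?thesis using False e by auto
            qed
          qed
          also have "\<dots> = -(\<Sum>p\<in>A1. 1 / real p) + 1"
          proof -
            have "(\<Sum>p\<in>A1. if p = 2 then 1 else 0 :: real) = 1"
              using fin y2 by (subst sum.delta) (auto simp: A1_def)
            thus ?thesis unfolding sum.distrib sum_negf by (simp only:)
          qed
          also have "\<dots> \<le> -(ln (ln y) - C) + 1"
            using C(2)[of y] y2 unfolding A1_def by linarith
          also have "ln (ln y) = ln l - ln 4"
          proof -
            have "ln y = l / 4" using L by (simp add: y_def ln_powr l_def)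
            hence "ln (ln y) = ln (l / 4)" by (simp only:)
            also have "\<dots> = ln l - ln 4" using L by (simp add: ln_div)
            finally show ?thesis .
          qed
          finally have 1: "e * (\<Sum>p\<in>A1. X p / real p) \<le> -ln l + ln 4 + C + 1" by simp
          have 2: "e * (\<Sum>p\<in>A2. X p / real p) \<le> 1"
            using mid e unfolding A2_def y_def z_def L_def by (auto simp: abs_le_iff)
          have "e * (\<Sum>p\<in>A3. X p / real p) = (\<Sum>p\<in>A3. e * X p / real p)" by (simp add: sum_distrib_left)
          also have "\<dots> \<le> (\<Sum>p\<in>A3. 1 / real p)" by (intro sum_mono divide_right_mono eX) auto
          also have "\<dots> = (\<Sum>p\<in>A. 1 / real p) - (\<Sum>p\<in>A1 \<union> A2. 1 / real p)"
            using sumA[of "\<lambda>p. 1 / real p"] fin split(2) by (simp add: sum.union_disjoint)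
          also have "\<dots> \<le> (ln (ln Z) + C) - (ln (ln z) - C)"
            using C(2)[of Z] C(2)[of z] y2 yz zZ unfolding A_def split(4) by linarith
          also have "ln (ln Z) - ln (ln z) = ln 32"
          proof -
            have "ln (ln Z) - ln (ln z) = ln (4 * sqrt L / (sqrt L / 8))"
              unfolding Z_def z_def ln_exp using L by (subst ln_div) auto
            also have "4 * sqrt L / (sqrt L / 8) = 32" using L by simp
            finally show ?thesis .
          qed
          hence "(ln (ln Z) + C) - (ln (ln z) - C) = ln 32 + 2 * C" by linarith
          finally have 3: "e * (\<Sum>p\<in>A3. X p / real p) \<le> ln 32 + 2 * C" .
          show ?thesis using 1 2 3 sumA[of "\<lambda>p. X p / real p"] by (simp add: K2_def distrib_left)
        qed
        have e_abs: "e * a \<le> e * b + c" if "\<bar>a - b\<bar> \<le> c" for a b c using that e by auto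
        have "e * S1 \<le> e * (\<Sum>p\<in>A. X p * pi_fun (x / real p)) + (2 * \<delta> * x * (1 + L) + Z * real d)"
          by (rule e_abs[OF b3])
        also have "e * (\<Sum>p\<in>A. X p * pi_fun (x / real p)) \<le> e * (w * (\<Sum>p\<in>A. X p / real p)) + K1 * (1 + C) * w"
          by (rule e_abs[OF b4])
        also have "e * (w * (\<Sum>p\<in>A. X p / real p)) \<le> w * (-ln l + K2)"
          using mult_left_mono[OF b5, of w] w0 by (simp add: mult_ac)
        finally have b6: "e * S1 \<le> w * (-ln l + K2) + K1 * (1 + C) * w + (2 * \<delta> * x * (1 + L) + Z * real d)" by simp
        have b7: "\<delta> * x * (1 + L) \<le> 2 * w"
        proof -
          have "\<delta> * x * (1 + L) \<le> \<delta> * x * (L + L)" using L \<delta>0 by (intro mult_left_mono) auto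
          also have "\<dots> = 2 * w" using L by (simp add: \<delta>_def w_def power2_eq_square)
          finally show ?thesis .
        qed
        have b8: "Z * real d + Z\<^sup>2 / 2 + 2 * sqrt x \<le> w"
        proof -
          have "Z * real d \<le> Z * exp (sqrt L)" using d Zx by (intro mult_left_mono) (auto simp: L_def)
          thus ?thesis using elim unfolding Z_def w_def L_def by linarith
        qed
        \<comment> \<open>The coefficient 4 of \<open>\<delta> * x * (1 + L)\<close> is 2 from S1
          plus half of the 4 from S2. By \<open>b7\<close> and \<open>b8\<close> these errors amount
          to 9 w, the number 9 in K.\<close>
        have "4 * real (prime_product_count x (\<lambda>p q. X p = e \<and> X q = e)) \<le>
           real (prime_product_count x (\<lambda>p q. X p \<noteq> 0 \<and> X q \<noteq> 0)) + (w * (-ln l + K2) + K1 * (1 + C) * w) + 4 * (\<delta> * x * (1 + L)) +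
              (Z * real d + Z\<^sup>2 / 2 + 2 * sqrt x)"
          using b1 b2 b6 by (simp add: abs_le_iff)
        also have "\<dots> \<le> real (prime_product_count x (\<lambda>p q. X p \<noteq> 0 \<and> X q \<noteq> 0)) + (w * (-ln l + K2) + K1 * (1 + C) * w) + 4 * (2 * w) + w"
          using b7 b8 by linarith
        also have "\<dots> = real (prime_product_count x (\<lambda>p q. X p \<noteq> 0 \<and> X q \<noteq> 0)) - w * (ln l - K)"
          by (simp add: K_def algebra_simps)
        finally show "4 * real (prime_product_count x (\<lambda>p q. X p = e \<and> X q = e)) \<le>
           real (prime_product_count x (\<lambda>p q. X p \<noteq> 0 \<and> X q \<noteq> 0)) - x / ln x * (ln (ln (ln x)) - K)"
          by (simp add: w_def l_def L_def)
      qed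
    qed
  qed
qed

text \<open>The bound T \<le> w (l + K5) turns the absolute saving w (\<mu> - K4) into a saving
  relative to T. Replacing w by T / l is paid for by subtracting K5 from \<mu>, which is enough
  because \<mu> \<le> l.\<close>

lemma ratio_from_difference:
  fixes N T w l \<mu> K4 K5 :: real
  assumes "4 * N \<le> T - w * (\<mu> - K4)" "T \<le> w * (l + K5)" "N \<ge> 0" "w > 0" "l \<ge> 1" "\<mu> \<le> l"
    "\<mu> > K4 + K5" "K4 \<ge> 0" "K5 \<ge> 0"
  shows "N / (1/4 * T) \<le> 1 - (\<mu> + -(K4 + K5)) / l"
proof -
  have "w * (\<mu> - K4) > 0" using assms by (intro mult_pos_pos) auto
  hence T: "T > 0" using assms by linarith
  have "T * (\<mu> - (K4 + K5)) / l \<le> w * (l + K5) * (\<mu> - (K4 + K5)) / l"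
    using assms by (intro divide_right_mono mult_right_mono) auto
  also have "\<dots> = w * (\<mu> - (K4 + K5) + K5 * (\<mu> - (K4 + K5)) / l)"
    using assms by (simp add: field_simps)
  also have "\<dots> \<le> w * (\<mu> - K4)"
  proof (intro mult_left_mono)
    have "K5 * (\<mu> - (K4 + K5)) \<le> K5 * l" using assms by (intro mult_left_mono) auto
    hence "K5 * (\<mu> - (K4 + K5)) / l \<le> K5" using assms by (simp add: divide_le_eq)
    thus "\<mu> - (K4 + K5) + K5 * (\<mu> - (K4 + K5)) / l \<le> \<mu> - K4" by simp
  qed (use assms in auto)
  finally have "4 * N \<le> T - T * (\<mu> - (K4 + K5)) / l" using assms by linarith
  hence "4 * N / T \<le> (T - T * (\<mu> - (K4 + K5)) / l) / T" using T by (intro divide_right_mono) auto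
  also have "\<dots> = 1 - (\<mu> + -(K4 + K5)) / l" using T by (simp add: diff_divide_distrib add_divide_distrib)
  finally show ?thesis by (simp add: mult.commute)
qed

section \<open>Conductors with prescribed values at the small primes\<close>

text \<open>A class modulo this number fixes d modulo 4, as reciprocity requires, and all symbols (d
  / p) at odd p \<le> y.\<close>

definition family_modulus :: "nat \<Rightarrow> nat" where
  "family_modulus y = 4 * \<Prod>{p. prime p \<and> 2 < p \<and> p \<le> y}"

text \<open>Crude, yet for y near (ln x)^(1/4) the bound is smaller than any fixed power of exp
  (sqrt (ln x)).\<close>

lemma family_modulus_le:
  assumes "y \<ge> 1"
  shows "0 < family_modulus y" "family_modulus y \<le> 4 * y ^ y"
proof -
  let ?A = "{p::nat. prime p \<and> 2 < p \<and> p \<le> y}"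
  show "0 < family_modulus y" unfolding family_modulus_def by (simp add: prod_pos)
  have "\<Prod>?A \<le> (\<Prod>p\<in>?A. y)" by (rule prod_mono) auto
  also have "\<dots> = y ^ card ?A" by simp
  also have "\<dots> \<le> y ^ y"
  proof (rule power_increasing)
    have "card ?A \<le> card {1..y}" by (intro card_mono) (auto dest: prime_gt_0_nat)
    thus "card ?A \<le> y" by simp
  qed (use assms in auto)
  finally show "family_modulus y \<le> 4 * y ^ y" by (simp add: family_modulus_def)
qed

lemma prime_not_dvd_family_modulus:
  assumes "prime p" "\<not> p dvd family_modulus y"
  shows "p > y"
proof (rule ccontr)
  assume "\<not> p > y"
  hence py: "p \<le> y" by simp
  show False
  proof (cases "p = 2")
    case True
    have "(2::nat) dvd 4 * k" for k by presburger
    thus False using True assms by (simp add: family_modulus_def)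
  next
    case False
    hence "p \<in> {p. prime p \<and> 2 < p \<and> p \<le> y}" using assms py prime_ge_2_nat[of p] by auto
    hence "p dvd \<Prod>{p. prime p \<and> 2 < p \<and> p \<le> y}" by (intro dvd_prodI) auto
    thus False using assms by (simp add: family_modulus_def)
  qed
qed

text \<open>The Chinese remainder theorem over the odd primes up to y and the modulus 4, which is
  filed under the index 2. Coprimality to the modulus follows from the symbols being nonzero and r
  being odd.\<close>

lemma prescribed_residue_class:
  assumes e: "e = 1 \<or> e = -1"
  shows "\<exists>r. 0 < r \<and> r \<le> family_modulus y \<and> coprime r (family_modulus y) \<and> [r = 1] (mod 4) \<and>
    (\<forall>p. prime p \<and> 2 < p \<and> p \<le> y \<longrightarrow> Legendre (int r) (int p) = e)"
proof -
  define Ps where "Ps = {p::nat. prime p \<and> 2 < p \<and> p \<le> y}"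
  define M where "M = family_modulus y"
  have M: "M = 4 * \<Prod>Ps" "M > 0" unfolding M_def family_modulus_def Ps_def by (auto intro: prod_pos)
  have finPs: "finite Ps" by (simp add: Ps_def)
  have "\<forall>p\<in>Ps. \<exists>b::nat. Legendre (int b) (int p) = e"
  proof
    fix p assume p: "p \<in> Ps"
    have "\<exists>b. Legendre b (int p) = e"
      using e Legendre_1[of p] Legendre_nonresidue_exists[of p] p by (auto simp: Ps_def)
    then obtain b where b: "Legendre b (int p) = e" by blast
    have "int (nat (b mod int p)) = b mod int p" using p by (simp add: Ps_def)
    moreover have "[b mod int p = b] (mod int p)" by (simp add: unique_euclidean_semiring_class.cong_def)
    ultimately have "Legendre (int (nat (b mod int p))) (int p) = e" using b Legendre_cong by metis
    thus "\<exists>b::nat. Legendre (int b) (int p) = e" by blast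
  qed
  then obtain b where b: "\<And>p. p \<in> Ps \<Longrightarrow> Legendre (int (b p)) (int p) = e" by metis
  define m where "m = (\<lambda>p::nat. if p = 2 then 4 else p)"
  define u where "u = (\<lambda>p::nat. if p = 2 then 1 else b p)"
  have cop: "\<forall>i\<in>insert 2 Ps. \<forall>j\<in>insert 2 Ps. i \<noteq> j \<longrightarrow> coprime (m i) (m j)"
  proof (intro ballI impI)
    fix i j assume ij: "i \<in> insert 2 Ps" "j \<in> insert 2 Ps" "i \<noteq> j"
    have pr: "prime i" "prime j" using ij by (auto simp: Ps_def)
    have "coprime i j" using pr ij primes_coprime by blast
    moreover have "m k dvd k\<^sup>2" for k by (auto simp: m_def power2_eq_square)
    ultimately show "coprime (m i) (m j)"
      by (meson coprime_divisors coprime_power_left_iff coprime_power_right_iff)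
  qed
  obtain x where x: "\<And>i. i \<in> insert 2 Ps \<Longrightarrow> [x = u i] (mod m i)"
    using chinese_remainder_nat[OF _ cop] finPs by blast
  define r where "r = x mod M"
  have rx: "[r = x] (mod M)" by (simp add: r_def unique_euclidean_semiring_class.cong_def)
  have r4: "[r = 1] (mod 4)"
  proof -
    have "[r = x] (mod 4)" by (rule cong_dvd_modulus_nat[OF rx]) (simp add: M)
    thus ?thesis using x[of 2] cong_trans by (auto simp: m_def u_def)
  qed
  have leg: "Legendre (int r) (int p) = e" if p: "p \<in> Ps" for p
  proof -
    have "p dvd \<Prod>Ps" using p finPs by (intro dvd_prodI) auto
    hence "[r = x] (mod p)" by (intro cong_dvd_modulus_nat[OF rx]) (simp add: M)
    moreover have "[x = b p] (mod p)" using x[of p] p by (auto simp: m_def u_def Ps_def)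
    ultimately have "[r = b p] (mod p)" by (rule cong_trans)
    hence "[int r = int (b p)] (mod int p)" by (simp add: cong_int_iff)
    thus ?thesis using Legendre_cong b[OF p] by metis
  qed
  have odd: "odd r"
  proof -
    have "r mod 4 = 1" using r4 by (simp add: unique_euclidean_semiring_class.cong_def)
    thus ?thesis by presburger
  qed
  have "coprime r (\<Prod>Ps)"
  proof (rule prod_coprime_right)
    fix p assume p: "p \<in> Ps"
    have "Legendre (int r) (int p) \<noteq> 0" using leg[OF p] e by auto
    hence "\<not> p dvd r" by (simp add: Legendre_eq_0_iff)
    thus "coprime r p" using p prime_imp_coprime[of p r] by (simp add: Ps_def coprime_commute)
  qed
  moreover have "coprime r 4"
  proof -
    have "coprime r 2" using odd by simp
    hence "coprime r (2\<^sup>2)" by (simp only: coprime_power_right_iff) simp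
    thus ?thesis by simp
  qed
  ultimately have "coprime r M" by (simp add: M)
  moreover have "r > 0" using odd by (auto intro: Nat.gr0I)
  moreover have "r \<le> M" using M(2) by (simp add: r_def less_imp_le)
  ultimately show ?thesis using r4 leg unfolding M_def Ps_def by blast
qed

text \<open>From the progression r + M j three exceptional sets are removed: the members that are
  not squarefree, those biased in the middle range (Chebyshev's inequality with
  \<open>second_moment\<close>), and those with a long biased sum
  (\<open>large_sieve_exceptions\<close>). The left side is J less 1 and the bounds for these
  sets.\<close>

lemma good_discriminants_count:
  fixes D Z \<delta> :: real and y z N s :: nat and e :: int
  assumes e: "e = 1 \<or> e = -1" and y: "y \<ge> 4" and D: "D \<ge> 0" and s: "D \<le> (real s)\<^sup>2"
    and Z: "Z > 0" "Z \<ge> 2 * D ^ 3" and \<delta>: "\<delta> > 0"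
  defines "Gd \<equiv> {d. odd d \<and> squarefree d \<and> d > 1 \<and> real d \<le> D \<and>
      (\<forall>p. prime p \<and> 2 < p \<and> p \<le> y \<longrightarrow> jac d (int p) = e) \<and>
      \<bar>\<Sum>p | prime p \<and> y < p \<and> p \<le> z. real_of_int (jac d (int p)) / real p\<bar> \<le> 1 \<and>
      (\<forall>u. Z \<le> real u \<and> u \<le> N \<longrightarrow> \<bar>\<Sum>p | prime p \<and> p \<le> u. real_of_int (jac d (int p))\<bar> < \<delta> * real u)}"
    and "J \<equiv> nat \<lfloor>D / real (family_modulus y)\<rfloor>"
  shows "real J - 1 - (real J / real y + real s) - (real J / real y + (real z)\<^sup>2) - 2 * (\<Sum>n=1..N. 1 / real n) / \<delta>\<^sup>2 \<le> real (card Gd)"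
proof -
  define M where "M = family_modulus y"
  have M0: "M > 0" unfolding M_def by (rule family_modulus_le) (use y in auto)
  obtain r where r: "0 < r" "r \<le> M" "coprime r M" "[r = 1] (mod 4)"
    "\<And>p. prime p \<Longrightarrow> 2 < p \<Longrightarrow> p \<le> y \<Longrightarrow> Legendre (int r) (int p) = e"
    using prescribed_residue_class[OF e, of y] unfolding M_def by blast
  define d where "d = (\<lambda>j. r + M * j)"
  have inj_d: "inj_on d A" for A using M0 by (auto simp: inj_on_def d_def)
  have dD: "real (d j) \<le> D" if "j < J" for j
  proof -
    have "d j \<le> M * J"
    proof -
      have "d j \<le> M * 1 + M * j" using r(2) by (simp add: d_def)
      also have "\<dots> = M * Suc j" by simp
      also have "\<dots> \<le> M * J" using that by (intro mult_left_mono) auto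
      finally show ?thesis .
    qed
    hence "real (d j) \<le> real M * real J" by (simp flip: of_nat_mult)
    also have "real J \<le> D / real M" unfolding J_def M_def using D by (intro of_nat_floor) auto
    hence "real M * real J \<le> D" using M0 by (simp add: field_simps)
    finally show ?thesis .
  qed
  have d4: "[d j = 1] (mod 4)" for j
  proof -
    obtain k where "M = 4 * k" by (auto simp: M_def family_modulus_def)
    hence "r + M * j = r + 4 * (k * j)" by simp
    hence "(r + M * j) mod 4 = r mod 4" by (simp only: mod_mult_self2)
    hence "[r + M * j = r] (mod 4)" by (simp only: unique_euclidean_semiring_class.cong_def)
    thus ?thesis using r(4) cong_trans unfolding d_def by blast
  qed
  have d_odd: "odd (d j)" for j
  proof -
    have "d j mod 4 = 1" using d4[of j] by (simp add: unique_euclidean_semiring_class.cong_def)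
    thus ?thesis by presburger
  qed
  define P where "P = {p::nat. prime p \<and> y < p \<and> p \<le> z}"
  have finP: "finite P" by (rule finite_subset[of _ "{..z}"]) (auto simp: P_def)
  define f where "f = (\<lambda>j. \<Sum>p\<in>P. real_of_int (Legendre (int (r + M * j)) (int p)) / real p)"
  define bad where "bad = (\<lambda>d. \<exists>u. Z \<le> real u \<and> u \<le> N \<and> \<bar>\<Sum>p | prime p \<and> p \<le> u. real_of_int (jac d (int p))\<bar> \<ge> \<delta> * real u)"
  define B1 where "B1 = {j. j < J \<and> \<not> squarefree (d j)}"
  define B2 where "B2 = {j. j < J \<and> \<bar>f j\<bar> > 1}"
  define B3 where "B3 = {j. j < J \<and> squarefree (d j) \<and> bad (d j)}"
  \<comment> \<open>The index 0 is dropped because r may be 1; every j \<ge> 1 gives a conductor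
    above 1.\<close>
  define Go where "Go = {..<J} - ({0} \<union> B1 \<union> B2 \<union> B3)"
  have fin: "finite B1" "finite B2" "finite B3" by (auto simp: B1_def B2_def B3_def)
  have c1: "real (card B1) \<le> real J / real y + real s"
    unfolding B1_def d_def
  proof (rule non_squarefree_count[OF r(3) M0])
    show "p > y" if "prime p" "\<not> p dvd M" for p
      using that unfolding M_def by (rule prime_not_dvd_family_modulus)
    fix j assume "j < J"
    hence "real (d j) \<le> (real s)\<^sup>2" using dD s by (meson order_trans)
    hence "real (d j) \<le> real (s\<^sup>2)" by simp
    hence "d j \<le> s\<^sup>2" by (simp only: of_nat_le_iff)
    thus "0 < r + M * j \<and> r + M * j \<le> s\<^sup>2" using r(1) by (simp add: d_def)
  qed (use y in auto)
  have c2: "real (card B2) \<le> real J / real y + (real z)\<^sup>2"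
  proof -
    have "real (card B2) = (\<Sum>j\<in>B2. 1)" by simp
    also have "\<dots> \<le> (\<Sum>j\<in>B2. (f j)\<^sup>2)"
    proof (rule sum_mono)
      fix j assume "j \<in> B2"
      hence "1 \<le> \<bar>f j\<bar>" by (simp add: B2_def)
      hence "1\<^sup>2 \<le> \<bar>f j\<bar>\<^sup>2" by (intro power_mono) auto
      thus "1 \<le> (f j)\<^sup>2" by simp
    qed
    also have "\<dots> \<le> (\<Sum>j<J. (f j)\<^sup>2)" by (rule sum_mono2) (auto simp: B2_def)
    also have "\<dots> \<le> real J * (\<Sum>p\<in>P. 1 / (real p)\<^sup>2) + (real (card P))\<^sup>2"
      unfolding f_def
    proof (rule second_moment[OF finP])
      fix p assume p: "p \<in> P"
      have "\<not> p dvd M"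
      proof
        assume "p dvd M"
        hence "p dvd 4 \<or> p dvd \<Prod>{p. prime p \<and> 2 < p \<and> p \<le> y}"
          using p by (simp add: M_def family_modulus_def prime_dvd_mult_iff P_def)
        thus False
        proof
          assume "p dvd 4"
          hence "p \<le> 4" by (intro dvd_imp_le) auto
          thus False using p y by (simp add: P_def)
        next
          assume "p dvd \<Prod>{p. prime p \<and> 2 < p \<and> p \<le> y}"
          then obtain q where q: "prime q" "q \<le> y" "p dvd q"
            using p by (auto simp: P_def prime_dvd_prod_iff)
          have "prime p" using p by (simp add: P_def)
          hence "p = q" using q(1,3) by (rule primes_dvd_imp_eq)
          thus False using p \<open>q \<le> y\<close> by (simp add: P_def)
        qed
      qed
      thus "prime p \<and> p > 2 \<and> coprime M p"
        using p y prime_imp_coprime[of p M] by (auto simp: P_def coprime_commute)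
    qed
    also have "\<dots> \<le> real J * (1 / real y) + (real z)\<^sup>2"
    proof (intro add_mono mult_left_mono power_mono)
      have "(\<Sum>p\<in>P. 1 / (real p)\<^sup>2) \<le> (\<Sum>p\<in>{y<..z}. 1 / (real p)\<^sup>2)"
        by (rule sum_mono2) (auto simp: P_def)
      also have "\<dots> \<le> 1 / real y" using y by (intro sum_inverse_squares_le) auto
      finally show "(\<Sum>p\<in>P. 1 / (real p)\<^sup>2) \<le> 1 / real y" .
      have "card P \<le> card {1..z}" by (intro card_mono) (auto simp: P_def dest: prime_gt_0_nat)
      thus "real (card P) \<le> real z" by simp
    qed auto
    finally show ?thesis by simp
  qed
  have c3: "real (card B3) \<le> 2 * (\<Sum>n=1..N. 1 / real n) / \<delta>\<^sup>2"
  proof -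
    define S where "S = d ` B3"
    have cardS: "card S = card B3" unfolding S_def by (rule card_image[OF inj_d])
    have finS: "finite S" using fin by (simp add: S_def)
    have S: "odd c \<and> squarefree c \<and> real c \<le> D" "bad c" "c > 0" if "c \<in> S" for c
    proof -
      obtain j where j: "c = d j" "j < J" "squarefree (d j)" "bad (d j)"
        using \<open>c \<in> S\<close> unfolding S_def B3_def by blast
      show "odd c \<and> squarefree c \<and> real c \<le> D" using j d_odd[of j] dD[of j] by blast
      show "bad c" using j by blast
      show "c > 0" unfolding j(1) d_def using r(1) by simp
    qed
    have "real (card S) \<le> D"
    proof -
      have "S \<subseteq> {1..nat \<lfloor>D\<rfloor>}"
      proof
        fix c assume "c \<in> S"
        thus "c \<in> {1..nat \<lfloor>D\<rfloor>}" using S(1)[of c] S(3)[of c] le_nat_floor[of c D] by simp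
      qed
      hence "card S \<le> card {1..nat \<lfloor>D\<rfloor>}" by (intro card_mono) simp_all
      hence "real (card S) \<le> real (nat \<lfloor>D\<rfloor>)" by simp
      also have "\<dots> \<le> D" using D by (intro of_nat_floor)
      finally show ?thesis .
    qed
    \<comment> \<open>Every biased conductor brings its own length at which the bias shows, which is
      why the large sieve admits lengths depending on d.\<close>
    define u where "u = (\<lambda>c. SOME u. Z \<le> real u \<and> u \<le> N \<and>
        \<bar>\<Sum>p | prime p \<and> p \<le> u. real_of_int (jac c (int p))\<bar> \<ge> \<delta> * real u)"
    have u: "Z \<le> real (u c) \<and> u c \<le> N \<and>
        \<bar>\<Sum>p | prime p \<and> p \<le> u c. real_of_int (jac c (int p))\<bar> \<ge> \<delta> * real (u c)" if "c \<in> S" for c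
      unfolding u_def by (rule someI_ex) (use S(2)[OF that] in \<open>simp add: bad_def\<close>)
    define a where "a = (\<lambda>n::nat. if prime n then 1 else 0 :: real)"
    have "\<delta>\<^sup>2 * real (card S) \<le> 2 * (\<Sum>n=1..N. 1 / real n)"
    proof (rule large_sieve_exceptions[OF finS S(1), where a = a and u = u and Z = Z])
      fix c assume c: "c \<in> S"
      have "(\<Sum>n=1..u c. a n * real_of_int (jac c (int n))) = (\<Sum>p | prime p \<and> p \<le> u c. real_of_int (jac c (int p)))"
        by (intro sum.mono_neutral_cong_right) (auto simp: a_def Suc_le_eq dest: prime_gt_0_nat)
      thus "\<delta> * real (u c) \<le> \<bar>\<Sum>n=1..u c. a n * real_of_int (jac c (int n))\<bar>" using u[OF c] by simp
    next
      show "\<bar>a n\<bar> \<le> 1" for n by (simp add: a_def)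
    next
      show "Z \<le> real (u c) \<and> u c \<le> N" if "c \<in> S" for c using u[OF that] by blast
    qed (use \<delta> Z \<open>real (card S) \<le> D\<close> in \<open>simp_all\<close>)
    thus ?thesis using \<delta> cardS by (simp add: field_simps)
  qed
  have "Gd \<subseteq> {n. real n \<le> D}" by (auto simp: Gd_def)
  hence finGd: "finite Gd" by (rule finite_subset) simp
  have sub: "d ` Go \<subseteq> Gd"
  proof
    fix c assume "c \<in> d ` Go"
    then obtain j where j: "c = d j" "j < J" "j \<noteq> 0" "squarefree (d j)" "\<not> \<bar>f j\<bar> > 1" "\<not> bad (d j)"
      by (auto simp: Go_def B1_def B2_def B3_def)
    \<comment> \<open>Reciprocity links the character at p to the position of d j modulo p: at p
      \<le> y this is fixed by r, and at larger p it varies with j as in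
      \<open>second_moment\<close>.\<close>
    have rec: "jac (d j) (int p) = Legendre (int (d j)) (int p)" if "prime p" "p > 2" for p
      by (rule jac_reciprocity[OF d_odd j(4) d4 that])
    have "M * j > 0" using M0 j(3) by simp
    hence "d j > 1" unfolding d_def using r(1) by linarith
    moreover have "jac (d j) (int p) = e" if p: "prime p" "2 < p" "p \<le> y" for p
    proof -
      have "p dvd M" using prime_not_dvd_family_modulus[OF p(1), of y] p(3) unfolding M_def by linarith
      hence "[int (d j) = int r] (mod int p)"
        unfolding d_def by (simp add: cong_iff_dvd_diff)
      hence "Legendre (int (d j)) (int p) = Legendre (int r) (int p)" by (rule Legendre_cong)
      thus ?thesis using r(5)[OF p] rec p by simp
    qed
    moreover have "(\<Sum>p | prime p \<and> y < p \<and> p \<le> z. real_of_int (jac (d j) (int p)) / real p) = f j"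
      unfolding f_def P_def by (intro sum.cong refl) (use rec y in \<open>auto simp: d_def\<close>)
    ultimately have "odd (d j) \<and> squarefree (d j) \<and> d j > 1 \<and> real (d j) \<le> D \<and>
      (\<forall>p. prime p \<and> 2 < p \<and> p \<le> y \<longrightarrow> jac (d j) (int p) = e) \<and>
      \<bar>\<Sum>p | prime p \<and> y < p \<and> p \<le> z. real_of_int (jac (d j) (int p)) / real p\<bar> \<le> 1"
      using j(4,5) d_odd[of j] dD[OF j(2)] by simp
    moreover have "\<bar>\<Sum>p | prime p \<and> p \<le> u. real_of_int (jac (d j) (int p))\<bar> < \<delta> * real u"
      if "Z \<le> real u" "u \<le> N" for u
      using j(6) that unfolding bad_def by (meson not_le)
    ultimately show "c \<in> Gd" unfolding Gd_def j(1) by blast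
  qed
  have "card Go = card (d ` Go)" by (simp add: card_image[OF inj_d])
  also have "\<dots> \<le> card Gd" by (rule card_mono[OF finGd sub])
  finally have "card Go \<le> card Gd" .
  moreover have "J \<le> card Go + (1 + card B1 + card B2 + card B3)"
  proof -
    have "card {..<J} \<le> card (Go \<union> ({0} \<union> B1 \<union> B2 \<union> B3))"
      by (rule card_mono) (use fin in \<open>auto simp: Go_def\<close>)
    also have "\<dots> \<le> card Go + card ({0} \<union> B1 \<union> B2 \<union> B3)" by (rule card_Un_le)
    also have "card ({0} \<union> B1 \<union> B2 \<union> B3) \<le> card ({0} \<union> B1 \<union> B2) + card B3" by (rule card_Un_le)
    also have "card ({0} \<union> B1 \<union> B2) \<le> card ({0} \<union> B1) + card B2" by (rule card_Un_le)
    also have "card ({0} \<union> B1) \<le> card {0::nat} + card B1" by (rule card_Un_le)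
    finally show ?thesis by simp
  qed
  ultimately show ?thesis using c1 c2 c3 by linarith
qed

text \<open>Let D = exp (sqrt (ln x)). The modulus is at most 4Y with 16 Y \<le> D^\<kappa>, so J
  \<ge> 4 D^(1 - \<kappa>) - 1. The two losses J / y \<le> J / 4 leave half of J, and all other
  terms together are at most D^(3/4) \<le> D^(1 - \<kappa>).\<close>

lemma good_count_asymptotic:
  assumes "\<epsilon> > 0"
  shows "\<forall>\<^sub>F x in at_top. \<forall>(y::nat) (z::nat) (s::nat) (J::nat) H.
    4 \<le> y \<and> real y \<le> ln x powr (1/4) \<and> real z \<le> exp (sqrt (ln x) / 8) \<and> real s \<le> sqrt (exp (sqrt (ln x))) + 1 \<and>
    real J \<ge> exp (sqrt (ln x)) / real (family_modulus y) - 1 \<and> H \<le> 1 + ln x \<longrightarrow>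
    exp (sqrt (ln x)) powr (1 - \<epsilon>) \<le>
      real J - 1 - (real J / real y + real s) - (real J / real y + (real z)\<^sup>2) - 2 * H / (1 / (ln x)\<^sup>2)\<^sup>2"
proof -
  \<comment> \<open>The cap 1/4 secures D^(3/4) \<le> D^(1 - \<kappa>) also when \<epsilon> is
    large.\<close>
  define \<kappa> where "\<kappa> = min \<epsilon> (1/4)"
  have \<kappa>: "\<kappa> > 0" "\<kappa> \<le> \<epsilon>" "\<kappa> \<le> 1/4" using assms by (auto simp: \<kappa>_def)
  have "((\<lambda>x::real. (ln 16 + ln x powr (1/4) * ln (ln x powr (1/4))) / sqrt (ln x)) \<longlongrightarrow> 0) at_top"
    by real_asymp
  hence "\<forall>\<^sub>F x::real in at_top. (ln 16 + ln x powr (1/4) * ln (ln x powr (1/4))) / sqrt (ln x) < \<kappa>"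
    by (rule order_tendstoD) (use \<kappa> in auto)
  moreover have "\<forall>\<^sub>F x::real in at_top. ln x > 1 \<and>
     2 + (sqrt (exp (sqrt (ln x))) + 1) + (exp (sqrt (ln x) / 8))\<^sup>2 + 2 * (1 + ln x) * (ln x) ^ 4 \<le> exp (3 / 4 * sqrt (ln x))"
    by (intro eventually_conj; real_asymp)
  ultimately show ?thesis
  proof eventually_elim
    case (elim x)
    show ?case
    proof (intro allI impI, elim conjE)
      fix y z s J :: nat and H :: real
      assume y: "4 \<le> y" "real y \<le> ln x powr (1/4)" and z: "real z \<le> exp (sqrt (ln x) / 8)"
        and s: "real s \<le> sqrt (exp (sqrt (ln x))) + 1"
        and J: "real J \<ge> exp (sqrt (ln x)) / real (family_modulus y) - 1" and H: "H \<le> 1 + ln x"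
      define L where "L = ln x"
      define D where "D = exp (sqrt L)"
      define v where "v = L powr (1/4)"
      define Y where "Y = exp (v * ln v)"
      have L: "L > 1" using elim by (simp add: L_def)
      have v: "v \<ge> 4" "real y \<le> v" using y by (auto simp: v_def L_def)
      define E where "E = exp ((1 - \<kappa>) * sqrt L)"
      have "16 * Y \<le> exp (\<kappa> * sqrt L)"
      proof -
        have "ln 16 + v * ln v \<le> \<kappa> * sqrt L" using elim L by (simp add: v_def L_def field_simps)
        hence "exp (ln 16 + v * ln v) \<le> exp (\<kappa> * sqrt L)" by simp
        thus ?thesis by (simp add: exp_add Y_def)
      qed
      hence "16 * Y * E \<le> exp (\<kappa> * sqrt L) * E" by (intro mult_right_mono) (auto simp: E_def)
      also have "\<dots> = D" by (simp add: E_def D_def algebra_simps flip: exp_add)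
      finally have YE: "16 * Y * E \<le> D" .
      have Ypos: "Y > 0" by (simp add: Y_def)
      have MY: "real (family_modulus y) \<le> 4 * Y"
      proof -
        have "real (y ^ y) = real y powr real y" using y by (simp add: powr_realpow)
        also have "\<dots> \<le> v powr real y" using v y by (intro powr_mono2) auto
        also have "\<dots> \<le> v powr v" using v by (intro powr_mono) auto
        also have "\<dots> = Y" using v by (simp add: powr_def Y_def)
        finally have "real (y ^ y) \<le> Y" .
        moreover have "real (family_modulus y) \<le> real (4 * y ^ y)"
          using family_modulus_le(2)[of y] y by (simp only: of_nat_le_iff)
        ultimately show ?thesis by simp
      qed
      have Mpos: "real (family_modulus y) > 0" using family_modulus_le(1)[of y] y by simp
      have "4 * E \<le> D / real (family_modulus y)"
      proof -
        have "4 * E * real (family_modulus y) \<le> 4 * E * (4 * Y)" using MY by (intro mult_left_mono) (auto simp: E_def)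
        also have "\<dots> \<le> D" using YE by (simp add: mult_ac)
        finally show ?thesis using Mpos by (simp add: field_simps)
      qed
      hence J1: "real J \<ge> 4 * E - 1" using J by (simp add: D_def L_def)
      have Jy: "real J / real y \<le> real J / 4" using y by (intro divide_left_mono) auto
      have z2: "(real z)\<^sup>2 \<le> (exp (sqrt L / 8))\<^sup>2" using z by (intro power_mono) (auto simp: L_def)
      have H2: "2 * H / (1 / L\<^sup>2)\<^sup>2 \<le> 2 * (1 + L) * L ^ 4"
      proof -
        have "2 * H / (1 / L\<^sup>2)\<^sup>2 = 2 * H * L ^ 4" using L by (simp add: power_divide flip: power_mult)
        also have "\<dots> \<le> 2 * (1 + L) * L ^ 4" using H L by (intro mult_right_mono) (auto simp: L_def)
        finally show ?thesis .
      qed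
      have E34: "exp (3 / 4 * sqrt L) \<le> E"
      proof -
        have "3 / 4 * sqrt L \<le> (1 - \<kappa>) * sqrt L" using \<kappa> L by (intro mult_right_mono) auto
        thus ?thesis by (simp add: E_def)
      qed
      have rest: "2 + (sqrt D + 1) + (exp (sqrt L / 8))\<^sup>2 + 2 * (1 + L) * L ^ 4 \<le> exp (3 / 4 * sqrt L)"
        using elim by (simp only: D_def L_def)
      have "exp (sqrt L) powr (1 - \<epsilon>) \<le> E"
      proof -
        have "(1 - \<epsilon>) * sqrt L \<le> (1 - \<kappa>) * sqrt L" using \<kappa> L by (intro mult_right_mono) auto
        thus ?thesis by (simp add: E_def powr_def)
      qed
      also have "E \<le> real J - 1 - (real J / real y + real s) - (real J / real y + (real z)\<^sup>2) - 2 * H / (1 / L\<^sup>2)\<^sup>2"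
      proof -
        have "real s \<le> sqrt D + 1" using s by (simp add: D_def L_def)
        thus ?thesis using J1 Jy z2 H2 E34 rest by linarith
      qed
      finally show "exp (sqrt (ln x)) powr (1 - \<epsilon>) \<le>
        real J - 1 - (real J / real y + real s) - (real J / real y + (real z)\<^sup>2) - 2 * H / (1 / (ln x)\<^sup>2)\<^sup>2"
        by (simp add: L_def)
    qed
  qed
qed

theorem theorem1p5:
  "\<exists>C::real. C > 0 \<and>
     (let D = (\<lambda>x::real. exp (C * (ln x) powr (1/2))) in
      \<forall>\<eta>\<in>{-1, 1 :: complex}. \<forall>\<epsilon>::real. \<epsilon> > 0 \<longrightarrow>
        (\<exists>K::real. \<forall>\<^sub>F x in at_top.
           real (card {d :: nat. d > 0 \<and> real d \<le> D x \<and>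
             (\<exists>\<chi>. quadratic_character d \<chi> \<and>
               (\<exists>E::real. \<bar>E\<bar> \<le> K \<and>
                 real (prime_product_count x (\<lambda>p q. \<chi> (int p) = \<eta> \<and> \<chi> (int q) = \<eta>))
                 / (1/4 * real (prime_product_count x (\<lambda>p q. coprime (p * q) d)))
                 \<le> 1 - (ln (ln (ln x)) + E) / ln (ln x)))})
           \<ge> D x powr (1 - \<epsilon>)))"
proof -
  obtain K4 where K4: "K4 \<ge> 0" and bias: "\<forall>\<^sub>F x in at_top. \<forall>(X :: nat \<Rightarrow> real) d e.
     (\<forall>n. X n \<in> {-1, 0, 1}) \<and> d > 0 \<and> real d \<le> exp (sqrt (ln x)) \<and> (\<forall>q. prime q \<longrightarrow> X q = 0 \<longrightarrow> q dvd d) \<and>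
     e \<in> {-1, 1} \<and> (\<forall>p. prime p \<longrightarrow> p > 2 \<longrightarrow> real p \<le> ln x powr (1/4) \<longrightarrow> X p = -e) \<and>
     \<bar>\<Sum>p | prime p \<and> ln x powr (1/4) < real p \<and> real p \<le> exp (sqrt (ln x) / 8). X p / real p\<bar> \<le> 1 \<and>
     (\<forall>u. exp (4 * sqrt (ln x)) \<le> u \<longrightarrow> u \<le> x \<longrightarrow> \<bar>\<Sum>p | prime p \<and> real p \<le> u. X p\<bar> \<le> 1 / (ln x)\<^sup>2 * u) \<longrightarrow>
     4 * real (prime_product_count x (\<lambda>p q. X p = e \<and> X q = e)) \<le>
       real (prime_product_count x (\<lambda>p q. X p \<noteq> 0 \<and> X q \<noteq> 0)) - x / ln x * (ln (ln (ln x)) - K4)"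
    using character_bias_bound by blast
  obtain K5 where K5: "K5 \<ge> 0" and upper:
    "\<forall>\<^sub>F x in at_top. \<forall>R. real (prime_product_count x R) \<le> x / ln x * (ln (ln x) + K5)"
    using prime_product_count_upper by blast
  have lnln: "\<forall>\<^sub>F x::real in at_top. ln (ln (ln x)) > K4 + K5"
    by (rule eventually_compose_filterlim[OF eventually_gt_at_top]) real_asymp
  have misc: "\<forall>\<^sub>F x::real in at_top. x > 1 \<and> ln x > 1 \<and> ln (ln x) > 1 \<and> ln (ln (ln x)) \<le> ln (ln x) \<and>
      ln x powr (1/4) \<ge> 5 \<and> exp (4 * sqrt (ln x)) - 1 \<ge> 2 * exp (sqrt (ln x)) ^ 3 \<and> exp (4 * sqrt (ln x)) - 1 > 0"
    by (intro eventually_conj; real_asymp)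
  have main: "\<forall>\<^sub>F x in at_top.
           real (card {d :: nat. d > 0 \<and> real d \<le> exp (1 * (ln x) powr (1/2)) \<and>
             (\<exists>\<chi>. quadratic_character d \<chi> \<and>
               (\<exists>E::real. \<bar>E\<bar> \<le> K4 + K5 \<and>
                 real (prime_product_count x (\<lambda>p q. \<chi> (int p) = \<eta> \<and> \<chi> (int q) = \<eta>))
                 / (1/4 * real (prime_product_count x (\<lambda>p q. coprime (p * q) d)))
                 \<le> 1 - (ln (ln (ln x)) + E) / ln (ln x)))})
           \<ge> exp (1 * (ln x) powr (1/2)) powr (1 - \<epsilon>)"
    if \<eta>: "\<eta> \<in> {-1, 1 :: complex}" and \<epsilon>: "\<epsilon> > 0" for \<eta> \<epsilon>
  proof -
    define e :: int where "e = (if \<eta> = 1 then 1 else -1)"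
    have e: "e = 1 \<or> e = -1" "\<eta> = of_int e" using \<eta> by (auto simp: e_def)
    show ?thesis
      using bias upper lnln misc good_count_asymptotic[OF \<epsilon>]
    proof eventually_elim
      case (elim x)
      define L where "L = ln x"
      define D where "D = exp (sqrt L)"
      define y where "y = nat \<lfloor>L powr (1/4)\<rfloor>"
      define z where "z = nat \<lfloor>exp (sqrt L / 8)\<rfloor>"
      \<comment> \<open>A prime whose square divides a positive d \<le> D is at most sqrt D.\<close>
      define s where "s = nat \<lceil>sqrt D\<rceil>"
      define N where "N = nat \<lfloor>x\<rfloor>"
      \<comment> \<open>Lowered by 1 because a real u \<ge> exp (4 sqrt L) will be replaced by its
        integer part, which may fall just short of that bound.\<close>
      define Z where "Z = exp (4 * sqrt L) - 1"
      define \<delta> where "\<delta> = 1 / L\<^sup>2"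
      define J where "J = nat \<lfloor>D / real (family_modulus y)\<rfloor>"
      define Gd where "Gd = {d. odd d \<and> squarefree d \<and> d > 1 \<and> real d \<le> D \<and>
        (\<forall>p. prime p \<and> 2 < p \<and> p \<le> y \<longrightarrow> jac d (int p) = -e) \<and>
        \<bar>\<Sum>p | prime p \<and> y < p \<and> p \<le> z. real_of_int (jac d (int p)) / real p\<bar> \<le> 1 \<and>
        (\<forall>u. Z \<le> real u \<and> u \<le> N \<longrightarrow> \<bar>\<Sum>p | prime p \<and> p \<le> u. real_of_int (jac d (int p))\<bar> < \<delta> * real u)}"
      have x: "x > 1" "L > 1" using elim by (auto simp: L_def)
      have Dx: "exp (1 * (ln x) powr (1/2)) = D" using x by (simp add: D_def L_def powr_half_sqrt)
      have y: "y \<ge> 4" "real y \<le> L powr (1/4)" using elim unfolding y_def L_def by (linarith, simp add: of_nat_floor)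
      have z: "real z \<le> exp (sqrt L / 8)" unfolding z_def by (intro of_nat_floor) simp
      have s: "D \<le> (real s)\<^sup>2" "real s \<le> sqrt D + 1"
      proof -
        have "sqrt D \<le> real s" unfolding s_def by linarith
        hence "(sqrt D)\<^sup>2 \<le> (real s)\<^sup>2" by (intro power_mono) (auto simp: D_def)
        thus "D \<le> (real s)\<^sup>2" by (simp add: D_def)
        have "sqrt D \<ge> 0" by (simp add: D_def)
        thus "real s \<le> sqrt D + 1" unfolding s_def by linarith
      qed
      have Z: "Z > 0" "Z \<ge> 2 * D ^ 3" using elim by (simp_all only: Z_def D_def L_def)
      \<comment> \<open>The prescribed value is -e, so that the small odd primes avoid
        \<eta>.\<close>
      have count: "real J - 1 - (real J / real y + real s) - (real J / real y + (real z)\<^sup>2) - 2 * (\<Sum>n=1..N. 1 / real n) / \<delta>\<^sup>2 \<le> real (card Gd)"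
        unfolding Gd_def J_def
        by (rule good_discriminants_count) (use e y s Z x in \<open>auto simp: D_def \<delta>_def\<close>)
      have "D powr (1 - \<epsilon>) \<le> real J - 1 - (real J / real y + real s) - (real J / real y + (real z)\<^sup>2) - 2 * (\<Sum>n=1..N. 1 / real n) / \<delta>\<^sup>2"
      proof -
        have "real J \<ge> D / real (family_modulus y) - 1" unfolding J_def by linarith
        moreover have "(\<Sum>n=1..N. 1 / real n) \<le> 1 + ln x"
        proof -
          have N: "N \<ge> 1" "real N \<le> x" using x unfolding N_def by linarith+
          have "(\<Sum>n=1..N. 1 / real n) \<le> 1 + ln (real N)" by (rule harmonic_sum_le[OF N(1)])
          also have "ln (real N) \<le> ln x" using N by simp
          finally show ?thesis by simp
        qed
        ultimately show ?thesis
          using elim(5)[rule_format, of y z s J "\<Sum>n=1..N. 1 / real n"] y z s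
          unfolding D_def L_def \<delta>_def by blast
      qed
      hence low: "D powr (1 - \<epsilon>) \<le> real (card Gd)" using count by linarith
      define Tgt where "Tgt = {d :: nat. d > 0 \<and> real d \<le> D \<and>
             (\<exists>\<chi>. quadratic_character d \<chi> \<and>
               (\<exists>E::real. \<bar>E\<bar> \<le> K4 + K5 \<and>
                 real (prime_product_count x (\<lambda>p q. \<chi> (int p) = \<eta> \<and> \<chi> (int q) = \<eta>))
                 / (1/4 * real (prime_product_count x (\<lambda>p q. coprime (p * q) d)))
                 \<le> 1 - (ln (ln (ln x)) + E) / ln (ln x)))}"
      have "Gd \<subseteq> Tgt"
      proof
        fix d assume "d \<in> Gd"
        hence d: "odd d" "squarefree d" "d > 1" "real d \<le> D"
          "\<And>p. prime p \<Longrightarrow> 2 < p \<Longrightarrow> p \<le> y \<Longrightarrow> jac d (int p) = -e"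
          "\<bar>\<Sum>p | prime p \<and> y < p \<and> p \<le> z. real_of_int (jac d (int p)) / real p\<bar> \<le> 1"
          "\<And>u. Z \<le> real u \<Longrightarrow> u \<le> N \<Longrightarrow> \<bar>\<Sum>p | prime p \<and> p \<le> u. real_of_int (jac d (int p))\<bar> < \<delta> * real u"
          unfolding Gd_def by blast+
        define X where "X = (\<lambda>n. real_of_int (jac d (int n)))"
        define \<chi> where "\<chi> = (\<lambda>a. complex_of_int (jac d a))"
        have quad: "quadratic_character d \<chi>" unfolding \<chi>_def by (rule jac_quadratic_character[OF d(1-3)])
        have X_eq: "(\<lambda>p q. X p = real_of_int e \<and> X q = real_of_int e) = (\<lambda>p q. \<chi> (int p) = \<eta> \<and> \<chi> (int q) = \<eta>)"
          by (simp add: X_def \<chi>_def e(2) fun_eq_iff)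
        have X_cop: "(\<lambda>p q. X p \<noteq> 0 \<and> X q \<noteq> 0) = (\<lambda>p q. coprime (p * q) d)"
          using jac_eq_0_iff[of d] d(3) by (simp add: X_def fun_eq_iff)
        have "4 * real (prime_product_count x (\<lambda>p q. X p = real_of_int e \<and> X q = real_of_int e)) \<le>
          real (prime_product_count x (\<lambda>p q. X p \<noteq> 0 \<and> X q \<noteq> 0)) - x / ln x * (ln (ln (ln x)) - K4)"
        proof (rule elim(1)[THEN spec[of _ X], THEN spec[of _ d], THEN spec[of _ "real_of_int e"], THEN mp], intro conjI allI impI)
          fix n
          have "jac d (int n) = -1 \<or> jac d (int n) = 0 \<or> jac d (int n) = 1"
            using abs_jac_le[of d "int n"] by linarith
          thus "X n \<in> {-1, 0, 1}" by (auto simp: X_def)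
        next
          show "d > 0" "real d \<le> exp (sqrt (ln x))" using d by (auto simp: D_def L_def)
        next
          fix q assume "prime q" "X q = 0"
          hence "\<not> coprime q d" using jac_eq_0_iff[of d "int q"] d(3) by (simp add: X_def)
          thus "q dvd d" using \<open>prime q\<close> prime_imp_coprime by blast
        next
          show "real_of_int e \<in> {-1, 1}" using e by auto
        next
          fix p assume p: "prime p" "p > 2" "real p \<le> ln x powr (1/4)"
          hence "p \<le> y" by (simp add: y_def L_def le_nat_floor)
          thus "X p = -real_of_int e" using d(5) p by (simp add: X_def)
        next
          have "{p. prime p \<and> ln x powr (1/4) < real p \<and> real p \<le> exp (sqrt (ln x) / 8)} = {p. prime p \<and> y < p \<and> p \<le> z}"
          proof -
            have "real p \<le> b \<longleftrightarrow> p \<le> nat \<lfloor>b\<rfloor>" if "b \<ge> 0" for p b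
              using that by (metis le_nat_floor of_nat_floor of_nat_le_iff order_trans)
            from this[of "ln x powr (1/4)"] this[of "exp (sqrt (ln x) / 8)"]
            show ?thesis unfolding y_def z_def L_def by (auto simp flip: not_le)
          qed
          thus "\<bar>\<Sum>p | prime p \<and> ln x powr (1/4) < real p \<and> real p \<le> exp (sqrt (ln x) / 8). X p / real p\<bar> \<le> 1"
            using d(6) by (simp add: X_def)
        next
          fix u assume u: "exp (4 * sqrt (ln x)) \<le> u" "u \<le> x"
          define k where "k = nat \<lfloor>u\<rfloor>"
          have u0: "u \<ge> 0" using u(1) by (meson exp_ge_zero order_trans)
          have k: "Z \<le> real k" "k \<le> N" "real k \<le> u"
            using u u0 unfolding Z_def L_def k_def N_def by (linarith, simp add: nat_mono floor_mono, simp add: of_nat_floor)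
          have "{p. prime p \<and> real p \<le> u} = {p. prime p \<and> p \<le> k}"
          proof -
            have "real p \<le> u \<longleftrightarrow> p \<le> k" for p
              using u0 unfolding k_def by (metis le_nat_floor of_nat_floor of_nat_le_iff order_trans)
            thus ?thesis by simp
          qed
          hence "\<bar>\<Sum>p | prime p \<and> real p \<le> u. X p\<bar> < \<delta> * real k" using d(7)[OF k(1,2)] by (simp add: X_def)
          also have "\<dots> \<le> \<delta> * u" using k by (intro mult_left_mono) (auto simp: \<delta>_def)
          finally show "\<bar>\<Sum>p | prime p \<and> real p \<le> u. X p\<bar> \<le> 1 / (ln x)\<^sup>2 * u" by (simp add: \<delta>_def L_def)
        qed
        hence "4 * real (prime_product_count x (\<lambda>p q. \<chi> (int p) = \<eta> \<and> \<chi> (int q) = \<eta>)) \<le>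
          real (prime_product_count x (\<lambda>p q. coprime (p * q) d)) - x / ln x * (ln (ln (ln x)) - K4)"
          by (simp only: X_eq X_cop)
        \<comment> \<open>The witness E = -(K4 + K5) is the same for all x and d.\<close>
        hence "real (prime_product_count x (\<lambda>p q. \<chi> (int p) = \<eta> \<and> \<chi> (int q) = \<eta>))
                 / (1/4 * real (prime_product_count x (\<lambda>p q. coprime (p * q) d)))
                 \<le> 1 - (ln (ln (ln x)) + -(K4 + K5)) / ln (ln x)"
          by (rule ratio_from_difference) (use elim K4 K5 in auto)
        moreover have "\<bar>-(K4 + K5)\<bar> \<le> K4 + K5" using K4 K5 by simp
        ultimately show "d \<in> Tgt" unfolding Tgt_def using quad d(3,4) by auto
      qed
      moreover have "finite Tgt" by (rule finite_subset[of _ "{n. real n \<le> D}"]) (auto simp: Tgt_def)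
      ultimately have "real (card Gd) \<le> real (card Tgt)" by (simp add: card_mono)
      with low have "D powr (1 - \<epsilon>) \<le> real (card Tgt)" by linarith
      thus ?case unfolding Tgt_def Dx .
    qed
  qed
  show ?thesis
    unfolding Let_def
  \<comment> \<open>With C = 1 the bound D(x) is exp (sqrt (ln x)); the exponents 4 and 1/8 of the
    two other ranges are fitted to this choice.\<close>
  proof (rule exI[of _ 1], intro conjI ballI allI impI)
    fix \<eta> :: complex and \<epsilon> :: real assume "\<eta> \<in> {-1, 1}" "\<epsilon> > 0"
    from main[OF this]
    show "\<exists>K::real. \<forall>\<^sub>F x in at_top.
           real (card {d :: nat. d > 0 \<and> real d \<le> exp (1 * (ln x) powr (1/2)) \<and>
             (\<exists>\<chi>. quadratic_character d \<chi> \<and>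
               (\<exists>E::real. \<bar>E\<bar> \<le> K \<and>
                 real (prime_product_count x (\<lambda>p q. \<chi> (int p) = \<eta> \<and> \<chi> (int q) = \<eta>))
                 / (1/4 * real (prime_product_count x (\<lambda>p q. coprime (p * q) d)))
                 \<le> 1 - (ln (ln (ln x)) + E) / ln (ln x)))})
           \<ge> exp (1 * (ln x) powr (1/2)) powr (1 - \<epsilon>)"
      by (rule exI[of _ "K4 + K5"])
  qed simp
qed

end
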